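(* Let $\gamma>0$ and let $m$ be a positive integer. Let $X_m^{(s)}$ be the space of spherically symmetric functions $u=u(|x|):\mathbb{R}^2\to\mathbb{C}$ with $$\int_{\mathbb{R}^2}\Big(|\partial_r u|^2+\frac{m^2}{r^2}|u|^2+|u|^2+\ln(1+r)|u|^2\Big)dx<\infty,\quad r=|x|,$$ and define $$E_m(u)=\int_{\mathbb{R}^2}\Big(|\partial_r u|^2+\frac{m^2}{r^2}|u|^2\Big)dx+\frac{\gamma}{4\pi}\int_{\mathbb{R}^2}\int_{\mathbb{R}^2}\ln(|x-y|)|u(x)|^2|u(y)|^2\,dx\,dy,$$ $N(u)=\int_{\mathbb{R}^2}|u|^2dx$, and $e_m(\lambda)=\inf\{E_m(u):u\in X_m^{(s)},N(u)=\lambda\}$. Then for every $\lambda>0$ there exists a nonnegative $u_\lambda\in X_m^{(s)}$ with $N(u_\lambda)=\lambda$ and $E_m(u_\lambda)=e_m(\lambda)$.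
   Context: $\gamma>0$ is a fixed coupling constant. *)

theory Defs
  imports "HOL-Analysis.Analysis"
begin

type_synonym pt2 = "real^2"

text \<open>g is a (weak) radial derivative of the profile f on (0,inf):
f is locally absolutely continuous on (0,inf) with derivative g.\<close>
definition radial_deriv :: "(real \<Rightarrow> complex) \<Rightarrow> (real \<Rightarrow> complex) \<Rightarrow> bool" where
  "radial_deriv f g \<longleftrightarrow> g \<in> borel_measurable borel \<and>
     (\<forall>a b. 0 < a \<longrightarrow> a \<le> b \<longrightarrow>
        set_integrable lborel {a..b} g \<and> f b - f a = (LINT t:{a..b}|lborel. g t))"

definition radial_with :: "(pt2 \<Rightarrow> complex) \<Rightarrow> (real \<Rightarrow> complex) \<Rightarrow> (real \<Rightarrow> complex) \<Rightarrow> bool" where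
  "radial_with u f g \<longleftrightarrow> u = (\<lambda>x. f (norm x)) \<and> radial_deriv f g"

text \<open>partial_r u, as a function on R^2 (determined a.e.).\<close>
definition dr :: "(pt2 \<Rightarrow> complex) \<Rightarrow> pt2 \<Rightarrow> complex" where
  "dr u = (let g = (SOME g. \<exists>f. radial_with u f g) in (\<lambda>x. g (norm x)))"

definition Xs :: "nat \<Rightarrow> (pt2 \<Rightarrow> complex) set" where
  "Xs m = {u. (\<exists>f g. radial_with u f g) \<and> u \<in> borel_measurable lborel \<and>
     (\<integral>\<^sup>+ x. ennreal ((cmod (dr u x))\<^sup>2 + (real m)\<^sup>2 / (norm x)\<^sup>2 * (cmod (u x))\<^sup>2
                 + (cmod (u x))\<^sup>2 + ln (1 + norm x) * (cmod (u x))\<^sup>2) \<partial>lborel) < \<infinity>}"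

definition Nrm :: "(pt2 \<Rightarrow> complex) \<Rightarrow> real" where
  "Nrm u = (\<integral>x. (cmod (u x))\<^sup>2 \<partial>lborel)"

definition Em :: "real \<Rightarrow> nat \<Rightarrow> (pt2 \<Rightarrow> complex) \<Rightarrow> real" where
  "Em \<gamma> m u = (\<integral>x. (cmod (dr u x))\<^sup>2 + (real m)\<^sup>2 / (norm x)\<^sup>2 * (cmod (u x))\<^sup>2 \<partial>lborel)
     + \<gamma> / (4 * pi) * (\<integral>z. (case z of (x, y) \<Rightarrow>
          ln (dist x y) * (cmod (u x))\<^sup>2 * (cmod (u y))\<^sup>2) \<partial>(lborel \<Otimes>\<^sub>M lborel))"

definition em :: "real \<Rightarrow> nat \<Rightarrow> real \<Rightarrow> ereal" where
  "em \<gamma> m lam = (INF u \<in> {u \<in> Xs m. Nrm u = lam}. ereal (Em \<gamma> m u))"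

end

theory Submission
  imports Defs "HOL-Complex_Analysis.Great_Picard"
begin

text \<open>
  Put \<open>t = ln r\<close> and let \<open>h t\<close> be the modulus of the profile at radius \<open>exp t\<close>. The kinetic part becomes
  \<open>2 \<pi>\<close> times the integral of \<open>h'\<^sup>2 + m\<^sup>2 h\<^sup>2\<close> over the line. Averaging \<open>ln |x - y|\<close> over rotations of
  \<open>y\<close> (mean value property of \<open>ln |1 - z|\<close>) replaces it by \<open>ln (max |x| |y|)\<close>, so the interaction becomes the
  double integral of \<open>max s t\<close> against \<open>h\<^sup>2\<close> times the radial measure \<open>2 \<pi> exp (2 t) dt\<close>. Since
  \<open>max s t \<ge> t\<close> and \<open>|t| \<le> \<epsilon> exp (- 2 t) + 1 / (4 \<epsilon>)\<close> for \<open>t < 0\<close>, the energy controls the integrals of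
  \<open>h'\<^sup>2\<close>, \<open>h\<^sup>2\<close> and \<open>|t| h\<^sup>2\<close>. The profiles of a minimising sequence are thus bounded and uniformly
  Hoelder continuous, a subsequence converges pointwise, no mass escapes, and Fatou's lemma gives lower
  semicontinuity. The derivative of the limit is recovered from its dyadic difference quotients, whose
  \<open>L\<^sup>2\<close> norms pass to the limit and do not increase when a profile is replaced by its modulus;
  this also yields a nonnegative minimiser.
\<close>

section \<open>Radial integration and rotations\<close>

text \<open>The energy has no sign and its derivative part passes to no pointwise limit; this shapes
  the proof. Near the origin the negative logarithm is beaten only by the centrifugal term: as
  \<open>m > 0\<close>, that term is a multiple of the plain square norm of \<open>h\<close> in
  \<open>t\<close>, which together with the derivative gives an H^1 norm on the line. The
  derivatives of a minimising sequence need not converge, but dyadic quotients involve values of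
  \<open>h\<close> only, so they follow pointwise limits; being a martingale bounded in square mean,
  they rebuild a derivative of the limit without weak compactness. Taking moduli destroys the
  identity between increments and integrals of the derivative, so the minimising profiles carry
  merely a bound on their variation; a true derivative is restored for the limit. Mass can escape
  only towards large radii, because \<open>{..T}\<close> has finite radial measure and the profiles
  are uniformly bounded; the weight \<open>\<bar>t\<bar>\<close> prevents this escape. The same two
  facts supply the integrable minorant that Fatou's lemma needs for the signed kernel
  \<open>max s t\<close>.\<close>

definition radial_measure :: "real measure" where
  "radial_measure = density lborel (\<lambda>t. ennreal (2 * pi * exp (2 * t)))"

lemma sets_radial_measure [measurable_cong, simp]: "sets radial_measure = sets borel"
  and space_radial_measure [simp]: "space radial_measure = UNIV"
  by (simp_all add: radial_measure_def)

lemma emeasure_radial_measure_interval: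
  assumes "a < b"
  shows "emeasure radial_measure {a<..<b} = ennreal (pi * exp (2 * b) - pi * exp (2 * a))"
proof -
  have "emeasure radial_measure {a<..<b}
      = (\<integral>\<^sup>+t. ennreal (2 * pi * exp (2 * t)) * indicator {a<..<b} t \<partial>lborel)"
    by (simp add: radial_measure_def emeasure_density)
  also have "\<dots> = (\<integral>\<^sup>+t. ennreal (2 * pi * exp (2 * t)) * indicator {a..b} t \<partial>lborel)"
  proof (rule nn_integral_cong_AE)
    show "AE t in lborel. ennreal (2 * pi * exp (2 * t)) * indicator {a<..<b} t
        = ennreal (2 * pi * exp (2 * t)) * indicator {a..b} t"
      using AE_lborel_singleton[of a] AE_lborel_singleton[of b]
      by eventually_elim (auto split: split_indicator)
  qed
  also have "\<dots> = ennreal (pi * exp (2 * b) - pi * exp (2 * a))"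
    using assms
    by (intro nn_integral_FTC_Icc) (auto intro!: derivative_eq_intros)
  finally show ?thesis .
qed

text \<open>The annulus with radii \<open>exp a\<close> and \<open>exp b\<close> has area
  \<open>pi * exp (2 * b) - pi * exp (2 * a)\<close>, and open intervals are an intersection-stable
  generator of the Borel sets. Every integral of a radial function over the plane is moved to the
  line by this identity.\<close>

lemma distr_ln_norm: "distr (lborel :: pt2 measure) borel (\<lambda>x. ln (norm x)) = radial_measure"
proof (rule measure_eqI_generator_eq)
  let ?E = "range (\<lambda>(a, b). {a<..<b::real})"
  show "Int_stable ?E"
    by (auto simp: Int_stable_def)
  show "?E \<subseteq> Pow UNIV"
    "sets (distr (lborel :: pt2 measure) borel (\<lambda>x. ln (norm x))) = sigma_sets UNIV ?E"
    "sets radial_measure = sigma_sets UNIV ?E"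
    by (simp_all add: borel_eq_box box_real)
  let ?A = "\<lambda>n::nat. {- real (Suc n)<..<real (Suc n)}"
  show "range ?A \<subseteq> ?E" by auto
  show "(\<Union>i. ?A i) = UNIV"
  proof -
    have "\<exists>i. x \<in> ?A i" for x :: real
    proof -
      obtain n where "\<bar>x\<bar> < real n" using reals_Archimedean2 by blast
      then have "x \<in> ?A n" by auto
      then show ?thesis by blast
    qed
    then show ?thesis by blast
  qed
  have main: "emeasure (distr (lborel :: pt2 measure) borel (\<lambda>x. ln (norm x))) {a<..<b}
       = emeasure radial_measure {a<..<b}" for a b :: real
  proof (cases "a < b")
    case True
    have "emeasure (distr (lborel :: pt2 measure) borel (\<lambda>x. ln (norm x))) {a<..<b}
        = emeasure lborel ((\<lambda>x::pt2. ln (norm x)) -` {a<..<b})"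
      by (subst emeasure_distr) auto
    also have "\<dots> = emeasure lborel (ball 0 (exp b) - cball 0 (exp a) :: pt2 set)"
    proof (rule emeasure_eq_AE)
      \<comment> \<open>The origin is sent to \<open>ln 0 = 0\<close> although it lies in no
        annulus; as a single point it is discarded.\<close>
      show "AE x::pt2 in lborel. (x \<in> (\<lambda>x. ln (norm x)) -` {a<..<b}) = (x \<in> ball 0 (exp b) - cball 0 (exp a))"
        using AE_lborel_singleton[of "0::pt2"]
      proof eventually_elim
        case (elim x)
        then have "norm x > 0" by simp
        then show ?case using ln_less_cancel_iff[of "norm x" "exp b"] ln_less_cancel_iff[of "exp a" "norm x"]
          by (auto simp: not_le)
      qed
      show "(\<lambda>x::pt2. ln (norm x)) -` {a<..<b} \<in> sets lborel"
        using measurable_sets[of "\<lambda>x::pt2. ln (norm x)" lborel borel "{a<..<b}"] by simp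
    qed auto
    also have "\<dots> = emeasure lborel (ball 0 (exp b) :: pt2 set) - emeasure lborel (cball 0 (exp a) :: pt2 set)"
      using True by (intro emeasure_Diff) (auto simp: emeasure_cball intro: le_less_trans)
    also have "\<dots> = ennreal (pi * exp (2 * b) - pi * exp (2 * a))"
      by (simp add: emeasure_ball emeasure_cball unit_ball_vol_2 exp_double ennreal_minus)
    finally show ?thesis using True by (simp add: emeasure_radial_measure_interval)
  qed simp
  then show "emeasure (distr (lborel :: pt2 measure) borel (\<lambda>x. ln (norm x))) X
       = emeasure radial_measure X" if "X \<in> ?E" for X
    using that by auto
  show "emeasure (distr (lborel :: pt2 measure) borel (\<lambda>x. ln (norm x))) (?A i) \<noteq> \<infinity>" for i
    by (simp only: main) (simp add: emeasure_radial_measure_interval)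
qed

lemma sigma_finite_radial_measure: "sigma_finite_measure radial_measure"
  unfolding radial_measure_def
  by (subst sigma_finite_measure.sigma_finite_iff_density_finite'[OF lborel.sigma_finite_measure_axioms]) auto

interpretation radial: pair_sigma_finite radial_measure radial_measure
  by (intro pair_sigma_finite.intro sigma_finite_radial_measure)

lemma radial_pair_measure:
  "radial_measure \<Otimes>\<^sub>M radial_measure
     = distr (lborel \<Otimes>\<^sub>M lborel :: (pt2 \<times> pt2) measure) (borel \<Otimes>\<^sub>M borel) (\<lambda>(x, y). (ln (norm x), ln (norm y)))"
  unfolding distr_ln_norm[symmetric]
  by (rule pair_measure_distr) (auto simp: distr_ln_norm sigma_finite_radial_measure)

section \<open>Rotations of the plane and invariance of Lebesgue measure\<close>

definition quarter_turn :: "pt2 \<Rightarrow> pt2" where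
  "quarter_turn y = vector [- vec_nth y 2, vec_nth y 1]"

definition rot :: "real \<Rightarrow> pt2 \<Rightarrow> pt2" where
  "rot \<theta> y = cos \<theta> *\<^sub>R y + sin \<theta> *\<^sub>R quarter_turn y"

text \<open>Measure invariance is proved in \<open>real^2\<close>, the mean value property in the
  complex plane; this isometry links the two.\<close>

definition to_complex :: "pt2 \<Rightarrow> complex" where
  "to_complex y = Complex (vec_nth y 1) (vec_nth y 2)"

lemma linear_quarter_turn: "linear quarter_turn"
  by (rule linearI) (auto simp: quarter_turn_def vec_eq_iff forall_2)

lemma measurable_quarter_turn [measurable]: "quarter_turn \<in> borel_measurable borel"
  by (intro borel_measurable_continuous_onI linear_continuous_on linear_linear[THEN iffD2] 
      linear_conv_bounded_linear[THEN iffD1] linear_quarter_turn)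

lemma measurable_rot [measurable]:
  assumes [measurable]: "f \<in> borel_measurable M" "g \<in> borel_measurable M"
  shows "(\<lambda>x. rot (f x) (g x)) \<in> borel_measurable M"
  unfolding rot_def by measurable

lemma cmod_to_complex: "cmod (to_complex y) = norm y"
  by (simp add: to_complex_def cmod_def norm_vec_def L2_set_def sum_2)

lemma to_complex_diff: "to_complex (x - y) = to_complex x - to_complex y"
  by (simp add: to_complex_def complex_eq_iff)

lemma to_complex_rot: "to_complex (rot \<theta> y) = cis \<theta> * to_complex y"
  by (simp add: to_complex_def rot_def quarter_turn_def complex_eq_iff)

lemma norm_rot [simp]: "norm (rot \<theta> y) = norm y"
  by (metis cmod_to_complex to_complex_rot norm_mult norm_cis mult_1)

lemma dist_rot: "dist x (rot \<theta> y) = cmod (to_complex x - cis \<theta> * to_complex y)"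
  by (simp add: dist_norm to_complex_rot cmod_to_complex[symmetric] to_complex_diff)

lemma rot_rot_uminus: "rot \<theta> (rot (- \<theta>) y) = y"
proof -
  have "to_complex (rot \<theta> (rot (- \<theta>) y)) = to_complex y"
    by (simp add: to_complex_rot cis_mult mult.assoc[symmetric])
  then show ?thesis by (simp add: to_complex_def vec_eq_iff forall_2)
qed

lemma orthogonal_transformation_rot: "orthogonal_transformation (rot \<theta>)"
proof -
  have "linear (rot \<theta>)"
    unfolding rot_def
    by (intro linear_compose_add linear_compose_scale_right linear_quarter_turn linear_ident)
  then show ?thesis by (simp add: orthogonal_transformation)
qed

text \<open>A measure that gives every box its volume is Lebesgue measure. The preimage of a box is
  its image under the inverse rotation, no longer a box, so its volume comes from invariance under
  orthogonal maps.\<close>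

lemma distr_rot: "distr lborel borel (rot \<theta>) = lborel"
proof (rule lborel_eqI[symmetric])
  fix l u :: pt2 assume le: "\<And>b. b \<in> Basis \<Longrightarrow> l \<bullet> b \<le> u \<bullet> b"
  have *: "rot \<theta> -` box l u = rot (- \<theta>) ` box l u"
    using rot_rot_uminus[of \<theta>] rot_rot_uminus[of "- \<theta>"]
    by (auto simp: image_iff) (metis minus_minus)
  have "rot \<theta> -` box l u \<in> sets borel"
    using measurable_sets[of "rot \<theta>" borel borel "box l u"] measurable_rot[of "\<lambda>_. \<theta>" borel id] by simp
  moreover have "rot (- \<theta>) ` box l u \<in> lmeasurable"
    by (intro measurable_orthogonal_image orthogonal_transformation_rot) simp
  moreover have "measure lebesgue (rot (- \<theta>) ` box l u) = measure lborel (box l u)"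
    by (subst measure_orthogonal_image) (auto intro: orthogonal_transformation_rot)
  ultimately have "emeasure lborel (rot \<theta> -` box l u) = emeasure lborel (box l u)"
    unfolding * by (subst (1 2) emeasure_eq_ennreal_measure) (use emeasure_lborel_box_finite[of l u] in \<open>auto dest!: fmeasurableD2\<close>)
  then show "emeasure (distr lborel borel (rot \<theta>)) (box l u) = ennreal (\<Prod>b\<in>Basis. (u - l) \<bullet> b)"
    using le measurable_rot[of "\<lambda>_. \<theta>" borel id]
    by (subst emeasure_distr) (auto simp: emeasure_lborel_box_eq)
qed simp

text \<open>Cauchy's integral formula at the centre of the unit circle, applied to
  \<open>Ln (1 - z * c)\<close>: the value at the centre is \<open>Ln 1 = 0\<close>, and the real
  part of \<open>Ln\<close> is the logarithm of the modulus.\<close>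

lemma mean_ln_cmod_disc:
  assumes "cmod c < 1"
  shows "((\<lambda>t. ln (cmod (1 - cis (2 * pi * t) * c))) has_integral 0) {0..1}"
proof -
  define F where "F = (\<lambda>z. Ln (1 - z * c))"
  \<comment> \<open>A positive real part keeps \<open>1 - z * c\<close> off the branch cut of
    \<open>Ln\<close> on the whole closed disc.\<close>
  have pos: "Re (1 - z * c) > 0" if "z \<in> cball 0 1" for z
  proof -
    have "Re (z * c) \<le> cmod (z * c)" by (rule complex_Re_le_cmod)
    also have "\<dots> \<le> 1 * cmod c" using that unfolding norm_mult by (intro mult_right_mono) auto
    finally show ?thesis using assms by simp
  qed
  have "F holomorphic_on cball 0 1"
    unfolding F_def
  proof (intro holomorphic_intros)
    fix z :: complex assume "z \<in> cball 0 1"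
    then show "1 - z * c \<notin> \<real>\<^sub>\<le>\<^sub>0" using pos[of z] by (auto simp: complex_nonpos_Reals_iff)
  qed
  then have "((\<lambda>u. F u / (u - 0)) has_contour_integral (2 * of_real pi * \<i> * F 0)) (circlepath 0 1)"
    by (rule Cauchy_integral_circlepath_simple) simp
  then have "((\<lambda>t. F (circlepath 0 1 t) / circlepath 0 1 t
       * vector_derivative (circlepath 0 1) (at t within {0..1})) has_integral 0) {0..1}"
    by (simp add: has_contour_integral_def F_def)
  then have "((\<lambda>t. (2 * of_real pi * \<i>) * F (cis (2 * pi * t))) has_integral 0) {0..1}"
  proof (rule has_integral_eq[rotated])
    fix t :: real assume t: "t \<in> {0..1}"
    have vd: "vector_derivative (circlepath 0 1) (at t within {0..1})
        = 2 * of_real pi * \<i> * exp (2 * of_real pi * \<i> * of_real t)"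
      using t by (simp add: vector_derivative_circlepath01)
    have "circlepath 0 1 t = cis (2 * pi * t)"
      by (simp add: circlepath cis_conv_exp mult_ac)
    moreover have "exp (2 * of_real pi * \<i> * of_real t) = cis (2 * pi * t)"
      by (simp add: cis_conv_exp mult_ac)
    ultimately show "F (circlepath 0 1 t) / circlepath 0 1 t
       * vector_derivative (circlepath 0 1) (at t within {0..1}) = 2 * of_real pi * \<i> * F (cis (2 * pi * t))"
      by (simp add: vd)
  qed
  from has_integral_mult_right[OF this, of "1 / (2 * of_real pi * \<i>)"]
  have "((\<lambda>t. F (cis (2 * pi * t))) has_integral 0) {0..1}"
    by simp
  from has_integral_linear[OF this bounded_linear_Re]
  have "((\<lambda>t. Re (F (cis (2 * pi * t)))) has_integral 0) {0..1}"
    by (simp add: o_def)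
  then show ?thesis
  proof (rule has_integral_eq[rotated])
    fix t :: real
    have "1 - cis (2 * pi * t) * c \<noteq> 0" using pos[of "cis (2 * pi * t)"] by (auto simp: complex_eq_iff)
    then show "Re (F (cis (2 * pi * t))) = ln (cmod (1 - cis (2 * pi * t) * c))"
      by (simp add: F_def)
  qed
qed

text \<open>Factoring out the point of larger modulus leaves \<open>1 - cis _ * c\<close> with
  \<open>cmod c < 1\<close>, whose logarithm has mean zero. Equal moduli would put the singularity
  on the circle; such pairs are negligible by \<open>AE_norm_neq\<close>.\<close>

lemma mean_ln_cmod:
  assumes "cmod z \<noteq> cmod w"
  shows "((\<lambda>t. ln (cmod (z - cis (2 * pi * t) * w))) has_integral ln (max (cmod z) (cmod w))) {0..1}"
proof (cases "cmod w < cmod z")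
  case True
  then have z: "z \<noteq> 0" by auto
  have c: "cmod (w / z) < 1" using True z by (simp add: norm_divide divide_simps)
  have "ln (cmod (z - cis (2 * pi * t) * w)) = ln (cmod z) + ln (cmod (1 - cis (2 * pi * t) * (w / z)))" for t
  proof -
    have "z - cis (2 * pi * t) * w = z * (1 - cis (2 * pi * t) * (w / z))" using z by (simp add: field_simps)
    moreover have "1 - cis (2 * pi * t) * (w / z) \<noteq> 0"
      using c norm_mult[of "cis (2 * pi * t)" "w / z"] by auto
    ultimately show ?thesis using z by (simp add: norm_mult ln_mult_pos)
  qed
  then show ?thesis
    using True has_integral_add[OF has_integral_const_real[of "ln (cmod z)" 0 1] mean_ln_cmod_disc[OF c]]
    by (simp add: max_def)
next
  case False
  with assms have less: "cmod z < cmod w" by simp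
  then have w: "w \<noteq> 0" by auto
  have c: "cmod (cnj (z / w)) < 1" using less w by (simp add: norm_divide divide_simps)
  have "ln (cmod (z - cis (2 * pi * t) * w)) = ln (cmod w) + ln (cmod (1 - cis (2 * pi * t) * cnj (z / w)))" for t
  proof -
    \<comment> \<open>Factoring out \<open>w\<close> inverts the rotation; the conjugation restores
      its direction, so the disc lemma applies to \<open>cnj (z / w)\<close>.\<close>
    have "z - cis (2 * pi * t) * w = - w * cis (2 * pi * t) * cnj (1 - cis (2 * pi * t) * cnj (z / w))"
      using w by (simp add: field_simps cis_cnj cis_mult)
    then have "cmod (z - cis (2 * pi * t) * w) = cmod w * cmod (1 - cis (2 * pi * t) * cnj (z / w))"
      by (simp only: norm_mult complex_mod_cnj norm_cis norm_minus_cancel mult_1_right)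
    moreover have "1 - cis (2 * pi * t) * cnj (z / w) \<noteq> 0"
      using c norm_mult[of "cis (2 * pi * t)" "cnj (z / w)"] by auto
    ultimately show ?thesis using w by (simp add: ln_mult_pos)
  qed
  then show ?thesis
    using less has_integral_add[OF has_integral_const_real[of "ln (cmod w)" 0 1] mean_ln_cmod_disc[OF c]]
    by (simp add: max_def)
qed

text \<open>For each fixed angle the integral in \<open>y\<close> is unchanged, because both
  Lebesgue measure and \<open>\<rho> (norm y)\<close> are rotation invariant; averaging over angles
  of total weight 1 then changes nothing. Nonnegative kernels let Tonelli apply without
  integrability, which is not yet known for the logarithm.\<close>

lemma nn_integral_rotation_average:
  fixes \<psi> \<rho> :: "real \<Rightarrow> ennreal"
  assumes [measurable]: "\<psi> \<in> borel_measurable borel" "\<rho> \<in> borel_measurable borel"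
  shows "(\<integral>\<^sup>+(x, y). \<psi> (dist x y) * (\<rho> (norm x) * \<rho> (norm y)) \<partial>(lborel \<Otimes>\<^sub>M lborel :: (pt2 \<times> pt2) measure))
    = (\<integral>\<^sup>+(x, y). (\<integral>\<^sup>+t. \<psi> (dist x (rot (2 * pi * t) y)) * indicator {0..1} t \<partial>lborel)
        * (\<rho> (norm x) * \<rho> (norm y)) \<partial>(lborel \<Otimes>\<^sub>M lborel))"
proof -
  define K where "K x = (\<integral>\<^sup>+y. \<psi> (dist x y) * (\<rho> (norm x) * \<rho> (norm y)) \<partial>lborel)" for x :: pt2
  have rotK: "(\<integral>\<^sup>+y. \<psi> (dist x (rot s y)) * (\<rho> (norm x) * \<rho> (norm y)) \<partial>lborel) = K x" for x s
  proof -
    have "K x = (\<integral>\<^sup>+y. \<psi> (dist x y) * (\<rho> (norm x) * \<rho> (norm y)) \<partial>(distr lborel borel (rot s)))"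
      by (simp add: K_def distr_rot)
    also have "\<dots> = (\<integral>\<^sup>+y. \<psi> (dist x (rot s y)) * (\<rho> (norm x) * \<rho> (norm y)) \<partial>lborel)"
      by (subst nn_integral_distr) auto
    finally show ?thesis by simp
  qed
  have "(\<integral>\<^sup>+(x, y). (\<integral>\<^sup>+t. \<psi> (dist x (rot (2 * pi * t) y)) * indicator {0..1} t \<partial>lborel)
        * (\<rho> (norm x) * \<rho> (norm y)) \<partial>(lborel \<Otimes>\<^sub>M lborel))
     = (\<integral>\<^sup>+x. (\<integral>\<^sup>+y. (\<integral>\<^sup>+t. \<psi> (dist x (rot (2 * pi * t) y)) * indicator {0..1} t \<partial>lborel)
        * (\<rho> (norm x) * \<rho> (norm y)) \<partial>lborel) \<partial>lborel)"
    by (subst lborel.nn_integral_fst[symmetric]) auto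
  also have "\<dots> = (\<integral>\<^sup>+x. (\<integral>\<^sup>+y. (\<integral>\<^sup>+t. \<psi> (dist x (rot (2 * pi * t) y)) * indicator {0..1} t
        * (\<rho> (norm x) * \<rho> (norm y)) \<partial>lborel) \<partial>lborel) \<partial>lborel)"
    by (intro nn_integral_cong nn_integral_multc[symmetric]) auto
  also have "\<dots> = (\<integral>\<^sup>+x. (\<integral>\<^sup>+t. (\<integral>\<^sup>+y. \<psi> (dist x (rot (2 * pi * t) y)) * indicator {0..1} t
        * (\<rho> (norm x) * \<rho> (norm y)) \<partial>lborel) \<partial>lborel) \<partial>lborel)"
    by (intro nn_integral_cong lborel_pair.Fubini') auto
  also have "\<dots> = (\<integral>\<^sup>+x. (\<integral>\<^sup>+t. K x * indicator {0..1::real} t \<partial>lborel) \<partial>lborel)"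
  proof (intro nn_integral_cong)
    fix x :: pt2 and t :: real
    have "(\<integral>\<^sup>+y. \<psi> (dist x (rot (2 * pi * t) y)) * indicator {0..1} t * (\<rho> (norm x) * \<rho> (norm y)) \<partial>lborel)
      = (\<integral>\<^sup>+y. (\<psi> (dist x (rot (2 * pi * t) y)) * (\<rho> (norm x) * \<rho> (norm y))) * indicator {0..1} t \<partial>lborel)"
      by (simp add: mult_ac)
    also have "\<dots> = K x * indicator {0..1} t"
      by (subst nn_integral_multc) (auto simp: rotK)
    finally show "(\<integral>\<^sup>+y. \<psi> (dist x (rot (2 * pi * t) y)) * indicator {0..1} t * (\<rho> (norm x) * \<rho> (norm y)) \<partial>lborel)
       = K x * indicator {0..1} t" .
  qed
  also have "\<dots> = (\<integral>\<^sup>+x. K x \<partial>lborel)"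
    by (simp add: nn_integral_cmult_indicator)
  also have "\<dots> = (\<integral>\<^sup>+(x, y). \<psi> (dist x y) * (\<rho> (norm x) * \<rho> (norm y)) \<partial>(lborel \<Otimes>\<^sub>M lborel :: (pt2 \<times> pt2) measure))"
    using lborel.nn_integral_fst[of "\<lambda>(x, y). \<psi> (dist x y) * (\<rho> (norm x) * \<rho> (norm y))" "lborel :: pt2 measure"]
    by (simp add: K_def)
  finally show ?thesis ..
qed

section \<open>Newton's theorem for the logarithmic potential\<close>

lemma (in pair_sigma_finite) integrable_mult_pair:
  fixes f :: "'a \<Rightarrow> real" and g :: "'b \<Rightarrow> real"
  assumes [measurable]: "integrable M1 f" "integrable M2 g"
  shows "integrable (M1 \<Otimes>\<^sub>M M2) (\<lambda>(x, y). f x * g y)"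
proof (rule Fubini_integrable)
  show "(\<lambda>(x, y). f x * g y) \<in> borel_measurable (M1 \<Otimes>\<^sub>M M2)" by measurable
  have "integrable M1 (\<lambda>x. \<bar>f x\<bar> * (\<integral>y. \<bar>g y\<bar> \<partial>M2))"
    using assms by (intro integrable_mult_left integrable_abs)
  then show "integrable M1 (\<lambda>x. \<integral>y. norm (case (x, y) of (x, y) \<Rightarrow> f x * g y) \<partial>M2)"
    by (simp add: abs_mult)
  show "AE x in M1. integrable M2 (\<lambda>y. case (x, y) of (x, y) \<Rightarrow> f x * g y)"
    using assms by simp
qed

text \<open>Spheres and points are null sets. The excluded pairs are those where a logarithm takes
  its default value at 0 or where the circle through \<open>y\<close> meets
  \<open>x\<close>.\<close>

lemma AE_norm_neq: "AE (x, y) in (lborel \<Otimes>\<^sub>M lborel :: (pt2 \<times> pt2) measure). x \<noteq> 0 \<and> y \<noteq> 0 \<and> norm x \<noteq> norm y"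
proof (rule lborel_pair.AE_pair_measure)
  show "{z \<in> space (lborel \<Otimes>\<^sub>M lborel). case z of (x, y) \<Rightarrow> x \<noteq> 0 \<and> y \<noteq> 0 \<and> norm x \<noteq> norm y}
      \<in> sets (lborel \<Otimes>\<^sub>M lborel :: (pt2 \<times> pt2) measure)"
    by measurable
  have sph: "AE y::pt2 in lborel. r \<noteq> norm y" for r
  proof -
    have "sphere (0::pt2) r \<in> null_sets lborel"
      using negligible_sphere[of "0::pt2" r]
      by (auto simp: null_sets_completion_iff negligible_iff_null_sets)
    then have "AE y in lborel. y \<notin> sphere (0::pt2) r" by (rule AE_not_in)
    then show ?thesis by eventually_elim auto
  qed
  show "AE x::pt2 in lborel. AE y::pt2 in lborel. case (x, y) of (x, y) \<Rightarrow> x \<noteq> 0 \<and> y \<noteq> 0 \<and> norm x \<noteq> norm y"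
    using AE_lborel_singleton[of "0::pt2"]
  proof eventually_elim
    case (elim x)
    show ?case using AE_lborel_singleton[of "0::pt2"] sph[of "norm x"]
      by eventually_elim (use elim in auto)
  qed
qed

context
  fixes x y :: pt2
  assumes nz: "x \<noteq> 0" "y \<noteq> 0" and neq: "norm x \<noteq> norm y"
begin

lemma dist_rot_pos: "dist x (rot s y) > 0"
  using neq by (metis norm_rot zero_less_dist_iff)

lemma continuous_on_ln_dist_rot: "continuous_on {0..1} (\<lambda>t. ln (dist x (rot (2 * pi * t) y)))"
  unfolding rot_def
  by (intro continuous_intros) (use dist_rot_pos in \<open>auto simp: rot_def\<close>)

text \<open>Only an upper bound can be of this form: the logarithm tends to minus infinity as the
  circle approaches \<open>x\<close>. The mean of the negative part is controlled through the exact
  mean value instead.\<close>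

lemma ln_dist_rot_le: "ln (dist x (rot s y)) \<le> ln 2 + \<bar>ln (norm x)\<bar> + \<bar>ln (norm y)\<bar>"
proof -
  have "dist x (rot s y) \<le> norm x + norm y"
    using norm_triangle_ineq4[of x "rot s y"] by (simp add: dist_norm)
  also have "\<dots> \<le> 2 * max (norm x) (norm y)" by simp
  finally have "ln (dist x (rot s y)) \<le> ln (2 * max (norm x) (norm y))"
    using dist_rot_pos[of s] by (intro ln_mono) auto
  also have "\<dots> = ln 2 + ln (max (norm x) (norm y))"
    using nz by (intro ln_mult_pos) (auto simp: less_max_iff_disj)
  also have "\<dots> \<le> ln 2 + \<bar>ln (norm x)\<bar> + \<bar>ln (norm y)\<bar>" by (cases "norm x \<le> norm y") (simp_all add: max_def)
  finally show ?thesis .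
qed

lemma nn_integral_circle:
  assumes F: "continuous_on UNIV F" "\<And>r. F r \<ge> 0"
  shows "(\<integral>\<^sup>+t. ennreal (F (ln (dist x (rot (2 * pi * t) y)))) * indicator {0..1} t \<partial>lborel)
      = ennreal (LINT t:{0..1}|lborel. F (ln (dist x (rot (2 * pi * t) y))))"
    and "set_integrable lborel {0..1} (\<lambda>t. F (ln (dist x (rot (2 * pi * t) y))))"
proof -
  have "continuous_on {0..1} (\<lambda>t. F (ln (dist x (rot (2 * pi * t) y))))"
    using continuous_on_compose2[OF F(1) continuous_on_ln_dist_rot] by simp
  then show int: "set_integrable lborel {0..1} (\<lambda>t. F (ln (dist x (rot (2 * pi * t) y))))"
    by (rule borel_integrable_atLeastAtMost')
  have "(\<integral>\<^sup>+t. ennreal (F (ln (dist x (rot (2 * pi * t) y)))) * indicator {0..1} t \<partial>lborel)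
     = (\<integral>\<^sup>+t. ennreal (indicator {0..1} t *\<^sub>R F (ln (dist x (rot (2 * pi * t) y)))) \<partial>lborel)"
    by (intro nn_integral_cong) (auto split: split_indicator)
  also have "\<dots> = ennreal (LINT t:{0..1}|lborel. F (ln (dist x (rot (2 * pi * t) y))))"
    unfolding set_lebesgue_integral_def
    by (rule nn_integral_eq_integral) (use int F(2) in \<open>auto simp: set_integrable_def\<close>)
  finally show "(\<integral>\<^sup>+t. ennreal (F (ln (dist x (rot (2 * pi * t) y)))) * indicator {0..1} t \<partial>lborel)
      = ennreal (LINT t:{0..1}|lborel. F (ln (dist x (rot (2 * pi * t) y))))" .
qed

text \<open>The logarithm appears split because the averaging over rotations is available for
  nonnegative kernels only; the mean value property evaluates the recombined integral.\<close>

lemma circle_mean_ln: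
  "(LINT t:{0..1}|lborel. max 0 (ln (dist x (rot (2 * pi * t) y))))
     - (LINT t:{0..1}|lborel. max 0 (- ln (dist x (rot (2 * pi * t) y)))) = ln (max (norm x) (norm y))"
proof -
  have "(LINT t:{0..1}|lborel. max 0 (ln (dist x (rot (2 * pi * t) y))))
     - (LINT t:{0..1}|lborel. max 0 (- ln (dist x (rot (2 * pi * t) y))))
     = (LINT t:{0..1}|lborel. max 0 (ln (dist x (rot (2 * pi * t) y))) - max 0 (- ln (dist x (rot (2 * pi * t) y))))"
    by (rule set_integral_diff(2)[symmetric]; rule nn_integral_circle(2)) (auto intro!: continuous_intros)
  also have "\<dots> = (LINT t:{0..1}|lborel. ln (dist x (rot (2 * pi * t) y)))"
    by (rule arg_cong[of _ _ "set_lebesgue_integral lborel {0..1}"]) (auto simp: max_def)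
  also have "\<dots> = integral {0..1} (\<lambda>t. ln (dist x (rot (2 * pi * t) y)))"
    by (intro set_borel_integral_eq_integral borel_integrable_atLeastAtMost' continuous_on_ln_dist_rot)
  also have "\<dots> = ln (max (norm x) (norm y))"
    using mean_ln_cmod[of "to_complex x" "to_complex y"] neq
    by (simp add: dist_rot cmod_to_complex integral_unique)
  finally show ?thesis .
qed

end

text \<open>Integrability of the kernel \<open>ln (dist x y)\<close> is not known beforehand, so its
  positive and negative parts are averaged separately by Tonelli. The averages are dominated by an
  integrable function, which gives integrability of both parts, and their difference is the mean
  value on the circle.\<close>

proposition newton_log_potential:
  fixes \<rho> :: "real \<Rightarrow> real"
  assumes \<rho>[measurable]: "\<rho> \<in> borel_measurable borel" and nonneg: "\<And>r. \<rho> r \<ge> 0"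
    and int0: "integrable lborel (\<lambda>x::pt2. \<rho> (norm x))"
    and int1: "integrable lborel (\<lambda>x::pt2. ln (norm x) * \<rho> (norm x))"
  shows "(\<integral>z. (case z of (x, y) \<Rightarrow> ln (dist x y) * \<rho> (norm x) * \<rho> (norm y)) \<partial>(lborel \<Otimes>\<^sub>M lborel :: (pt2 \<times> pt2) measure))
       = (\<integral>z. (case z of (x, y) \<Rightarrow> ln (max (norm x) (norm y)) * \<rho> (norm x) * \<rho> (norm y)) \<partial>(lborel \<Otimes>\<^sub>M lborel :: (pt2 \<times> pt2) measure))"
proof -
  let ?M = "lborel \<Otimes>\<^sub>M lborel :: (pt2 \<times> pt2) measure"
  have int1': "integrable lborel (\<lambda>x::pt2. \<bar>ln (norm x)\<bar> * \<rho> (norm x))"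
    using integrable_abs[OF int1] nonneg by (simp add: abs_mult)
  \<comment> \<open>A majorant made of products of one-variable functions, integrable by
    \<open>int0\<close> and \<open>int1\<close>; it bounds the averaged positive part, and twice it
    bounds the averaged negative part.\<close>
  define B where "B = (\<lambda>(x::pt2, y::pt2). (ln 2 + \<bar>ln (norm x)\<bar> + \<bar>ln (norm y)\<bar>) * \<rho> (norm x) * \<rho> (norm y))"
  have intB: "integrable ?M B"
  proof -
    have "B = (\<lambda>z. ln 2 * (case z of (x, y) \<Rightarrow> \<rho> (norm x) * \<rho> (norm y))
       + (case z of (x, y) \<Rightarrow> (\<bar>ln (norm x)\<bar> * \<rho> (norm x)) * \<rho> (norm y))
       + (case z of (x, y) \<Rightarrow> \<rho> (norm x) * (\<bar>ln (norm y)\<bar> * \<rho> (norm y))))"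
      by (auto simp: B_def fun_eq_iff algebra_simps)
    then show ?thesis
      by (simp only:) (intro Bochner_Integration.integrable_add integrable_mult_right
          lborel_pair.integrable_mult_pair int0 int1')
  qed
  have lnmax: "\<bar>ln (max (norm x) (norm y))\<bar> \<le> ln 2 + \<bar>ln (norm x)\<bar> + \<bar>ln (norm y)\<bar>" for x y :: pt2
    by (auto simp: max_def)
  define A where "A F z = (case z of (x, y) \<Rightarrow>
      (LINT t:{0..1}|lborel. F (ln (dist x (rot (2 * pi * t) y)))))" for F :: "real \<Rightarrow> real" and z :: "pt2 \<times> pt2"
  define w where "w = (\<lambda>(x::pt2, y::pt2). \<rho> (norm x) * \<rho> (norm y))"
  have w0: "w z \<ge> 0" for z by (auto simp: w_def nonneg split: prod.split)
  have [measurable]: "w \<in> borel_measurable ?M" unfolding w_def by measurable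
  have mA[measurable]: "A F \<in> borel_measurable ?M" if [measurable]: "F \<in> borel_measurable borel" for F
    unfolding A_def set_lebesgue_integral_def by measurable
  have avg: "(\<integral>\<^sup>+z. ennreal ((case z of (x, y) \<Rightarrow> F (ln (dist x y))) * w z) \<partial>?M) = (\<integral>\<^sup>+z. ennreal (A F z * w z) \<partial>?M)"
    if F: "continuous_on UNIV F" "\<And>r. F r \<ge> 0" for F
  proof -
    have [measurable]: "F \<in> borel_measurable borel" using F by (intro borel_measurable_continuous_onI)
    have "(\<integral>\<^sup>+z. ennreal ((case z of (x, y) \<Rightarrow> F (ln (dist x y))) * w z) \<partial>?M)
      = (\<integral>\<^sup>+(x, y). ennreal (F (ln (dist x y))) * (ennreal (\<rho> (norm x)) * ennreal (\<rho> (norm y))) \<partial>?M)"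
      by (intro nn_integral_cong) (auto simp: w_def ennreal_mult F nonneg split: prod.split)
    also have "\<dots> = (\<integral>\<^sup>+(x, y). (\<integral>\<^sup>+t. ennreal (F (ln (dist x (rot (2 * pi * t) y)))) * indicator {0..1} t \<partial>lborel)
        * (ennreal (\<rho> (norm x)) * ennreal (\<rho> (norm y))) \<partial>?M)"
      by (rule nn_integral_rotation_average) auto
    also have "\<dots> = (\<integral>\<^sup>+z. ennreal (A F z * w z) \<partial>?M)"
    proof (rule nn_integral_cong_AE)
      show "AE z in ?M. (case z of (x, y) \<Rightarrow> (\<integral>\<^sup>+t. ennreal (F (ln (dist x (rot (2 * pi * t) y)))) * indicator {0..1} t \<partial>lborel)
        * (ennreal (\<rho> (norm x)) * ennreal (\<rho> (norm y)))) = ennreal (A F z * w z)"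
        using AE_norm_neq
      proof eventually_elim
        case (elim z)
        obtain x y where z: "z = (x, y)" by (cases z)
        have "A F z \<ge> 0"
          using F(2) by (auto simp: A_def z set_lebesgue_integral_def intro!: integral_nonneg_AE)
        then show ?case using elim nn_integral_circle(1)[OF _ _ _ F, of x y]
          by (simp add: z A_def w_def ennreal_mult nonneg)
      qed
    qed
    finally show ?thesis .
  qed
  have cont: "continuous_on UNIV (\<lambda>r::real. max 0 r)" "continuous_on UNIV (\<lambda>r::real. max 0 (- r))"
    by (auto intro!: continuous_intros)
  note avg' = avg[OF cont(1)] avg[OF cont(2)]
  have Apos: "AE z in ?M. A (\<lambda>r. max 0 r) z * w z \<le> B z \<and> A (\<lambda>r. max 0 r) z \<ge> 0
      \<and> A (\<lambda>r. max 0 (- r)) z * w z \<le> 2 * B z \<and> A (\<lambda>r. max 0 (- r)) z \<ge> 0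
      \<and> A (\<lambda>r. max 0 r) z - A (\<lambda>r. max 0 (- r)) z = (case z of (x, y) \<Rightarrow> ln (max (norm x) (norm y)))"
    using AE_norm_neq
  proof eventually_elim
    case (elim z)
    obtain x y where z: "z = (x, y)" by (cases z)
    from elim have n: "x \<noteq> 0" "y \<noteq> 0" "norm x \<noteq> norm y" by (auto simp: z)
    define b where "b = ln 2 + \<bar>ln (norm x)\<bar> + \<bar>ln (norm y)\<bar>"
    have b0: "b \<ge> 0" by (simp add: b_def)
    have A0: "A F z \<ge> 0" if "\<And>r. F r \<ge> 0" for F
      using that by (auto simp: A_def z set_lebesgue_integral_def intro!: integral_nonneg_AE)
    have "A (\<lambda>r. max 0 r) z \<le> (LINT t:{0..1::real}|lborel. b)"
      unfolding A_def z prod.case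
    proof (rule set_integral_mono)
      show "set_integrable lborel {0..1} (\<lambda>t. max 0 (ln (dist x (rot (2 * pi * t) y))))"
        using nn_integral_circle(2)[OF n cont(1)] by simp
      show "set_integrable lborel {0..1::real} (\<lambda>t. b)"
        by (intro borel_integrable_atLeastAtMost' continuous_intros)
      show "max 0 (ln (dist x (rot (2 * pi * t) y))) \<le> b" for t
        using b0 ln_dist_rot_le[OF n, of "2 * pi * t"] by (simp add: b_def)
    qed
    then have P: "A (\<lambda>r. max 0 r) z \<le> b" by (simp add: set_lebesgue_integral_def)
    have d: "A (\<lambda>r. max 0 r) z - A (\<lambda>r. max 0 (- r)) z = ln (max (norm x) (norm y))"
      using circle_mean_ln[OF n] by (simp add: A_def z)
    \<comment> \<open>The negative mean is the positive mean minus
      \<open>ln (max (norm x) (norm y))\<close>, and each of the two contributes at most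
      \<open>b\<close>.\<close>
    have N: "A (\<lambda>r. max 0 (- r)) z \<le> 2 * b" using d P lnmax[of x y, folded b_def] unfolding abs_le_iff by argo
    have Bz: "B z = b * w z" by (simp add: z B_def w_def b_def)
    show ?case
      using mult_right_mono[OF P w0[of z]] mult_right_mono[OF N w0[of z]] d A0
      unfolding Bz by (simp add: z mult.assoc)
  qed
  have intP: "integrable ?M (\<lambda>z. A (\<lambda>r. max 0 r) z * w z)"
  proof (rule Bochner_Integration.integrable_bound[OF intB])
    show "AE z in ?M. norm (A (\<lambda>r. max 0 r) z * w z) \<le> norm (B z)"
      using Apos by eventually_elim (use w0 in \<open>auto simp: abs_mult\<close>)
  qed measurable
  have intN: "integrable ?M (\<lambda>z. A (\<lambda>r. max 0 (- r)) z * w z)"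
  proof (rule Bochner_Integration.integrable_bound[OF integrable_mult_right[OF intB, of 2]])
    show "AE z in ?M. norm (A (\<lambda>r. max 0 (- r)) z * w z) \<le> norm (2 * B z)"
      using Apos by eventually_elim (use w0 in \<open>auto simp: abs_mult\<close>)
  qed measurable
  \<comment> \<open>Equality of the nonnegative integrals, with a finite value on the averaged side,
    transfers integrability back to the unaveraged kernel.\<close>
  have key: "integrable ?M (\<lambda>z. (case z of (x, y) \<Rightarrow> F (ln (dist x y))) * w z)
     \<and> (\<integral>z. (case z of (x, y) \<Rightarrow> F (ln (dist x y))) * w z \<partial>?M) = (\<integral>z. A F z * w z \<partial>?M)"
    if F: "continuous_on UNIV F" "\<And>r. F r \<ge> 0" and int: "integrable ?M (\<lambda>z. A F z * w z)" for F
  proof -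
    have [measurable]: "F \<in> borel_measurable borel" using F by (intro borel_measurable_continuous_onI)
    have A0: "A F z \<ge> 0" for z
      using F(2) by (cases z) (auto simp: A_def set_lebesgue_integral_def intro!: integral_nonneg_AE)
    have "(\<integral>\<^sup>+z. ennreal (A F z * w z) \<partial>?M) = ennreal (\<integral>z. A F z * w z \<partial>?M)"
      using int A0 w0 by (intro nn_integral_eq_integral) auto
    then have *: "(\<integral>\<^sup>+z. ennreal ((case z of (x, y) \<Rightarrow> F (ln (dist x y))) * w z) \<partial>?M) = ennreal (\<integral>z. A F z * w z \<partial>?M)"
      using avg[OF F] by simp
    have "has_bochner_integral ?M (\<lambda>z. (case z of (x, y) \<Rightarrow> F (ln (dist x y))) * w z) (\<integral>z. A F z * w z \<partial>?M)"
      by (rule has_bochner_integral_nn_integral[OF _ _ _ *])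
        (use F(2) w0 A0 in \<open>auto split: prod.split intro!: integral_nonneg_AE AE_I2 mult_nonneg_nonneg\<close>)
    then show ?thesis using has_bochner_integral_iff by blast
  qed
  note keyP = key[OF cont(1) _ intP, simplified] and keyN = key[OF cont(2) _ intN, simplified]
  have "(\<integral>z. (case z of (x, y) \<Rightarrow> ln (dist x y) * \<rho> (norm x) * \<rho> (norm y)) \<partial>?M)
     = (\<integral>z. (case z of (x, y) \<Rightarrow> max 0 (ln (dist x y))) * w z - (case z of (x, y) \<Rightarrow> max 0 (- ln (dist x y))) * w z \<partial>?M)"
    by (intro Bochner_Integration.integral_cong) (auto simp: w_def max_def algebra_simps)
  also have "\<dots> = (\<integral>z. A (\<lambda>r. max 0 r) z * w z \<partial>?M) - (\<integral>z. A (\<lambda>r. max 0 (- r)) z * w z \<partial>?M)"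
    using keyP keyN by (subst Bochner_Integration.integral_diff) auto
  also have "\<dots> = (\<integral>z. A (\<lambda>r. max 0 r) z * w z - A (\<lambda>r. max 0 (- r)) z * w z \<partial>?M)"
    using intP intN by simp
  also have "\<dots> = (\<integral>z. (case z of (x, y) \<Rightarrow> ln (max (norm x) (norm y)) * \<rho> (norm x) * \<rho> (norm y)) \<partial>?M)"
  proof (rule integral_cong_AE)
    show "AE z in ?M. A (\<lambda>r. max 0 r) z * w z - A (\<lambda>r. max 0 (- r)) z * w z
       = (case z of (x, y) \<Rightarrow> ln (max (norm x) (norm y)) * \<rho> (norm x) * \<rho> (norm y))"
      using Apos
    proof eventually_elim
      case (elim z)
      then show ?case by (cases z) (simp add: w_def left_diff_distrib[symmetric])
    qed
  qed auto
  finally show "(\<integral>z. (case z of (x, y) \<Rightarrow> ln (dist x y) * \<rho> (norm x) * \<rho> (norm y)) \<partial>?M)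
       = (\<integral>z. (case z of (x, y) \<Rightarrow> ln (max (norm x) (norm y)) * \<rho> (norm x) * \<rho> (norm y)) \<partial>?M)" .
qed

section \<open>Recovering a square-integrable derivative from dyadic difference quotients\<close>

lemma Cauchy_Schwarz_interval:
  fixes p :: "real \<Rightarrow> real"
  assumes [measurable]: "p \<in> borel_measurable borel" and "a \<le> b"
  shows "(\<integral>\<^sup>+t. ennreal \<bar>p t\<bar> * indicator {a..b} t \<partial>lborel)\<^sup>2
      \<le> ennreal (b - a) * (\<integral>\<^sup>+t. ennreal ((p t)\<^sup>2) * indicator {a..b} t \<partial>lborel)"
proof -
  have "(\<integral>\<^sup>+t. ennreal \<bar>p t\<bar> * indicator {a..b} t \<partial>lborel)\<^sup>2
      = (\<integral>\<^sup>+t. indicator {a..b} t * (ennreal \<bar>p t\<bar> * indicator {a..b} t) \<partial>lborel)\<^sup>2"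
    by (intro arg_cong[of _ _ "\<lambda>x. x\<^sup>2"] nn_integral_cong) (auto split: split_indicator)
  also have "\<dots> \<le> (\<integral>\<^sup>+t. (indicator {a..b} t)\<^sup>2 \<partial>lborel) * (\<integral>\<^sup>+t. (ennreal \<bar>p t\<bar> * indicator {a..b} t)\<^sup>2 \<partial>lborel)"
    by (rule Cauchy_Schwarz_nn_integral) auto
  also have "(\<integral>\<^sup>+t. (indicator {a..b} t)\<^sup>2 \<partial>lborel) = (\<integral>\<^sup>+t. indicator {a..b} t \<partial>lborel)"
    by (intro nn_integral_cong) (auto split: split_indicator)
  also have "\<dots> = ennreal (b - a)" using assms by simp
  also have "(\<integral>\<^sup>+t. (ennreal \<bar>p t\<bar> * indicator {a..b} t)\<^sup>2 \<partial>lborel)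
     = (\<integral>\<^sup>+t. ennreal ((p t)\<^sup>2) * indicator {a..b} t \<partial>lborel)"
    by (intro nn_integral_cong) (auto split: split_indicator simp: ennreal_power)
  finally show ?thesis .
qed

section \<open>The martingale of dyadic difference quotients\<close>

definition dyadic_floor :: "nat \<Rightarrow> real \<Rightarrow> real" where
  "dyadic_floor k t = of_int \<lfloor>2 ^ k * t\<rfloor> / 2 ^ k"

text \<open>For absolutely continuous \<open>h\<close> this is the conditional expectation of the
  derivative given the dyadic cells of length \<open>1 / 2 ^ k\<close>. Only two values of
  \<open>h\<close> enter, so it is stable under pointwise convergence.\<close>

definition dyadic_quot :: "(real \<Rightarrow> real) \<Rightarrow> nat \<Rightarrow> real \<Rightarrow> real" where
  "dyadic_quot h k t = 2 ^ k * (h (dyadic_floor k t + 1 / 2 ^ k) - h (dyadic_floor k t))"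

text \<open>Swapping the halves of each dyadic interval preserves Lebesgue measure; together with the
  parallelogram law this makes the dyadic difference quotients an \<open>L\<^sup>2\<close> martingale.\<close>
definition sibling :: "nat \<Rightarrow> real \<Rightarrow> real" where
  "sibling k t = (if even \<lfloor>2 ^ Suc k * t\<rfloor> then t + 1 / 2 ^ Suc k else t - 1 / 2 ^ Suc k)"

lemma measurable_dyadic_floor [measurable]: "dyadic_floor k \<in> borel_measurable borel"
  unfolding dyadic_floor_def by measurable

lemma measurable_sibling [measurable]: "sibling k \<in> borel_measurable borel"
  unfolding sibling_def by measurable

lemma measurable_dyadic_quot [measurable]:
  assumes [measurable]: "h \<in> borel_measurable borel"
  shows "dyadic_quot h k \<in> borel_measurable borel"
  unfolding dyadic_quot_def by measurable

lemma floor_dyadic_le: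
  fixes t :: real
  assumes "j \<le> l"
  shows "\<lfloor>2 ^ j * t\<rfloor> = \<lfloor>2 ^ l * t\<rfloor> div 2 ^ (l - j)"
proof -
  have "(2::real) ^ l = 2 ^ j * 2 ^ (l - j)"
    using assms by (simp add: power_add[symmetric])
  then have "2 ^ j * t = (2 ^ l * t) / real_of_int (2 ^ (l - j))" by simp
  then show ?thesis by (simp only:) (simp add: floor_divide_real_eq_div del: of_int_power)
qed

lemma floor_sibling:
  "\<lfloor>2 ^ Suc k * sibling k t\<rfloor> = (if even \<lfloor>2 ^ Suc k * t\<rfloor> then \<lfloor>2 ^ Suc k * t\<rfloor> + 1 else \<lfloor>2 ^ Suc k * t\<rfloor> - 1)"
proof -
  have "2 ^ Suc k * (t + 1 / 2 ^ Suc k) = 2 ^ Suc k * t + 1" "2 ^ Suc k * (t - 1 / 2 ^ Suc k) = 2 ^ Suc k * t - 1"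
    by (simp_all add: field_simps)
  then show ?thesis unfolding sibling_def by (simp del: power_Suc)
qed

text \<open>The two halves that are swapped make up one cell of level \<open>k\<close>, and this
  cell lies inside a single cell of every coarser level.\<close>

lemma floor_sibling_coarse: "j \<le> k \<Longrightarrow> \<lfloor>2 ^ j * sibling k t\<rfloor> = \<lfloor>2 ^ j * t\<rfloor>"
proof -
  assume j: "j \<le> k"
  have half: "\<lfloor>2 ^ k * s\<rfloor> = \<lfloor>2 ^ Suc k * s\<rfloor> div 2" for s :: real
    using floor_dyadic_le[of k "Suc k" s] by simp
  have "(if even n then n + 1 else n - 1) div 2 = n div 2" for n :: int by presburger
  then have "\<lfloor>2 ^ k * sibling k t\<rfloor> = \<lfloor>2 ^ k * t\<rfloor>"
    by (simp only: half floor_sibling)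
  then show ?thesis using floor_dyadic_le[OF j] by simp
qed

lemma dyadic_quot_sibling_coarse: "j \<le> k \<Longrightarrow> dyadic_quot h j (sibling k t) = dyadic_quot h j t"
  by (simp add: dyadic_quot_def dyadic_floor_def floor_sibling_coarse)

text \<open>The martingale property: the increments over the two halves of a cell add up to the
  increment over the cell, while the slope factor doubles.\<close>

lemma dyadic_quot_average:
  "dyadic_quot h (Suc k) t + dyadic_quot h (Suc k) (sibling k t) = 2 * dyadic_quot h k t"
proof -
  define q where "q = \<lfloor>2 ^ k * t\<rfloor>"
  have q: "\<lfloor>2 ^ Suc k * t\<rfloor> div 2 = q"
    using floor_dyadic_le[of k "Suc k" t] by (simp add: q_def)
  have f: "dyadic_floor k t = q / 2 ^ k" by (simp add: dyadic_floor_def q_def)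
  have s: "real_of_int q / 2 ^ k + 1 / 2 ^ Suc k + 1 / 2 ^ Suc k = q / 2 ^ k + 1 / 2 ^ k" by simp
  show ?thesis
  proof (cases "even \<lfloor>2 ^ Suc k * t\<rfloor>")
    case True
    then have n: "\<lfloor>2 ^ Suc k * t\<rfloor> = 2 * q" using q by auto
    then have n': "\<lfloor>2 ^ Suc k * sibling k t\<rfloor> = 2 * q + 1" using floor_sibling[of k t] by simp
    have "dyadic_floor (Suc k) t = q / 2 ^ k"
      unfolding dyadic_floor_def n by simp
    moreover have "dyadic_floor (Suc k) (sibling k t) = q / 2 ^ k + 1 / 2 ^ Suc k"
      unfolding dyadic_floor_def n' by (simp add: field_simps)
    ultimately show ?thesis
      unfolding dyadic_quot_def f by (simp only: s) (simp add: algebra_simps)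
  next
    case False
    then have n: "\<lfloor>2 ^ Suc k * t\<rfloor> = 2 * q + 1" using q by (auto elim!: oddE)
    then have n': "\<lfloor>2 ^ Suc k * sibling k t\<rfloor> = 2 * q" using floor_sibling[of k t] by simp
    have "dyadic_floor (Suc k) (sibling k t) = q / 2 ^ k"
      unfolding dyadic_floor_def n' by simp
    moreover have "dyadic_floor (Suc k) t = q / 2 ^ k + 1 / 2 ^ Suc k"
      unfolding dyadic_floor_def n by (simp add: field_simps)
    ultimately show ?thesis
      unfolding dyadic_quot_def f by (simp only: s) (simp add: algebra_simps)
  qed
qed

text \<open>On the even cells the map is a shift by one cell to the right, on the odd cells a shift
  to the left. Each shift exchanges the two families, so translation invariance on each family
  suffices.\<close>

lemma nn_integral_sibling:
  assumes [measurable]: "f \<in> borel_measurable borel"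
  shows "(\<integral>\<^sup>+t. f (sibling k t) \<partial>lborel) = (\<integral>\<^sup>+t. f t \<partial>lborel)"
proof -
  define e where "e = (1::real) / 2 ^ Suc k"
  define E where "E = {t::real. even \<lfloor>2 ^ Suc k * t\<rfloor>}"
  have [measurable]: "E \<in> sets borel" unfolding E_def by measurable
  have flip: "e + t \<in> E \<longleftrightarrow> t \<notin> E" "- e + t \<in> E \<longleftrightarrow> t \<notin> E" for t
  proof -
    have "2 ^ Suc k * (e + t) = 2 ^ Suc k * t + 1" "2 ^ Suc k * (- e + t) = 2 ^ Suc k * t - 1"
      by (simp_all add: e_def field_simps)
    then show "e + t \<in> E \<longleftrightarrow> t \<notin> E" "- e + t \<in> E \<longleftrightarrow> t \<notin> E"
      by (simp_all add: E_def del: power_Suc)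
  qed
  have "(\<integral>\<^sup>+t. f (sibling k t) \<partial>lborel) = (\<integral>\<^sup>+t. f (e + t) * indicator E t + f (- e + t) * indicator (- E) t \<partial>lborel)"
    by (intro nn_integral_cong) (auto simp: sibling_def E_def e_def add.commute split: split_indicator)
  also have "\<dots> = (\<integral>\<^sup>+t. f (e + t) * indicator E t \<partial>lborel) + (\<integral>\<^sup>+t. f (- e + t) * indicator (- E) t \<partial>lborel)"
    by (intro nn_integral_add) auto
  also have "(\<integral>\<^sup>+t. f (e + t) * indicator E t \<partial>lborel) = (\<integral>\<^sup>+t. f t * indicator (- E) t \<partial>lborel)"
    by (subst nn_integral_real_affine[of "\<lambda>t. f t * indicator (- E) t" 1 e])
      (auto simp: flip indicator_def intro!: nn_integral_cong)
  also have "(\<integral>\<^sup>+t. f (- e + t) * indicator (- E) t \<partial>lborel) = (\<integral>\<^sup>+t. f t * indicator E t \<partial>lborel)"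
    by (subst nn_integral_real_affine[of "\<lambda>t. f t * indicator E t" 1 "- e"])
      (auto simp: flip[simplified] indicator_def intro!: nn_integral_cong)
  also have "(\<integral>\<^sup>+t. f t * indicator (- E) t \<partial>lborel) + (\<integral>\<^sup>+t. f t * indicator E t \<partial>lborel)
     = (\<integral>\<^sup>+t. f t * indicator (- E) t + f t * indicator E t \<partial>lborel)"
    by (intro nn_integral_add[symmetric]) auto
  also have "\<dots> = (\<integral>\<^sup>+t. f t \<partial>lborel)"
    by (intro nn_integral_cong) (auto split: split_indicator)
  finally show ?thesis .
qed

lemma distr_sibling: "distr lborel borel (sibling k) = lborel"
proof (rule measure_eqI)
  fix A assume "A \<in> sets (distr lborel borel (sibling k))"
  then have [measurable]: "A \<in> sets borel" by simp
  have "emeasure (distr lborel borel (sibling k)) A = (\<integral>\<^sup>+t. indicator A t \<partial>(distr lborel borel (sibling k)))"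
    by simp
  also have "\<dots> = (\<integral>\<^sup>+t. indicator A (sibling k t) \<partial>lborel)"
    by (subst nn_integral_distr) auto
  also have "\<dots> = emeasure lborel A"
    by (subst nn_integral_sibling) auto
  finally show "emeasure (distr lborel borel (sibling k)) A = emeasure lborel A" .
qed simp

text \<open>The slopes at \<open>t\<close> and at its sibling have mean
  \<open>dyadic_quot h k t\<close>, and \<open>\<phi>\<close> does not distinguish the two points,
  so this is the parallelogram law integrated. Only the factor 2 is cancelled, hence infinite
  integrals are allowed.\<close>

lemma dyadic_quot_step:
  assumes [measurable]: "h \<in> borel_measurable borel" "\<phi> \<in> borel_measurable borel"
    and inv: "\<And>t. \<phi> (sibling k t) = \<phi> t"
  shows "(\<integral>\<^sup>+t. ennreal ((dyadic_quot h (Suc k) t - \<phi> t)\<^sup>2) \<partial>lborel)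
    = (\<integral>\<^sup>+t. ennreal ((dyadic_quot h k t - \<phi> t)\<^sup>2) \<partial>lborel)
      + (\<integral>\<^sup>+t. ennreal ((dyadic_quot h (Suc k) t - dyadic_quot h k t)\<^sup>2) \<partial>lborel)"
proof -
  let ?G = "dyadic_quot h"
  have pw: "(?G (Suc k) t - \<phi> t)\<^sup>2 + (?G (Suc k) (sibling k t) - \<phi> t)\<^sup>2
      = 2 * ((?G k t - \<phi> t)\<^sup>2 + (?G (Suc k) t - ?G k t)\<^sup>2)" for t
  proof -
    have "?G (Suc k) (sibling k t) = 2 * ?G k t - ?G (Suc k) t" using dyadic_quot_average[of h k t] by simp
    then show ?thesis by (simp only:) (simp add: power2_eq_square algebra_simps)
  qed
  have "2 * (\<integral>\<^sup>+t. ennreal ((?G (Suc k) t - \<phi> t)\<^sup>2) \<partial>lborel)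
     = (\<integral>\<^sup>+t. ennreal ((?G (Suc k) t - \<phi> t)\<^sup>2) \<partial>lborel)
       + (\<integral>\<^sup>+t. ennreal ((?G (Suc k) (sibling k t) - \<phi> (sibling k t))\<^sup>2) \<partial>lborel)"
    by (subst nn_integral_sibling[of "\<lambda>t. ennreal ((?G (Suc k) t - \<phi> t)\<^sup>2)"]) (auto simp: mult_2)
  also have "\<dots> = (\<integral>\<^sup>+t. ennreal ((?G (Suc k) t - \<phi> t)\<^sup>2) + ennreal ((?G (Suc k) (sibling k t) - \<phi> t)\<^sup>2) \<partial>lborel)"
    by (simp add: inv nn_integral_add)
  also have "\<dots> = (\<integral>\<^sup>+t. 2 * (ennreal ((?G k t - \<phi> t)\<^sup>2) + ennreal ((?G (Suc k) t - ?G k t)\<^sup>2)) \<partial>lborel)"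
  proof (intro nn_integral_cong)
    fix t
    show "ennreal ((?G (Suc k) t - \<phi> t)\<^sup>2) + ennreal ((?G (Suc k) (sibling k t) - \<phi> t)\<^sup>2)
      = 2 * (ennreal ((?G k t - \<phi> t)\<^sup>2) + ennreal ((?G (Suc k) t - ?G k t)\<^sup>2))"
      by (simp only: ennreal_plus[symmetric] zero_le_power2 pw)
        (subst ennreal_mult, auto)
  qed
  also have "\<dots> = 2 * ((\<integral>\<^sup>+t. ennreal ((?G k t - \<phi> t)\<^sup>2) \<partial>lborel) + (\<integral>\<^sup>+t. ennreal ((?G (Suc k) t - ?G k t)\<^sup>2) \<partial>lborel))"
    by (simp add: nn_integral_cmult nn_integral_add)
  finally show ?thesis unfolding ennreal_mult_cancel_left by simp
qed

text \<open>Pythagoras for martingale increments. Each refinement uses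
  \<open>dyadic_quot_step\<close> twice, with \<open>\<phi>\<close> zero and with
  \<open>\<phi>\<close> the quotient of level \<open>j\<close>, and both sides grow by the same
  amount.\<close>

lemma dyadic_quot_orthogonal:
  assumes [measurable]: "h \<in> borel_measurable borel" and "j \<le> l"
  shows "(\<integral>\<^sup>+t. ennreal ((dyadic_quot h l t)\<^sup>2) \<partial>lborel)
    = (\<integral>\<^sup>+t. ennreal ((dyadic_quot h j t)\<^sup>2) \<partial>lborel)
      + (\<integral>\<^sup>+t. ennreal ((dyadic_quot h l t - dyadic_quot h j t)\<^sup>2) \<partial>lborel)"
  using \<open>j \<le> l\<close>
proof (induction l rule: dec_induct)
  case base
  then show ?case by simp
next
  case (step l)
  have "(\<integral>\<^sup>+t. ennreal ((dyadic_quot h (Suc l) t)\<^sup>2) \<partial>lborel)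
    = (\<integral>\<^sup>+t. ennreal ((dyadic_quot h l t)\<^sup>2) \<partial>lborel)
      + (\<integral>\<^sup>+t. ennreal ((dyadic_quot h (Suc l) t - dyadic_quot h l t)\<^sup>2) \<partial>lborel)"
    using dyadic_quot_step[of h "\<lambda>_. 0" l] by simp
  moreover have "(\<integral>\<^sup>+t. ennreal ((dyadic_quot h (Suc l) t - dyadic_quot h j t)\<^sup>2) \<partial>lborel)
    = (\<integral>\<^sup>+t. ennreal ((dyadic_quot h l t - dyadic_quot h j t)\<^sup>2) \<partial>lborel)
      + (\<integral>\<^sup>+t. ennreal ((dyadic_quot h (Suc l) t - dyadic_quot h l t)\<^sup>2) \<partial>lborel)"
    using step by (intro dyadic_quot_step) (auto simp: dyadic_quot_sibling_coarse)
  ultimately show ?case using step.IH by (simp add: add_ac)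
qed

lemma dyadic_interval: "{t. \<lfloor>2 ^ k * t\<rfloor> = i} = {of_int i / 2 ^ k..<(of_int i + 1) / 2 ^ k :: real}"
  by (auto simp: floor_eq_iff field_simps)

lemma square_integrable_imp_set_integrable:
  fixes f :: "real \<Rightarrow> real"
  assumes [measurable]: "f \<in> borel_measurable borel" "A \<in> sets borel"
    and fin: "(\<integral>\<^sup>+t. ennreal ((f t)\<^sup>2) \<partial>lborel) < \<infinity>" "emeasure lborel A < \<infinity>"
  shows "set_integrable lborel A f"
  unfolding set_integrable_def
proof (rule integrableI_bounded)
  have "(\<integral>\<^sup>+t. ennreal (norm (indicator A t *\<^sub>R f t)) \<partial>lborel) \<le> (\<integral>\<^sup>+t. indicator A t + ennreal ((f t)\<^sup>2) \<partial>lborel)"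
  proof (intro nn_integral_mono)
    fix t
    have "\<bar>f t\<bar> \<le> 1 + (f t)\<^sup>2"
      using zero_le_power2[of "\<bar>f t\<bar> - 1"] zero_le_power2[of "f t"] unfolding power2_diff by simp
    then show "ennreal (norm (indicator A t *\<^sub>R f t)) \<le> indicator A t + ennreal ((f t)\<^sup>2)"
      by (auto split: split_indicator simp: ennreal_1[symmetric] ennreal_plus[symmetric] simp del: ennreal_plus ennreal_1)
  qed
  also have "\<dots> = emeasure lborel A + (\<integral>\<^sup>+t. ennreal ((f t)\<^sup>2) \<partial>lborel)"
    by (simp add: nn_integral_add)
  also have "\<dots> < \<infinity>" using fin by simp
  finally show "(\<integral>\<^sup>+t. ennreal (norm (indicator A t *\<^sub>R f t)) \<partial>lborel) < \<infinity>" .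
qed measurable

text \<open>Refinement by one level replaces each value by two sibling values with the same mean,
  and a cell of level \<open>k\<close> is invariant under siblings of level
  \<open>l \<ge> k\<close>; so the integral stays what it is at level \<open>k\<close>, where the
  integrand is constant.\<close>

lemma set_integral_dyadic_quot:
  assumes [measurable]: "h \<in> borel_measurable borel"
    and fin: "\<And>k. (\<integral>\<^sup>+t. ennreal ((dyadic_quot h k t)\<^sup>2) \<partial>lborel) < \<infinity>" and "k \<le> l"
  shows "(LINT t:{of_int i / 2 ^ k..<(of_int i + 1) / 2 ^ k}|lborel. dyadic_quot h l t)
     = h ((of_int i + 1) / 2 ^ k) - h (of_int i / 2 ^ k)"
  using \<open>k \<le> l\<close>
proof (induction l rule: dec_induct)
  case base
  let ?A = "{of_int i / 2 ^ k..<(of_int i + 1) / 2 ^ k :: real}"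
  have "(LINT t:?A|lborel. dyadic_quot h k t)
     = (LINT t:?A|lborel. 2 ^ k * (h ((of_int i + 1) / 2 ^ k) - h (of_int i / 2 ^ k)))"
  proof (rule set_lebesgue_integral_cong)
    show "\<forall>t. t \<in> ?A \<longrightarrow> dyadic_quot h k t = 2 ^ k * (h ((of_int i + 1) / 2 ^ k) - h (of_int i / 2 ^ k))"
      unfolding dyadic_interval[symmetric]
      by (auto simp: dyadic_quot_def dyadic_floor_def add_divide_distrib)
  qed simp
  also have "\<dots> = h ((of_int i + 1) / 2 ^ k) - h (of_int i / 2 ^ k)"
    by (simp add: set_lebesgue_integral_def) (simp add: divide_right_mono diff_divide_distrib[symmetric])
  finally show ?case .
next
  case (step l)
  let ?A = "{of_int i / 2 ^ k..<(of_int i + 1) / 2 ^ k :: real}"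
  have inv: "indicator ?A (sibling l t) = (indicator ?A t :: real)" for t
    using floor_sibling_coarse[of k l t] step by (simp add: dyadic_interval[symmetric] indicator_def)
  have int: "integrable lborel (\<lambda>t. indicator ?A t *\<^sub>R dyadic_quot h (Suc l) t)"
    using square_integrable_imp_set_integrable[of "dyadic_quot h (Suc l)" ?A] fin[of "Suc l"]
    by (cases "of_int i / 2 ^ k \<le> ((of_int i + 1) / 2 ^ k :: real)") (auto simp: set_integrable_def)
  have sw: "integrable lborel (\<lambda>t. indicator ?A t *\<^sub>R dyadic_quot h (Suc l) (sibling l t))
     \<and> (\<integral>t. indicator ?A t *\<^sub>R dyadic_quot h (Suc l) (sibling l t) \<partial>lborel)
        = (\<integral>t. indicator ?A t *\<^sub>R dyadic_quot h (Suc l) t \<partial>lborel)"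
    using int integrable_distr_eq[of "sibling l" lborel borel "\<lambda>t. indicator ?A t *\<^sub>R dyadic_quot h (Suc l) t"]
      integral_distr[of "sibling l" lborel borel "\<lambda>t. indicator ?A t *\<^sub>R dyadic_quot h (Suc l) t"]
    by (simp add: distr_sibling inv)
  have "2 * (LINT t:?A|lborel. dyadic_quot h l t) = (\<integral>t. indicator ?A t *\<^sub>R (2 * dyadic_quot h l t) \<partial>lborel)"
    by (simp add: set_lebesgue_integral_def mult.left_commute)
  also have "\<dots> = (\<integral>t. indicator ?A t *\<^sub>R dyadic_quot h (Suc l) t + indicator ?A t *\<^sub>R dyadic_quot h (Suc l) (sibling l t) \<partial>lborel)"
    by (simp add: dyadic_quot_average[symmetric] algebra_simps)
  also have "\<dots> = 2 * (LINT t:?A|lborel. dyadic_quot h (Suc l) t)"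
    using int sw by (subst Bochner_Integration.integral_add) (auto simp: set_lebesgue_integral_def)
  finally show ?case using step.IH by simp
qed

text \<open>Cauchy-Schwarz on one cell gives \<open>2 ^ k\<close> times the integral of
  \<open>p^2\<close> over that cell. Only the bound \<open>var\<close> on increments enters, so the
  result applies to moduli of complex profiles.\<close>

lemma dyadic_quot_energy_le:
  fixes h p :: "real \<Rightarrow> real"
  assumes [measurable]: "h \<in> borel_measurable borel" "p \<in> borel_measurable borel"
    and var: "\<And>a b. a \<le> b \<Longrightarrow> ennreal \<bar>h b - h a\<bar> \<le> (\<integral>\<^sup>+t. ennreal \<bar>p t\<bar> * indicator {a..b} t \<partial>lborel)"
  shows "(\<integral>\<^sup>+t. ennreal ((dyadic_quot h k t)\<^sup>2) \<partial>lborel) \<le> (\<integral>\<^sup>+t. ennreal ((p t)\<^sup>2) \<partial>lborel)"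
proof -
  \<comment> \<open>The symmetric same-cell kernel replaces a sum over cells: after Tonelli its
    inner integral is the cell length, which cancels \<open>2 ^ k\<close>.\<close>
  define I where "I s t = (if \<lfloor>2 ^ k * s\<rfloor> = \<lfloor>2 ^ k * t\<rfloor> then 1 else 0 :: ennreal)" for s t :: real
  have [measurable]: "(\<lambda>(s, t). I s t) \<in> borel_measurable (borel \<Otimes>\<^sub>M borel)"
    unfolding I_def by measurable
  have bound: "ennreal ((dyadic_quot h k t)\<^sup>2) \<le> (\<integral>\<^sup>+s. ennreal (2 ^ k) * (ennreal ((p s)\<^sup>2) * I s t) \<partial>lborel)" for t
  proof -
    define c where "c = dyadic_floor k t"
    have "ennreal ((dyadic_quot h k t)\<^sup>2) = ennreal ((2 ^ k)\<^sup>2) * (ennreal \<bar>h (c + 1 / 2 ^ k) - h c\<bar>)\<^sup>2"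
      by (simp add: dyadic_quot_def c_def power_mult_distrib ennreal_mult ennreal_power)
    also have "\<dots> \<le> ennreal ((2 ^ k)\<^sup>2) * (\<integral>\<^sup>+s. ennreal \<bar>p s\<bar> * indicator {c..c + 1 / 2 ^ k} s \<partial>lborel)\<^sup>2"
      by (intro mult_left_mono power_mono var) auto
    also have "\<dots> \<le> ennreal ((2 ^ k)\<^sup>2) * (ennreal (1 / 2 ^ k) * (\<integral>\<^sup>+s. ennreal ((p s)\<^sup>2) * indicator {c..c + 1 / 2 ^ k} s \<partial>lborel))"
      using Cauchy_Schwarz_interval[of p c "c + 1 / 2 ^ k"] by (intro mult_left_mono) auto
    also have "\<dots> = ennreal (2 ^ k) * (\<integral>\<^sup>+s. ennreal ((p s)\<^sup>2) * indicator {c..c + 1 / 2 ^ k} s \<partial>lborel)"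
      by (simp add: mult.assoc[symmetric] ennreal_mult[symmetric] power2_eq_square)
    also have "(\<integral>\<^sup>+s. ennreal ((p s)\<^sup>2) * indicator {c..c + 1 / 2 ^ k} s \<partial>lborel) = (\<integral>\<^sup>+s. ennreal ((p s)\<^sup>2) * I s t \<partial>lborel)"
    proof (rule nn_integral_cong_AE)
      show "AE s in lborel. ennreal ((p s)\<^sup>2) * indicator {c..c + 1 / 2 ^ k} s = ennreal ((p s)\<^sup>2) * I s t"
        using AE_lborel_singleton[of "c + 1 / 2 ^ k"]
      proof eventually_elim
        case (elim s)
        have "I s t = indicator {s. \<lfloor>2 ^ k * s\<rfloor> = \<lfloor>2 ^ k * t\<rfloor>} s" by (simp add: I_def)
        also have "\<dots> = indicator {c..c + 1 / 2 ^ k} s"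
          using elim unfolding dyadic_interval
          by (auto simp: c_def dyadic_floor_def add_divide_distrib split: split_indicator)
        finally show ?case by simp
      qed
    qed
    also have "ennreal (2 ^ k) * \<dots> = (\<integral>\<^sup>+s. ennreal (2 ^ k) * (ennreal ((p s)\<^sup>2) * I s t) \<partial>lborel)"
      by (intro nn_integral_cmult[symmetric]) measurable
    finally show ?thesis .
  qed
  have inner: "(\<integral>\<^sup>+t. ennreal (2 ^ k) * (ennreal ((p s)\<^sup>2) * I s t) \<partial>lborel) = ennreal ((p s)\<^sup>2)" for s
  proof -
    have "(\<integral>\<^sup>+t. I s t \<partial>lborel) = (\<integral>\<^sup>+t. indicator {t::real. \<lfloor>2 ^ k * t\<rfloor> = \<lfloor>2 ^ k * s\<rfloor>} t \<partial>lborel)"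
      by (intro nn_integral_cong) (auto simp: I_def)
    also have "\<dots> = ennreal (1 / 2 ^ k)"
      unfolding dyadic_interval by (simp add: divide_right_mono diff_divide_distrib[symmetric])
    finally have "(\<integral>\<^sup>+t. I s t \<partial>lborel) = ennreal (1 / 2 ^ k)" .
    then have "(\<integral>\<^sup>+t. ennreal (2 ^ k) * (ennreal ((p s)\<^sup>2) * I s t) \<partial>lborel)
       = ennreal (2 ^ k) * (ennreal ((p s)\<^sup>2) * ennreal (1 / 2 ^ k))"
      by (simp add: nn_integral_cmult)
    also have "\<dots> = ennreal ((p s)\<^sup>2)" by (simp add: ennreal_mult[symmetric])
    finally show ?thesis .
  qed
  have "(\<integral>\<^sup>+t. ennreal ((dyadic_quot h k t)\<^sup>2) \<partial>lborel)
      \<le> (\<integral>\<^sup>+t. (\<integral>\<^sup>+s. ennreal (2 ^ k) * (ennreal ((p s)\<^sup>2) * I s t) \<partial>lborel) \<partial>lborel)"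
    by (intro nn_integral_mono bound)
  also have "\<dots> = (\<integral>\<^sup>+s. (\<integral>\<^sup>+t. ennreal (2 ^ k) * (ennreal ((p s)\<^sup>2) * I s t) \<partial>lborel) \<partial>lborel)"
    by (rule lborel_pair.Fubini'[symmetric]) measurable
  also have "\<dots> = (\<integral>\<^sup>+t. ennreal ((p t)\<^sup>2) \<partial>lborel)" by (simp add: inner)
  finally show ?thesis .
qed

lemma nn_integral_fatou:
  assumes [measurable]: "\<And>i. u i \<in> borel_measurable M" "f \<in> borel_measurable M"
    and lim: "AE x in M. (\<lambda>i. u i x) \<longlonglongrightarrow> (f x :: ennreal)"
  shows "(\<integral>\<^sup>+x. f x \<partial>M) \<le> liminf (\<lambda>i. \<integral>\<^sup>+x. u i x \<partial>M)"
proof -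
  have "(\<integral>\<^sup>+x. f x \<partial>M) = (\<integral>\<^sup>+x. liminf (\<lambda>i. u i x) \<partial>M)"
  proof (rule nn_integral_cong_AE)
    show "AE x in M. f x = liminf (\<lambda>i. u i x)"
      using lim by eventually_elim (simp add: lim_imp_Liminf)
  qed
  also have "\<dots> \<le> liminf (\<lambda>i. \<integral>\<^sup>+x. u i x \<partial>M)"
    by (rule nn_integral_liminf) auto
  finally show ?thesis .
qed

lemma liminf_le_const:
  fixes X :: "nat \<Rightarrow> 'a :: {complete_linorder}"
  assumes "\<forall>\<^sub>F i in sequentially. X i \<le> c"
  shows "liminf X \<le> c"
  using Limsup_bounded[OF assms] Liminf_le_Limsup[of sequentially X] by simp

text \<open>The bounded martingale of quotients converges in square mean, and along a fast
  subsequence almost everywhere. Its integrals over dyadic cells are exact at all finer levels,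
  hence exact for the limit \<open>g\<close>; continuity of \<open>h\<close> extends the identity to
  arbitrary intervals.\<close>

proposition riesz_derivative:
  fixes h :: "real \<Rightarrow> real"
  assumes cont: "continuous_on UNIV h"
    and bound: "\<And>k. (\<integral>\<^sup>+t. ennreal ((dyadic_quot h k t)\<^sup>2) \<partial>lborel) \<le> ennreal C"
  obtains g where "g \<in> borel_measurable borel" "(\<integral>\<^sup>+t. ennreal ((g t)\<^sup>2) \<partial>lborel) \<le> ennreal C"
    "\<And>a b. a \<le> b \<Longrightarrow> set_integrable lborel {a..b} g"
    "\<And>a b. a \<le> b \<Longrightarrow> h b - h a = (LINT t:{a..b}|lborel. g t)"
proof -
  have [measurable]: "h \<in> borel_measurable borel"
    using cont by (rule borel_measurable_continuous_onI)
  let ?G = "dyadic_quot h"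
  have finG: "(\<integral>\<^sup>+t. ennreal ((?G k t)\<^sup>2) \<partial>lborel) < \<infinity>" for k
    using bound[of k] by (simp add: order_le_less_trans)
  define Q where "Q k = enn2real (\<integral>\<^sup>+t. ennreal ((?G k t)\<^sup>2) \<partial>lborel)" for k
  have eQ: "(\<integral>\<^sup>+t. ennreal ((?G k t)\<^sup>2) \<partial>lborel) = ennreal (Q k)" for k
    using finG[of k] by (simp add: Q_def)
  have Q0: "Q k \<ge> 0" for k by (simp add: Q_def)
  \<comment> \<open>Orthogonality makes squared distances equal to differences of the monotone
    bounded sequence \<open>Q\<close>, so the quotients are Cauchy in square mean.\<close>
  have X: "Q j \<le> Q l \<and> (\<integral>\<^sup>+t. ennreal ((?G l t - ?G j t)\<^sup>2) \<partial>lborel) = ennreal (Q l - Q j)" if "j \<le> l" for j l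
  proof -
    define Y where "Y = (\<integral>\<^sup>+t. ennreal ((?G l t - ?G j t)\<^sup>2) \<partial>lborel)"
    have *: "ennreal (Q l) = ennreal (Q j) + Y"
      using dyadic_quot_orthogonal[of h j l] that by (simp add: eQ Y_def)
    then have "Y \<noteq> top" by auto
    then obtain y where y: "Y = ennreal y" "y \<ge> 0" by (cases Y) auto
    then have "Q l = Q j + y" using * Q0 by (simp add: ennreal_plus[symmetric] del: ennreal_plus)
    then show ?thesis using y by (simp add: Y_def)
  qed
  have "incseq Q" using X by (simp add: incseq_def)
  moreover have "Q k \<le> max 0 C" for k
    using bound[of k] by (auto simp: eQ ennreal_le_iff2)
  ultimately obtain L where L: "Q \<longlonglongrightarrow> L" "\<And>i. Q i \<le> L"
    by (metis incseq_convergent)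
  \<comment> \<open>The rate \<open>1/8\<close> leaves \<open>(1/2) ^ j\<close> after the weight
    \<open>4 ^ j\<close> below, and \<open>(1/4) ^ j\<close> after the weight \<open>2 ^ j\<close>
    in the convergence of integrals.\<close>
  have "\<exists>k\<ge>j. L - Q k \<le> (1/8) ^ j" for j
  proof -
    have "eventually (\<lambda>k. dist (Q k) L < (1/8) ^ j) sequentially"
      using L(1) by (intro tendstoD) auto
    then obtain N where "\<And>k. k \<ge> N \<Longrightarrow> dist (Q k) L < (1/8) ^ j" by (auto simp: eventually_sequentially)
    then have "dist (Q (max N j)) L < (1/8) ^ j" by simp
    then show ?thesis by (intro exI[of _ "max N j"]) (auto simp: dist_real_def)
  qed
  then obtain r where r: "\<And>j. r j \<ge> j" "\<And>j. L - Q (r j) \<le> (1/8) ^ j" by metis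
  define v where "v j = ?G (r j)" for j
  have [measurable]: "v j \<in> borel_measurable borel" for j by (simp add: v_def)
  have vv: "(\<integral>\<^sup>+t. ennreal ((v i t - v j t)\<^sup>2) \<partial>lborel) \<le> ennreal ((1/8) ^ j)" if "j \<le> i" for i j
  proof -
    have le: "L - Q (r i) \<le> (1/8) ^ j"
      by (rule order_trans[OF r(2)]) (use that in \<open>auto intro: power_decreasing\<close>)
    show ?thesis
    \<comment> \<open>The levels \<open>r\<close> are not chosen monotone, so either index may
      belong to the finer quotient.\<close>
    proof (cases "r j \<le> r i")
      case True
      then show ?thesis using X[OF True] r(2)[of j] L(2)[of "r i"] by (simp add: v_def ennreal_leI)
    next
      case False
      then have "r i \<le> r j" by simp
      from X[OF this] show ?thesis using le L(2)[of "r j"]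
        by (simp add: v_def power2_commute[of "?G (r i) _"] ennreal_leI)
    qed
  qed
  \<comment> \<open>Finiteness of this weighted sum forces increments of order
    \<open>(1/2) ^ j\<close> at almost every point, hence a convergent telescoping series.\<close>
  have "AE t in lborel. (\<Sum>j. ennreal (4 ^ j * (v (Suc j) t - v j t)\<^sup>2)) \<noteq> \<infinity>"
  proof (rule nn_integral_PInf_AE)
    have "(\<integral>\<^sup>+t. (\<Sum>j. ennreal (4 ^ j * (v (Suc j) t - v j t)\<^sup>2)) \<partial>lborel)
       = (\<Sum>j. \<integral>\<^sup>+t. ennreal (4 ^ j * (v (Suc j) t - v j t)\<^sup>2) \<partial>lborel)"
      by (rule nn_integral_suminf) auto
    also have "\<dots> \<le> (\<Sum>j. ennreal ((1/2) ^ j))"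
    proof (rule suminf_le)
      fix j
      have "(\<integral>\<^sup>+t. ennreal (4 ^ j * (v (Suc j) t - v j t)\<^sup>2) \<partial>lborel)
         = ennreal (4 ^ j) * (\<integral>\<^sup>+t. ennreal ((v (Suc j) t - v j t)\<^sup>2) \<partial>lborel)"
        by (simp add: ennreal_mult nn_integral_cmult)
      also have "\<dots> \<le> ennreal (4 ^ j) * ennreal ((1/8) ^ j)"
        by (intro mult_left_mono vv) auto
      also have "\<dots> = ennreal ((1/2) ^ j)"
        by (simp add: ennreal_mult[symmetric] power_mult_distrib[symmetric])
      finally show "(\<integral>\<^sup>+t. ennreal (4 ^ j * (v (Suc j) t - v j t)\<^sup>2) \<partial>lborel) \<le> ennreal ((1/2) ^ j)" .
    qed auto
    also have "\<dots> = ennreal (\<Sum>j. (1/2) ^ j)"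
      by (intro suminf_ennreal2 summable_geometric) auto
    also have "\<dots> < \<infinity>" by simp
    finally show "(\<integral>\<^sup>+t. (\<Sum>j. ennreal (4 ^ j * (v (Suc j) t - v j t)\<^sup>2)) \<partial>lborel) \<noteq> \<infinity>" by simp
  qed measurable
  then have conv: "AE t in lborel. convergent (\<lambda>j. v j t)"
  proof eventually_elim
    case (elim t)
    define S where "S = (\<Sum>j. ennreal (4 ^ j * (v (Suc j) t - v j t)\<^sup>2))"
    define K where "K = enn2real S"
    have "S = ennreal K" using elim unfolding K_def S_def[symmetric] by (simp add: less_top)
    then have K: "K \<ge> 0" "(\<Sum>j. ennreal (4 ^ j * (v (Suc j) t - v j t)\<^sup>2)) = ennreal K"
      by (simp_all add: K_def S_def)
    have "norm (v (Suc j) t - v j t) \<le> sqrt (K + 1) * (1/2) ^ j" for j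
    proof -
      have "ennreal (4 ^ j * (v (Suc j) t - v j t)\<^sup>2) < ennreal (K + 1)"
        by (rule ennreal_suminf_lessD) (use K in \<open>simp add: ennreal_less_iff\<close>)
      moreover have four: "((2::real) ^ j)\<^sup>2 = 4 ^ j"
        by (simp add: power2_eq_square power_mult_distrib[symmetric])
      ultimately have "4 ^ j * (v (Suc j) t - v j t)\<^sup>2 \<le> K + 1"
        by (simp add: ennreal_less_iff)
      then have "(2 ^ j * \<bar>v (Suc j) t - v j t\<bar>)\<^sup>2 \<le> K + 1"
        by (simp only: power_mult_distrib four power2_abs)
      then have "2 ^ j * \<bar>v (Suc j) t - v j t\<bar> \<le> sqrt (K + 1)"
        by (rule real_le_rsqrt)
      then show ?thesis by (simp add: field_simps power_divide)
    qed
    then have "summable (\<lambda>j. v (Suc j) t - v j t)"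
      by (rule summable_comparison_test'[where g = "\<lambda>j. sqrt (K + 1) * (1/2) ^ j", rotated])
        (rule summable_mult, rule summable_geometric, simp)
    then have "convergent (\<lambda>n. \<Sum>j<n. v (Suc j) t - v j t)"
      by (simp add: summable_iff_convergent)
    then have "convergent (\<lambda>n. v n t - v 0 t)" by (simp add: sum_lessThan_telescope[of "\<lambda>n. v n t"])
    then show ?case by (simp add: convergent_diff_const_right_iff)
  qed
  define g where "g t = lim (\<lambda>j. v j t)" for t
  have g_meas[measurable]: "g \<in> borel_measurable borel" unfolding g_def by measurable
  have lim: "AE t in lborel. (\<lambda>j. v j t) \<longlonglongrightarrow> g t"
    using conv by eventually_elim (simp add: g_def convergent_LIMSEQ_iff)
  have gC: "(\<integral>\<^sup>+t. ennreal ((g t)\<^sup>2) \<partial>lborel) \<le> ennreal C"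
  proof -
    have "(\<integral>\<^sup>+t. ennreal ((g t)\<^sup>2) \<partial>lborel) \<le> liminf (\<lambda>j. \<integral>\<^sup>+t. ennreal ((v j t)\<^sup>2) \<partial>lborel)"
    proof (rule nn_integral_fatou)
      show "AE t in lborel. (\<lambda>j. ennreal ((v j t)\<^sup>2)) \<longlonglongrightarrow> ennreal ((g t)\<^sup>2)"
        using lim by eventually_elim (auto intro!: tendsto_intros)
    qed auto
    also have "\<dots> \<le> ennreal C" by (rule liminf_le_const) (simp add: v_def bound)
    finally show ?thesis .
  qed
  have gv: "(\<integral>\<^sup>+t. ennreal ((v j t - g t)\<^sup>2) \<partial>lborel) \<le> ennreal ((1/8) ^ j)" for j
  proof -
    have "(\<integral>\<^sup>+t. ennreal ((v j t - g t)\<^sup>2) \<partial>lborel) \<le> liminf (\<lambda>i. \<integral>\<^sup>+t. ennreal ((v j t - v i t)\<^sup>2) \<partial>lborel)"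
    proof (rule nn_integral_fatou)
      show "AE t in lborel. (\<lambda>i. ennreal ((v j t - v i t)\<^sup>2)) \<longlonglongrightarrow> ennreal ((v j t - g t)\<^sup>2)"
        using lim by eventually_elim (auto intro!: tendsto_intros)
    qed auto
    also have "\<dots> \<le> ennreal ((1/8) ^ j)"
      by (rule liminf_le_const, rule eventually_sequentiallyI[of j]) (simp add: vv power2_commute[of "v j _"])
    finally show ?thesis .
  qed
  have int_v: "set_integrable lborel A (v j)" if "A \<in> sets borel" "emeasure lborel A < \<infinity>" for A j
    using that finG[of "r j"] by (intro square_integrable_imp_set_integrable) (auto simp: v_def)
  have int_g: "set_integrable lborel A g" if "A \<in> sets borel" "emeasure lborel A < \<infinity>" for A
    using that gC by (intro square_integrable_imp_set_integrable) (auto intro: order_le_less_trans)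
  have L1: "(\<lambda>j. LINT t:A|lborel. v j t) \<longlonglongrightarrow> (LINT t:A|lborel. g t)"
    if A[measurable]: "A \<in> sets borel" and fin: "emeasure lborel A < \<infinity>" for A
    unfolding set_lebesgue_integral_def
  proof (rule tendsto_L1_int)
    obtain c where c: "c \<ge> 0" "emeasure lborel A = ennreal c" using fin by (cases "emeasure lborel A") auto
    have le: "(\<integral>\<^sup>+t. ennreal (norm (indicator A t *\<^sub>R v j t - indicator A t *\<^sub>R g t)) \<partial>lborel) \<le> ennreal ((1/2) ^ j * c + (1/4) ^ j)" for j
    proof -
      have "(\<integral>\<^sup>+t. ennreal (norm (indicator A t *\<^sub>R v j t - indicator A t *\<^sub>R g t)) \<partial>lborel)
         \<le> (\<integral>\<^sup>+t. ennreal ((1/2) ^ j) * indicator A t + ennreal (2 ^ j) * ennreal ((v j t - g t)\<^sup>2) \<partial>lborel)"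
      proof (intro nn_integral_mono)
        fix t
        define d where "d = \<bar>v j t - g t\<bar>"
        \<comment> \<open>A weighted Young inequality in place of Cauchy-Schwarz: over a set of
          finite measure both terms vanish in the limit, the second because the integral of
          \<open>d^2\<close> is at most \<open>(1/8) ^ j\<close>.\<close>
        have "d \<le> (1/2) ^ j + 2 ^ j * d\<^sup>2"
        proof -
          have "0 \<le> (1/2) ^ j * (1 - 2 ^ j * d)\<^sup>2 + d" by (simp add: d_def)
          also have "\<dots> = (1/2) ^ j * (1 + (2 ^ j)\<^sup>2 * d\<^sup>2 - 2 * (2 ^ j * d)) + d"
            by (simp add: power2_eq_square algebra_simps)
          also have "\<dots> = (1/2) ^ j + 2 ^ j * d\<^sup>2 - d"
            by (simp add: power_divide power2_eq_square field_simps)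
          finally show ?thesis by simp
        qed
        then show "ennreal (norm (indicator A t *\<^sub>R v j t - indicator A t *\<^sub>R g t))
          \<le> ennreal ((1/2) ^ j) * indicator A t + ennreal (2 ^ j) * ennreal ((v j t - g t)\<^sup>2)"
          by (auto split: split_indicator simp: d_def ennreal_mult[symmetric] ennreal_plus[symmetric] ennreal_leI simp del: ennreal_plus)
      qed
      also have "\<dots> = ennreal ((1/2) ^ j) * ennreal c + ennreal (2 ^ j) * (\<integral>\<^sup>+t. ennreal ((v j t - g t)\<^sup>2) \<partial>lborel)"
        by (simp add: nn_integral_add nn_integral_cmult c(2)[symmetric] nn_integral_cmult_indicator)
      also have "\<dots> \<le> ennreal ((1/2) ^ j) * ennreal c + ennreal (2 ^ j) * ennreal ((1/8) ^ j)"
        by (intro add_left_mono mult_left_mono gv) auto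
      also have "\<dots> = ennreal ((1/2) ^ j * c + (1/4) ^ j)"
        using c by (simp add: ennreal_mult[symmetric] ennreal_plus[symmetric] power_mult_distrib[symmetric] del: ennreal_plus)
      finally show ?thesis .
    qed
    have "(\<lambda>j. ennreal ((1/2) ^ j * c + (1/4) ^ j)) \<longlonglongrightarrow> ennreal (0 * c + 0)"
      by (intro tendsto_intros tendsto_ennrealI LIMSEQ_power_zero) auto
    then show "(\<lambda>j. \<integral>\<^sup>+t. ennreal (norm (indicator A t *\<^sub>R v j t - indicator A t *\<^sub>R g t)) \<partial>lborel) \<longlonglongrightarrow> 0"
      using tendsto_sandwich[OF _ always_eventually[OF allI[OF le]] tendsto_const[of 0]] by simp
  qed (use int_v[OF that] int_g[OF that] in \<open>auto simp: set_integrable_def\<close>)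
  have finI: "emeasure lborel {a..<b} < \<infinity>" for a b :: real
    by (cases "a \<le> b") auto
  have cell: "(LINT t:{of_int i / 2 ^ k..<(of_int i + 1) / 2 ^ k}|lborel. g t)
     = h ((of_int i + 1) / 2 ^ k) - h (of_int i / 2 ^ k)" for i :: int and k
  proof (rule LIMSEQ_unique[OF L1])
    \<comment> \<open>Once \<open>j \<ge> k\<close>, also \<open>r j \<ge> k\<close>, and from then
      on the sequence of cell integrals is constant.\<close>
    have "eventually (\<lambda>j. (LINT t:{of_int i / 2 ^ k..<(of_int i + 1) / 2 ^ k}|lborel. v j t)
       = h ((of_int i + 1) / 2 ^ k) - h (of_int i / 2 ^ k)) sequentially"
      using r(1) by (intro eventually_sequentiallyI[of k])
        (auto simp: v_def intro!: set_integral_dyadic_quot finG[unfolded infinity_ennreal_def] intro: order_trans)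
    then show "(\<lambda>j. LINT t:{of_int i / 2 ^ k..<(of_int i + 1) / 2 ^ k}|lborel. v j t)
       \<longlonglongrightarrow> h ((of_int i + 1) / 2 ^ k) - h (of_int i / 2 ^ k)"
      by (rule tendsto_eventually)
  qed (auto simp: finI[unfolded infinity_ennreal_def])
  have grid: "(LINT t:{of_int i / 2 ^ k..<of_int i' / 2 ^ k}|lborel. g t) = h (of_int i' / 2 ^ k) - h (of_int i / 2 ^ k)"
    if "i \<le> i'" for i i' :: int and k
    using that
  proof (induction i' rule: int_ge_induct)
    case base
    then show ?case by (simp add: set_lebesgue_integral_def)
  next
    case (step n)
    have "{of_int i / 2 ^ k..<of_int (n + 1) / 2 ^ k :: real}
       = {of_int i / 2 ^ k..<of_int n / 2 ^ k} \<union> {of_int n / 2 ^ k..<(of_int n + 1) / 2 ^ k}"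
    proof -
      have "of_int i / 2 ^ k \<le> (of_int n / 2 ^ k :: real)" "of_int n / 2 ^ k \<le> ((of_int n + 1) / 2 ^ k :: real)"
        using step by (auto intro!: divide_right_mono)
      then show ?thesis by (auto simp: ivl_disj_un)
    qed
    then have "(LINT t:{of_int i / 2 ^ k..<of_int (n + 1) / 2 ^ k}|lborel. g t)
      = (LINT t:{of_int i / 2 ^ k..<of_int n / 2 ^ k}|lborel. g t) + (LINT t:{of_int n / 2 ^ k..<(of_int n + 1) / 2 ^ k}|lborel. g t)"
      by (simp only:) (intro set_integral_Un int_g finI; auto)
    then show ?case using step.IH cell[of n k] by simp
  qed
  have fl: "dyadic_floor k t \<le> t" "t < dyadic_floor k t + (1/2) ^ k" for k t
  proof -
    have "of_int \<lfloor>2 ^ k * t\<rfloor> \<le> 2 ^ k * t" "2 ^ k * t < of_int \<lfloor>2 ^ k * t\<rfloor> + 1" by linarith+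
    then show "dyadic_floor k t \<le> t" "t < dyadic_floor k t + (1/2) ^ k"
      by (simp_all add: dyadic_floor_def field_simps power_divide)
  qed
  have fl_lim: "(\<lambda>k. dyadic_floor k t) \<longlonglongrightarrow> t" for t
  proof (rule tendsto_sandwich[of "\<lambda>k. t - (1/2) ^ k"])
    have "(\<lambda>k. t - (1/2) ^ k) \<longlonglongrightarrow> t - 0"
      by (intro tendsto_intros LIMSEQ_power_zero) auto
    then show "(\<lambda>k. t - (1/2) ^ k) \<longlonglongrightarrow> t" by simp
    show "\<forall>\<^sub>F k in sequentially. t - (1/2) ^ k \<le> dyadic_floor k t"
      using fl(2)[of t] by (auto simp: less_imp_le diff_le_eq)
  qed (use fl in auto)
  have "h b - h a = (LINT t:{a..b}|lborel. g t)" if ab: "a \<le> b" for a b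
  proof (rule LIMSEQ_unique)
    have isc: "isCont h x" for x using cont by (simp add: continuous_on_eq_continuous_at)
    have "(\<lambda>k. h (dyadic_floor k b) - h (dyadic_floor k a)) \<longlonglongrightarrow> h b - h a"
      by (intro tendsto_diff isCont_tendsto_compose[OF isc] fl_lim)
    moreover have "(LINT t:{dyadic_floor k a..<dyadic_floor k b}|lborel. g t) = h (dyadic_floor k b) - h (dyadic_floor k a)" for k
      unfolding dyadic_floor_def using ab by (intro grid floor_mono mult_left_mono) auto
    ultimately show "(\<lambda>k. LINT t:{dyadic_floor k a..<dyadic_floor k b}|lborel. g t) \<longlonglongrightarrow> h b - h a" by simp
    show "(\<lambda>k. LINT t:{dyadic_floor k a..<dyadic_floor k b}|lborel. g t) \<longlonglongrightarrow> (LINT t:{a..b}|lborel. g t)"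
      unfolding set_lebesgue_integral_def
    \<comment> \<open>\<open>dyadic_floor k a\<close> may lie below \<open>a\<close>, but by less
      than 1 at every level, so one window serves all \<open>k\<close>.\<close>
    proof (rule integral_dominated_convergence[where w = "\<lambda>t. \<bar>indicator {a - 1..b} t *\<^sub>R g t\<bar>"])
      show "integrable lborel (\<lambda>t. \<bar>indicator {a - 1..b} t *\<^sub>R g t\<bar>)"
        using int_g[of "{a - 1..b}"] ab by (intro integrable_abs) (auto simp: set_integrable_def)
      have "a - 1 \<le> dyadic_floor k a" for k
        using fl(2)[of a k] power_le_one[of "1/2::real" k] by simp
      then show "AE t in lborel. norm (indicator {dyadic_floor k a..<dyadic_floor k b} t *\<^sub>R g t) \<le> \<bar>indicator {a - 1..b} t *\<^sub>R g t\<bar>" for k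
        using fl(1)[of k b] by (intro AE_I2) (auto split: split_indicator intro: order_trans)
      show "AE t in lborel. (\<lambda>k. indicator {dyadic_floor k a..<dyadic_floor k b} t *\<^sub>R g t) \<longlonglongrightarrow> indicator {a..b} t *\<^sub>R g t"
        using AE_lborel_singleton[of a] AE_lborel_singleton[of b]
      proof eventually_elim
        case (elim t)
        have "\<forall>\<^sub>F k in sequentially. indicator {dyadic_floor k a..<dyadic_floor k b} t = (indicator {a..b} t :: real)"
        proof -
          consider "t < a" | "a < t" "t < b" | "t > b" using elim by linarith
          then show ?thesis
          proof cases
            case 1
            then have "\<forall>\<^sub>F k in sequentially. t < dyadic_floor k a" by (intro order_tendstoD(1)[OF fl_lim])
            then show ?thesis by eventually_elim (use 1 in auto)
          next
            case 2
            then have "\<forall>\<^sub>F k in sequentially. t < dyadic_floor k b" by (intro order_tendstoD(1)[OF fl_lim])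
            then show ?thesis
            proof eventually_elim
              case (elim k)
              then show ?case using 2 fl(1)[of k a] by auto
            qed
          next
            case 3
            then have "\<not> t < dyadic_floor k b" for k using fl(1)[of k b] by simp
            then show ?thesis using 3 by (intro always_eventually) (auto split: split_indicator)
          qed
        qed
        then show ?case by (intro tendsto_scaleR tendsto_const tendsto_eventually)
      qed
    qed measurable
  qed
  then show ?thesis using that[OF g_meas gC] int_g by auto
qed

section \<open>Radial functions in the logarithmic variable\<close>

text \<open>Half-lines are an intersection-stable generator of the Borel sets, and sets with
  vanishing integral are closed under complements and countable disjoint unions. Truncation to
  \<open>{- real n..real n}\<close> makes \<open>d\<close> integrable, as these closure steps
  require.\<close>

lemma interval_integrals_zero_imp_AE_zero:
  fixes d :: "real \<Rightarrow> complex"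
  assumes [measurable]: "d \<in> borel_measurable borel"
    and int: "\<And>a b. a \<le> b \<Longrightarrow> set_integrable lborel {a..b} d"
    and zero: "\<And>a b. a \<le> b \<Longrightarrow> (LINT t:{a..b}|lborel. d t) = 0"
  shows "AE t in lborel. d t = 0"
proof -
  have loc: "AE t in lborel. indicator {- real n..real n} t *\<^sub>R d t = 0" for n
  proof (rule sigma_finite_measure.density_zero[OF lborel.sigma_finite_measure_axioms])
    let ?J = "{- real n..real n}"
    let ?D = "\<lambda>t. indicator ?J t *\<^sub>R d t"
    show intD: "integrable lborel ?D" using int[of "- real n" "real n"] by (simp add: set_integrable_def)
    have intA: "set_integrable lborel A ?D" if "A \<in> sets borel" for A
      unfolding set_integrable_def by (rule integrable_mult_indicator[OF _ intD]) (use that in simp)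
    fix A assume "A \<in> sets (lborel :: real measure)"
    then have A: "A \<in> sigma_sets UNIV (range (\<lambda>a. {..a::real}))"
      by (simp add: borel_eq_atMost)
    have stable: "Int_stable (range (\<lambda>a. {..a::real}))"
      by (auto simp: Int_stable_def)
    have pow: "range (\<lambda>a. {..a::real}) \<subseteq> Pow UNIV" by simp
    from stable pow A show "(LINT t:A|lborel. ?D t) = 0"
    proof (induction rule: sigma_sets_induct_disjoint)
      case (basic A)
      then obtain x where A: "A = {..x}" by auto
      have "(LINT t:A|lborel. ?D t) = (LINT t:{- real n..min x (real n)}|lborel. d t)"
        unfolding set_lebesgue_integral_def A
        by (intro Bochner_Integration.integral_cong) (auto split: split_indicator)
      also have "\<dots> = 0"
        using zero[of "- real n" "min x (real n)"]
        by (cases "- real n \<le> min x (real n)") (auto simp: set_lebesgue_integral_def)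
      finally show ?case .
    next
      case empty
      then show ?case by (simp add: set_lebesgue_integral_def)
    next
      case (compl A)
      then have A[measurable]: "A \<in> sets borel" by (simp add: borel_eq_atMost)
      have "(LINT t:UNIV - A|lborel. ?D t) = (\<integral>t. ?D t - indicator A t *\<^sub>R ?D t \<partial>lborel)"
        unfolding set_lebesgue_integral_def
        by (intro Bochner_Integration.integral_cong) (auto split: split_indicator)
      also have "\<dots> = (LINT t:?J|lborel. d t) - (LINT t:A|lborel. ?D t)"
        using intD intA[OF A] unfolding set_lebesgue_integral_def set_integrable_def
        by (subst Bochner_Integration.integral_diff) auto
      finally show ?case using compl zero[of "- real n" "real n"] by simp
    next
      case (union A)
      then have A[measurable]: "A i \<in> sets borel" for i by (auto simp: borel_eq_atMost)
      have "(LINT t:(\<Union>i. A i)|lborel. ?D t) = (\<Sum>i. (LINT t:A i|lborel. ?D t))"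
        using union A by (intro lebesgue_integral_countable_add intA) (auto simp: disjoint_family_on_def)
      then show ?case using union by simp
    qed
  qed
  then have "AE t in lborel. \<forall>n. indicator {- real n..real n} t *\<^sub>R d t = 0"
    by (subst AE_all_countable) blast
  then show ?thesis
  proof eventually_elim
    case (elim t)
    obtain n where "\<bar>t\<bar> \<le> real n" using real_arch_simple by blast
    then show ?case using elim[rule_format, of n] by (auto simp: indicator_def abs_le_iff split: if_splits)
  qed
qed

lemma set_integral_exp_substitution:
  fixes g :: "real \<Rightarrow> complex"
  assumes int: "set_integrable lborel {exp a..exp b} g" and "a \<le> b"
  shows "set_integrable lborel {a..b} (\<lambda>t. of_real (exp t) * g (exp t))"
    and "(LINT r:{exp a..exp b}|lborel. g r) = (LINT t:{a..b}|lborel. of_real (exp t) * g (exp t))"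
proof -
  have ce: "continuous_on {a..b} (exp :: real \<Rightarrow> real)"
    by (rule continuous_at_imp_continuous_on) auto
  have sub: "set_integrable lborel {a..b} (\<lambda>t. f (exp t) * exp t)
      \<and> (LINT r:{exp a..exp b}|lborel. f r) = (LINT t:{a..b}|lborel. f (exp t) * exp t)"
    if "set_integrable lborel {exp a..exp b} f" for f :: "real \<Rightarrow> real"
    using integral_substitution[where g = exp and g' = exp and f = f and a = a and b = b] that \<open>a \<le> b\<close> ce
    by (auto simp: set_lebesgue_integral_def mult_ac intro!: derivative_eq_intros)
  have Re: "set_integrable lborel {exp a..exp b} (\<lambda>r. Re (g r))"
    and Im: "set_integrable lborel {exp a..exp b} (\<lambda>r. Im (g r))"
    using int unfolding set_integrable_def by (auto dest: integrable_Re integrable_Im)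
  have "complex_integrable lborel (\<lambda>t. complex_of_real (indicator {a..b} t *\<^sub>R (Re (g (exp t)) * exp t))
      + \<i> * complex_of_real (indicator {a..b} t *\<^sub>R (Im (g (exp t)) * exp t)))"
    using sub[OF Re] sub[OF Im]
    by (intro Bochner_Integration.integrable_add integrable_mult_right integrable_of_real) (auto simp: set_integrable_def)
  moreover have "complex_of_real (indicator {a..b} t *\<^sub>R (Re (g (exp t)) * exp t))
      + \<i> * complex_of_real (indicator {a..b} t *\<^sub>R (Im (g (exp t)) * exp t))
      = indicator {a..b} t *\<^sub>R (of_real (exp t) * g (exp t))" for t
    by (simp add: complex_eq_iff)
  ultimately show int': "set_integrable lborel {a..b} (\<lambda>t. of_real (exp t) * g (exp t))"
    by (simp add: set_integrable_def)
  show "(LINT r:{exp a..exp b}|lborel. g r) = (LINT t:{a..b}|lborel. of_real (exp t) * g (exp t))"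
  proof (rule complex_eqI)
    show "Re (LINT r:{exp a..exp b}|lborel. g r) = Re (LINT t:{a..b}|lborel. of_real (exp t) * g (exp t))"
      using sub[OF Re] int int' unfolding set_integrable_def set_lebesgue_integral_def
      by (simp add: integral_Re[symmetric] mult_ac)
    show "Im (LINT r:{exp a..exp b}|lborel. g r) = Im (LINT t:{a..b}|lborel. of_real (exp t) * g (exp t))"
      using sub[OF Im] int int' unfolding set_integrable_def set_lebesgue_integral_def
      by (simp add: integral_Im[symmetric] mult_ac)
  qed
qed

lemma AE_ln_norm:
  assumes "AE t in lborel. P t"
  shows "AE x::pt2 in lborel. P (ln (norm x))"
proof -
  have "AE t in radial_measure. P t"
    unfolding radial_measure_def using assms by (subst AE_density) auto
  then have "AE t in distr (lborel :: pt2 measure) borel (\<lambda>x. ln (norm x)). P t"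
    by (simp only: distr_ln_norm)
  then show ?thesis by (rule AE_distrD[rotated]) measurable
qed

text \<open>\<open>dr\<close> selects some radial derivative by choice, so nothing can be computed
  until all candidates are known to agree almost everywhere. They do: the increments of the profile
  fix the integral of the derivative over every interval in the logarithmic variable.\<close>

lemma dr_eq:
  assumes "radial_with u f g"
  shows "AE x in lborel. dr u x = g (norm x)" and "dr u \<in> borel_measurable borel"
proof -
  define g' where "g' = (SOME g. \<exists>f. radial_with u f g)"
  have "\<exists>g f. radial_with u f g" using assms by blast
  from someI_ex[OF this] have "\<exists>f. radial_with u f g'" unfolding g'_def .
  then obtain f' where f': "radial_with u f' g'" by blast
  have [measurable]: "g \<in> borel_measurable borel" "g' \<in> borel_measurable borel"
    using assms f' by (auto simp: radial_with_def radial_deriv_def)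
  have dr: "dr u = (\<lambda>x. g' (norm x))" by (simp add: dr_def g'_def Let_def)
  then show "dr u \<in> borel_measurable borel" by simp
  \<comment> \<open>\<open>u\<close> determines a profile only at nonnegative radii; each such
    radius is the norm of some point.\<close>
  have ff: "f r = f' r" if "r \<ge> 0" for r
  proof -
    obtain x :: pt2 where "norm x = r" using vector_choose_size[OF \<open>r \<ge> 0\<close>] by blast
    then show ?thesis using assms f' by (metis radial_with_def)
  qed
  have d: "set_integrable lborel {a..b} (\<lambda>t. of_real (exp t) * h (exp t))
      \<and> (LINT t:{a..b}|lborel. of_real (exp t) * h (exp t)) = k (exp b) - k (exp a)"
    if "radial_with u k h" "a \<le> b" for k h a b
  proof -
    have "set_integrable lborel {exp a..exp b} h \<and> k (exp b) - k (exp a) = (LINT t:{exp a..exp b}|lborel. h t)"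
      using that by (auto simp: radial_with_def radial_deriv_def)
    then show ?thesis using set_integral_exp_substitution[OF _ \<open>a \<le> b\<close>, of h] by auto
  qed
  have "AE t in lborel. of_real (exp t) * g (exp t) - of_real (exp t) * g' (exp t) = 0"
  proof (rule interval_integrals_zero_imp_AE_zero)
    fix a b :: real assume ab: "a \<le> b"
    note 1 = d[OF assms ab] and 2 = d[OF f' ab]
    show "set_integrable lborel {a..b} (\<lambda>t. of_real (exp t) * g (exp t) - of_real (exp t) * g' (exp t))"
      using 1 2 by (intro set_integral_diff(1)) auto
    show "(LINT t:{a..b}|lborel. of_real (exp t) * g (exp t) - of_real (exp t) * g' (exp t)) = 0"
      using 1 2 by (subst set_integral_diff(2)) (auto simp: ff)
  qed measurable
  then have "AE t in lborel. g (exp t) = g' (exp t)"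
    by eventually_elim simp
  from AE_ln_norm[OF this] AE_lborel_singleton[of "0::pt2"]
  show "AE x in lborel. dr u x = g (norm x)"
    by eventually_elim (simp add: dr)
qed

section \<open>Dictionary between radial functions on the plane and profiles on the line\<close>

locale radial_profile =
  fixes u :: "pt2 \<Rightarrow> complex" and f g :: "real \<Rightarrow> complex"
  assumes radial: "radial_with u f g" and measurable_u: "u \<in> borel_measurable lborel"
begin

definition h :: "real \<Rightarrow> real" where "h t = cmod (f (exp t))"
text \<open>By the chain rule this is the modulus of the derivative of \<open>f (exp t)\<close>. It
  dominates the slope of \<open>h\<close> and may exceed it where the phase of \<open>f\<close>
  varies.\<close>

definition p :: "real \<Rightarrow> real" where "p t = cmod (g (exp t)) * exp t"

lemma measurable_g [measurable]: "g \<in> borel_measurable borel"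
  using radial by (simp add: radial_with_def radial_deriv_def)

lemma measurable_h [measurable]: "h \<in> borel_measurable borel"
proof -
  have [measurable]: "u \<in> borel_measurable borel" using measurable_u by simp
  \<comment> \<open>\<open>f\<close> is not assumed measurable; its values are read off from
    \<open>u\<close> along a ray.\<close>
  have "f (exp t) = u (exp t *\<^sub>R axis 1 1)" for t
    using radial by (simp add: radial_with_def norm_axis_1)
  then have "h = (\<lambda>t. cmod (u (exp t *\<^sub>R axis 1 1)))"
    by (simp add: h_def fun_eq_iff)
  also have "\<dots> \<in> borel_measurable borel" by measurable
  finally show ?thesis .
qed

lemma measurable_p [measurable]: "p \<in> borel_measurable borel"
  unfolding p_def by measurable

lemma cmod_u: "x \<noteq> 0 \<Longrightarrow> cmod (u x) = h (ln (norm x))"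
  using radial by (simp add: radial_with_def h_def)

lemma AE_cmod_u: "AE x in lborel. cmod (u x) = h (ln (norm x))"
  using AE_lborel_singleton[of "0::pt2"] by eventually_elim (rule cmod_u)

text \<open>The phase is dropped here by the reverse triangle inequality, so an inequality is all
  that survives of the fundamental theorem for \<open>f\<close>.\<close>

lemma h_variation:
  assumes "a \<le> b"
  shows "ennreal \<bar>h b - h a\<bar> \<le> (\<integral>\<^sup>+t. ennreal \<bar>p t\<bar> * indicator {a..b} t \<partial>lborel)"
proof -
  have 1: "set_integrable lborel {exp a..exp b} g" "f (exp b) - f (exp a) = (LINT t:{exp a..exp b}|lborel. g t)"
    using radial assms by (auto simp: radial_with_def radial_deriv_def)
  note 2 = set_integral_exp_substitution[OF 1(1) assms]
  have "ennreal \<bar>h b - h a\<bar> \<le> ennreal (cmod (f (exp b) - f (exp a)))"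
    unfolding h_def by (intro ennreal_leI norm_triangle_ineq3)
  also have "\<dots> \<le> (\<integral>\<^sup>+t. ennreal (norm (indicator {a..b} t *\<^sub>R (of_real (exp t) * g (exp t)))) \<partial>lborel)"
    unfolding 1(2) 2(2) unfolding set_lebesgue_integral_def
    by (rule integral_norm_bound_ennreal) (use 2(1) in \<open>simp add: set_integrable_def\<close>)
  also have "\<dots> = (\<integral>\<^sup>+t. ennreal \<bar>p t\<bar> * indicator {a..b} t \<partial>lborel)"
    by (intro nn_integral_cong) (auto simp: p_def norm_mult abs_mult mult_ac split: split_indicator)
  finally show ?thesis .
qed

lemma Xs_nn_integral:
  "(\<integral>\<^sup>+ x. ennreal ((cmod (dr u x))\<^sup>2 + (real m)\<^sup>2 / (norm x)\<^sup>2 * (cmod (u x))\<^sup>2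
                 + (cmod (u x))\<^sup>2 + ln (1 + norm x) * (cmod (u x))\<^sup>2) \<partial>lborel)
   = (\<integral>\<^sup>+ t. ennreal (exp (- (2 * t)) * (p t)\<^sup>2 + (real m)\<^sup>2 * exp (- (2 * t)) * (h t)\<^sup>2
        + (h t)\<^sup>2 + ln (1 + exp t) * (h t)\<^sup>2) \<partial>radial_measure)"
proof -
  let ?T = "\<lambda>t. ennreal (exp (- (2 * t)) * (p t)\<^sup>2 + (real m)\<^sup>2 * exp (- (2 * t)) * (h t)\<^sup>2
        + (h t)\<^sup>2 + ln (1 + exp t) * (h t)\<^sup>2)"
  have "(\<integral>\<^sup>+ x. ennreal ((cmod (dr u x))\<^sup>2 + (real m)\<^sup>2 / (norm x)\<^sup>2 * (cmod (u x))\<^sup>2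
                 + (cmod (u x))\<^sup>2 + ln (1 + norm x) * (cmod (u x))\<^sup>2) \<partial>lborel)
     = (\<integral>\<^sup>+ x. ?T (ln (norm x)) \<partial>(lborel :: pt2 measure))"
  proof (rule nn_integral_cong_AE)
    show "AE x in lborel. ennreal ((cmod (dr u x))\<^sup>2 + (real m)\<^sup>2 / (norm x)\<^sup>2 * (cmod (u x))\<^sup>2
                 + (cmod (u x))\<^sup>2 + ln (1 + norm x) * (cmod (u x))\<^sup>2) = ?T (ln (norm x))"
      using AE_cmod_u dr_eq(1)[OF radial] AE_lborel_singleton[of "0::pt2"]
    proof eventually_elim
      case (elim x)
      then have "exp (- (2 * ln (norm x))) = 1 / (norm x)\<^sup>2"
        by (simp add: exp_minus exp_double field_simps)
      then show ?case using elim by (simp add: p_def power_mult_distrib)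
    qed
  qed
  also have "\<dots> = (\<integral>\<^sup>+ t. ?T t \<partial>(distr (lborel :: pt2 measure) borel (\<lambda>x. ln (norm x))))"
    by (subst nn_integral_distr) auto
  finally show ?thesis by (simp add: distr_ln_norm)
qed

lemma Nrm_eq: "Nrm u = (\<integral>t. (h t)\<^sup>2 \<partial>radial_measure)"
proof -
  have [measurable]: "u \<in> borel_measurable borel" using measurable_u by simp
  have "Nrm u = (\<integral>x. (h (ln (norm x)))\<^sup>2 \<partial>(lborel :: pt2 measure))"
    unfolding Nrm_def
  proof (rule integral_cong_AE)
    show "AE x in lborel. (cmod (u x))\<^sup>2 = (h (ln (norm x)))\<^sup>2"
      using AE_cmod_u by eventually_elim simp
  qed auto
  also have "\<dots> = (\<integral>t. (h t)\<^sup>2 \<partial>(distr (lborel :: pt2 measure) borel (\<lambda>x. ln (norm x))))"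
    by (subst integral_distr) auto
  finally show ?thesis by (simp add: distr_ln_norm)
qed

text \<open>In both terms a factor \<open>exp (- (2 * t))\<close>, that is \<open>1 / r^2\<close>,
  cancels the density of the radial measure: the planar Dirichlet integral is conformally
  invariant.\<close>

lemma kinetic_eq:
  "(\<integral>x. (cmod (dr u x))\<^sup>2 + (real m)\<^sup>2 / (norm x)\<^sup>2 * (cmod (u x))\<^sup>2 \<partial>lborel)
     = (\<integral>t. 2 * pi * ((p t)\<^sup>2 + (real m)\<^sup>2 * (h t)\<^sup>2) \<partial>lborel)"
proof -
  have [measurable]: "u \<in> borel_measurable borel" using measurable_u by simp
  note [measurable] = dr_eq(2)[OF radial]
  let ?T = "\<lambda>t. exp (- (2 * t)) * (p t)\<^sup>2 + (real m)\<^sup>2 * exp (- (2 * t)) * (h t)\<^sup>2"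
  have "(\<integral>x. (cmod (dr u x))\<^sup>2 + (real m)\<^sup>2 / (norm x)\<^sup>2 * (cmod (u x))\<^sup>2 \<partial>lborel)
     = (\<integral>x. ?T (ln (norm x)) \<partial>(lborel :: pt2 measure))"
  proof (rule integral_cong_AE)
    show "AE x in lborel. (cmod (dr u x))\<^sup>2 + (real m)\<^sup>2 / (norm x)\<^sup>2 * (cmod (u x))\<^sup>2 = ?T (ln (norm x))"
      using AE_cmod_u dr_eq(1)[OF radial] AE_lborel_singleton[of "0::pt2"]
    proof eventually_elim
      case (elim x)
      then have "exp (- (2 * ln (norm x))) = 1 / (norm x)\<^sup>2"
        by (simp add: exp_minus exp_double field_simps)
      then show ?case using elim by (simp add: p_def power_mult_distrib)
    qed
  qed auto
  also have "\<dots> = (\<integral>t. ?T t \<partial>(distr (lborel :: pt2 measure) borel (\<lambda>x. ln (norm x))))"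
    by (subst integral_distr) auto
  also have "\<dots> = (\<integral>t. (2 * pi * exp (2 * t)) *\<^sub>R ?T t \<partial>lborel)"
    unfolding distr_ln_norm radial_measure_def by (subst integral_density) auto
  also have "\<dots> = (\<integral>t. 2 * pi * ((p t)\<^sup>2 + (real m)\<^sup>2 * (h t)\<^sup>2) \<partial>lborel)"
  proof (intro Bochner_Integration.integral_cong refl)
    fix t
    have "exp (2 * t) * exp (- (2 * t)) = (1::real)" by (simp add: exp_add[symmetric])
    moreover have "(2 * pi * exp (2 * t)) *\<^sub>R ?T t
        = 2 * pi * (exp (2 * t) * exp (- (2 * t))) * ((p t)\<^sup>2 + (real m)\<^sup>2 * (h t)\<^sup>2)"
      by (simp only: real_scaleR_def) (simp only: algebra_simps)
    ultimately show "(2 * pi * exp (2 * t)) *\<^sub>R ?T t = 2 * pi * ((p t)\<^sup>2 + (real m)\<^sup>2 * (h t)\<^sup>2)"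
      by (simp only: mult_1_right)
  qed
  finally show ?thesis .
qed

text \<open>Newton's theorem reduces the kernel to a function of the two radii, after which the
  product of radial measures is the image of planar measure. Off a null set \<open>ln\<close>
  commutes with \<open>max\<close>.\<close>

lemma potential_eq:
  assumes int0: "integrable radial_measure (\<lambda>t. (h t)\<^sup>2)" and int1: "integrable radial_measure (\<lambda>t. t * (h t)\<^sup>2)"
  shows "(\<integral>z. (case z of (x, y) \<Rightarrow> ln (dist x y) * (cmod (u x))\<^sup>2 * (cmod (u y))\<^sup>2) \<partial>(lborel \<Otimes>\<^sub>M lborel))
       = (\<integral>z. (case z of (s, t) \<Rightarrow> max s t * (h s)\<^sup>2 * (h t)\<^sup>2) \<partial>(radial_measure \<Otimes>\<^sub>M radial_measure))"
proof -
  have [measurable]: "u \<in> borel_measurable borel" using measurable_u by simp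
  let ?M = "lborel \<Otimes>\<^sub>M lborel :: (pt2 \<times> pt2) measure"
  let ?\<rho> = "\<lambda>r. (h (ln r))\<^sup>2"
  let ?L = "\<lambda>(x::pt2, y::pt2). (ln (norm x), ln (norm y))"
  have i0: "integrable lborel (\<lambda>x::pt2. ?\<rho> (norm x))"
    using int0 unfolding distr_ln_norm[symmetric] by (subst (asm) integrable_distr_eq) auto
  have i1: "integrable lborel (\<lambda>x::pt2. ln (norm x) * ?\<rho> (norm x))"
    using int1 unfolding distr_ln_norm[symmetric] by (subst (asm) integrable_distr_eq) auto
  have \<rho>_meas: "?\<rho> \<in> borel_measurable borel" by measurable
  note N = newton_log_potential[OF \<rho>_meas _ i0 i1, simplified]
  have ae: "AE z in ?M. (case z of (x, y) \<Rightarrow> ln (max (norm x) (norm y)) * ?\<rho> (norm x) * ?\<rho> (norm y))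
     = (case ?L z of (s, t) \<Rightarrow> max s t * (h s)\<^sup>2 * (h t)\<^sup>2)"
    using AE_norm_neq by eventually_elim (auto simp: max_def)
  have Lm[measurable]: "?L \<in> measurable ?M (borel \<Otimes>\<^sub>M borel)" by measurable
  have "(\<integral>z. (case z of (x, y) \<Rightarrow> ln (dist x y) * (cmod (u x))\<^sup>2 * (cmod (u y))\<^sup>2) \<partial>?M)
     = (\<integral>z. (case z of (x, y) \<Rightarrow> ln (dist x y) * ?\<rho> (norm x) * ?\<rho> (norm y)) \<partial>?M)"
  proof (rule integral_cong_AE)
    show "AE z in ?M. (case z of (x, y) \<Rightarrow> ln (dist x y) * (cmod (u x))\<^sup>2 * (cmod (u y))\<^sup>2)
       = (case z of (x, y) \<Rightarrow> ln (dist x y) * ?\<rho> (norm x) * ?\<rho> (norm y))"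
      using AE_norm_neq by eventually_elim (auto simp: cmod_u)
  qed auto
  also have "\<dots> = (\<integral>z. (case z of (x, y) \<Rightarrow> ln (max (norm x) (norm y)) * ?\<rho> (norm x) * ?\<rho> (norm y)) \<partial>?M)"
    by (rule N)
  also have "\<dots> = (\<integral>z. (case ?L z of (s, t) \<Rightarrow> max s t * (h s)\<^sup>2 * (h t)\<^sup>2) \<partial>?M)"
    by (rule integral_cong_AE[OF _ _ ae]) auto
  also have "\<dots> = (\<integral>z. (case z of (s, t) \<Rightarrow> max s t * (h s)\<^sup>2 * (h t)\<^sup>2) \<partial>(radial_measure \<Otimes>\<^sub>M radial_measure))"
    unfolding radial_pair_measure by (subst integral_distr[OF Lm]) auto
  finally show "(\<integral>z. (case z of (x, y) \<Rightarrow> ln (dist x y) * (cmod (u x))\<^sup>2 * (cmod (u y))\<^sup>2) \<partial>(lborel \<Otimes>\<^sub>M lborel))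
       = (\<integral>z. (case z of (s, t) \<Rightarrow> max s t * (h s)\<^sup>2 * (h t)\<^sup>2) \<partial>(radial_measure \<Otimes>\<^sub>M radial_measure))" .
qed

end

section \<open>Admissible profiles and their energy\<close>

lemma integrable_radial_iff:
  fixes F :: "real \<Rightarrow> real"
  assumes [measurable]: "F \<in> borel_measurable borel"
  shows "integrable radial_measure (\<lambda>t. exp (- (2 * t)) * F t) \<longleftrightarrow> integrable lborel F"
    and "(\<integral>t. exp (- (2 * t)) * F t \<partial>radial_measure) = 2 * pi * (\<integral>t. F t \<partial>lborel)"
proof -
  have eq: "(\<lambda>t. (2 * pi * exp (2 * t)) *\<^sub>R (exp (- (2 * t)) * F t)) = (\<lambda>t. (2 * pi) * F t)"
  proof
    fix t :: real
    have "exp (2 * t) * exp (- (2 * t)) = (1::real)" by (simp add: exp_add[symmetric])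
    moreover have "(2 * pi * exp (2 * t)) *\<^sub>R (exp (- (2 * t)) * F t) = (2 * pi) * (exp (2 * t) * exp (- (2 * t))) * F t"
      by (simp only: real_scaleR_def mult_ac)
    ultimately show "(2 * pi * exp (2 * t)) *\<^sub>R (exp (- (2 * t)) * F t) = (2 * pi) * F t" by (simp only: mult_1_right)
  qed
  show "integrable radial_measure (\<lambda>t. exp (- (2 * t)) * F t) \<longleftrightarrow> integrable lborel F"
    unfolding radial_measure_def by (subst integrable_density) (auto simp: eq[unfolded real_scaleR_def])
  show "(\<integral>t. exp (- (2 * t)) * F t \<partial>radial_measure) = 2 * pi * (\<integral>t. F t \<partial>lborel)"
    unfolding radial_measure_def by (subst integral_density) (auto simp: eq[unfolded real_scaleR_def])
qed

lemma Xs_iff: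
  "u \<in> Xs m \<longleftrightarrow> (\<exists>f g. radial_with u f g) \<and> u \<in> borel_measurable lborel \<and>
     (\<integral>\<^sup>+ x. ennreal ((cmod (dr u x))\<^sup>2 + (real m)\<^sup>2 / (norm x)\<^sup>2 * (cmod (u x))\<^sup>2
                 + (cmod (u x))\<^sup>2 + ln (1 + norm x) * (cmod (u x))\<^sup>2) \<partial>lborel) < \<infinity>"
  by (simp only: Xs_def mem_Collect_eq)

text \<open>These bounds exchange the weight \<open>ln (1 + r)\<close> for
  \<open>\<bar>t\<bar>\<close>. For negative \<open>t\<close> the former is small while
  \<open>\<bar>t\<bar>\<close> is not, and the term \<open>exp (- (2 * t))\<close>, which the
  centrifugal energy provides, makes up for it.\<close>

lemma ln_one_plus_exp_bounds:
  fixes t :: real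
  shows "\<bar>t\<bar> \<le> ln (1 + exp t) + exp (- (2 * t))" and "ln (1 + exp t) \<le> ln 2 + \<bar>t\<bar>" and "ln (1 + exp t) \<ge> 0"
proof -
  show pos: "ln (1 + exp t) \<ge> 0" by simp
  show "\<bar>t\<bar> \<le> ln (1 + exp t) + exp (- (2 * t))"
  proof (cases "t \<ge> 0")
    case True
    have "t \<le> ln (1 + exp t)" using ln_mono[of "exp t" "1 + exp t"] by simp
    then show ?thesis using True by (simp add: add_increasing2)
  next
    case False
    then have "- t \<le> exp (- (2 * t))" using exp_ge_add_one_self[of "- (2 * t)"] by linarith
    then show ?thesis using False pos by linarith
  qed
  have "1 + exp t \<le> 2 * exp \<bar>t\<bar>" 
  proof -
    have "1 \<le> exp \<bar>t\<bar>" "exp t \<le> exp \<bar>t\<bar>" by simp_all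
    then show ?thesis by linarith
  qed
  then have "ln (1 + exp t) \<le> ln (2 * exp \<bar>t\<bar>)" by (intro ln_mono) (auto simp: add_pos_pos)
  then show "ln (1 + exp t) \<le> ln 2 + \<bar>t\<bar>" by (simp add: ln_mult_pos)
qed

text \<open>\<open>p\<close> plays the role of an upper gradient of \<open>h\<close>, not of its
  derivative. Moduli of complex profiles satisfy this at once, and it is enough for Hoelder
  continuity and for the energy bound on dyadic quotients.\<close>

definition energy_profile :: "(real \<Rightarrow> real) \<Rightarrow> (real \<Rightarrow> real) \<Rightarrow> bool" where
  "energy_profile h p \<longleftrightarrow> h \<in> borel_measurable borel \<and> p \<in> borel_measurable borel \<and> (\<forall>t. h t \<ge> 0) \<and>
     (\<forall>a b. a \<le> b \<longrightarrow> ennreal \<bar>h b - h a\<bar> \<le> (\<integral>\<^sup>+t. ennreal \<bar>p t\<bar> * indicator {a..b} t \<partial>lborel)) \<and>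
     integrable lborel (\<lambda>t. (p t)\<^sup>2) \<and> integrable lborel (\<lambda>t. (h t)\<^sup>2) \<and>
     integrable radial_measure (\<lambda>t. (h t)\<^sup>2) \<and> integrable radial_measure (\<lambda>t. \<bar>t\<bar> * (h t)\<^sup>2)"

definition interaction :: "(real \<Rightarrow> real) \<Rightarrow> real" where
  "interaction h = (\<integral>z. (case z of (s, t) \<Rightarrow> max s t * (h s)\<^sup>2 * (h t)\<^sup>2) \<partial>(radial_measure \<Otimes>\<^sub>M radial_measure))"

definition profile_energy :: "real \<Rightarrow> nat \<Rightarrow> (real \<Rightarrow> real) \<Rightarrow> (real \<Rightarrow> real) \<Rightarrow> real" where
  "profile_energy \<gamma> m h p = 2 * pi * (\<integral>t. (p t)\<^sup>2 \<partial>lborel) + 2 * pi * (real m)\<^sup>2 * (\<integral>t. (h t)\<^sup>2 \<partial>lborel)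
     + \<gamma> / (4 * pi) * interaction h"

lemma integrable_weight_sign:
  fixes F :: "real \<Rightarrow> real"
  assumes [measurable]: "F \<in> borel_measurable borel" and "integrable radial_measure (\<lambda>t. \<bar>t\<bar> * (F t)\<^sup>2)"
  shows "integrable radial_measure (\<lambda>t. t * (F t)\<^sup>2)"
  by (rule Bochner_Integration.integrable_bound[OF assms(2)]) (auto simp: abs_mult)

context radial_profile
begin

lemma Em_eq:
  assumes "energy_profile h p"
  shows "Em \<gamma> m u = profile_energy \<gamma> m h p"
proof -
  have "integrable radial_measure (\<lambda>t. t * (h t)\<^sup>2)"
    using assms by (intro integrable_weight_sign) (auto simp: energy_profile_def)
  with assms show ?thesis
    unfolding Em_def kinetic_eq profile_energy_def interaction_def
    by (subst potential_eq) (auto simp: energy_profile_def distrib_left)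
qed

text \<open>Positivity of \<open>m\<close> is essential: with \<open>(real m)^2 \<ge> 1\<close> the
  centrifugal term dominates \<open>exp (- (2 * t)) * h^2\<close>, which gives square integrability
  of \<open>h\<close> in \<open>t\<close> and controls the weight \<open>\<bar>t\<bar>\<close> near
  the origin.\<close>

lemma energy_profileI:
  assumes "m > 0" and fin: "(\<integral>\<^sup>+ t. ennreal (exp (- (2 * t)) * (p t)\<^sup>2 + (real m)\<^sup>2 * exp (- (2 * t)) * (h t)\<^sup>2
        + (h t)\<^sup>2 + ln (1 + exp t) * (h t)\<^sup>2) \<partial>radial_measure) < \<infinity>"
  shows "energy_profile h p"
proof -
  let ?T = "\<lambda>t. exp (- (2 * t)) * (p t)\<^sup>2 + (real m)\<^sup>2 * exp (- (2 * t)) * (h t)\<^sup>2 + (h t)\<^sup>2 + ln (1 + exp t) * (h t)\<^sup>2"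
  have m1: "(real m)\<^sup>2 \<ge> 1" using \<open>m > 0\<close> by (simp add: one_le_power)
  have T: "0 \<le> exp (- (2 * t)) * (p t)\<^sup>2" "0 \<le> exp (- (2 * t)) * (h t)\<^sup>2"
    "exp (- (2 * t)) * (h t)\<^sup>2 \<le> (real m)\<^sup>2 * exp (- (2 * t)) * (h t)\<^sup>2" "0 \<le> (h t)\<^sup>2" "0 \<le> ln (1 + exp t) * (h t)\<^sup>2" for t
    using mult_right_mono[OF m1, of "exp (- (2 * t)) * (h t)\<^sup>2"] ln_one_plus_exp_bounds(3)[of t] by (simp_all add: mult.assoc)
  have T0: "?T t \<ge> 0" for t using T[of t] by linarith
  have intT: "integrable radial_measure ?T"
  proof (rule integrableI_bounded)
    show "(\<integral>\<^sup>+ t. ennreal (norm (?T t)) \<partial>radial_measure) < \<infinity>"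
      using fin T0 by simp
  qed measurable
  have bnd: "integrable radial_measure F" if [measurable]: "F \<in> borel_measurable borel" and "\<And>t. 0 \<le> F t \<and> F t \<le> ?T t" for F
  proof (rule Bochner_Integration.integrable_bound[OF intT])
    show "AE t in radial_measure. norm (F t) \<le> norm (?T t)"
      using that(2) by (intro AE_I2) (smt (verit) real_norm_def)
  qed measurable
  have "integrable radial_measure (\<lambda>t. exp (- (2 * t)) * (p t)\<^sup>2)"
  proof (rule bnd)
    show "0 \<le> exp (- (2 * t)) * (p t)\<^sup>2 \<and> exp (- (2 * t)) * (p t)\<^sup>2 \<le> ?T t" for t using T[of t] by linarith
  qed measurable
  then have 1: "integrable lborel (\<lambda>t. (p t)\<^sup>2)" by (subst (asm) integrable_radial_iff) auto
  have "integrable radial_measure (\<lambda>t. exp (- (2 * t)) * (h t)\<^sup>2)"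
  proof (rule bnd)
    show "0 \<le> exp (- (2 * t)) * (h t)\<^sup>2 \<and> exp (- (2 * t)) * (h t)\<^sup>2 \<le> ?T t" for t using T[of t] by linarith
  qed measurable
  then have 2: "integrable lborel (\<lambda>t. (h t)\<^sup>2)" by (subst (asm) integrable_radial_iff) auto
  have 3: "integrable radial_measure (\<lambda>t. (h t)\<^sup>2)"
  proof (rule bnd)
    show "0 \<le> (h t)\<^sup>2 \<and> (h t)\<^sup>2 \<le> ?T t" for t using T[of t] by linarith
  qed measurable
  have 4: "integrable radial_measure (\<lambda>t. \<bar>t\<bar> * (h t)\<^sup>2)"
  proof (rule bnd)
    fix t
    have "\<bar>t\<bar> * (h t)\<^sup>2 \<le> (ln (1 + exp t) + exp (- (2 * t))) * (h t)\<^sup>2"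
      by (intro mult_right_mono ln_one_plus_exp_bounds) auto
    then show "0 \<le> \<bar>t\<bar> * (h t)\<^sup>2 \<and> \<bar>t\<bar> * (h t)\<^sup>2 \<le> ?T t"
      using T[of t] unfolding distrib_right by (intro conjI, simp, linarith)
  qed measurable
  show ?thesis
    unfolding energy_profile_def using 1 2 3 4 h_variation by (auto simp: h_def)
qed

lemma Xs_I:
  assumes "energy_profile h p"
  shows "u \<in> Xs m"
proof -
  note e = assms[unfolded energy_profile_def]
  let ?T = "\<lambda>t. exp (- (2 * t)) * (p t)\<^sup>2 + (real m)\<^sup>2 * (exp (- (2 * t)) * (h t)\<^sup>2) + (h t)\<^sup>2 + ln (1 + exp t) * (h t)\<^sup>2"
  have "integrable radial_measure (\<lambda>t. ln 2 * (h t)\<^sup>2 + \<bar>t\<bar> * (h t)\<^sup>2)"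
    using e by (intro Bochner_Integration.integrable_add integrable_mult_right) auto
  then have 1: "integrable radial_measure (\<lambda>t. ln (1 + exp t) * (h t)\<^sup>2)"
  proof (rule Bochner_Integration.integrable_bound)
    have "ln (1 + exp t) * (h t)\<^sup>2 \<le> (ln 2 + \<bar>t\<bar>) * (h t)\<^sup>2" for t
      by (intro mult_right_mono ln_one_plus_exp_bounds) auto
    then show "AE t in radial_measure. norm (ln (1 + exp t) * (h t)\<^sup>2) \<le> norm (ln 2 * (h t)\<^sup>2 + \<bar>t\<bar> * (h t)\<^sup>2)"
      using ln_one_plus_exp_bounds(3) by (intro AE_I2) (simp add: abs_mult distrib_right)
  qed measurable
  have 2: "integrable radial_measure (\<lambda>t. exp (- (2 * t)) * (p t)\<^sup>2)" "integrable radial_measure (\<lambda>t. exp (- (2 * t)) * (h t)\<^sup>2)"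
    using e by (auto simp: integrable_radial_iff)
  have intT: "integrable radial_measure ?T"
    using e 1 2 by (intro Bochner_Integration.integrable_add integrable_mult_right) auto
  have "?T t \<ge> 0" for t using ln_one_plus_exp_bounds(3)[of t] by (intro add_nonneg_nonneg mult_nonneg_nonneg) auto
  then have "(\<integral>\<^sup>+ t. ennreal (?T t) \<partial>radial_measure) = ennreal (\<integral>t. ?T t \<partial>radial_measure)"
    by (intro nn_integral_eq_integral[OF intT]) auto
  also have "\<dots> < \<infinity>" by simp
  finally show ?thesis
    using radial measurable_u unfolding Xs_iff Xs_nn_integral mult.assoc by blast
qed

end

lemma Xs_energy_profile:
  assumes "u \<in> Xs m" "m > 0"
  obtains h p where "energy_profile h p" "Nrm u = (\<integral>t. (h t)\<^sup>2 \<partial>radial_measure)"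
    "\<And>\<gamma>. Em \<gamma> m u = profile_energy \<gamma> m h p"
proof -
  obtain f g where "radial_with u f g" "u \<in> borel_measurable lborel"
    using assms by (auto simp: Xs_iff)
  then interpret radial_profile u f g by unfold_locales
  have "energy_profile h p"
    using assms unfolding Xs_iff Xs_nn_integral by (intro energy_profileI[of m]) blast+
  then show ?thesis using that Nrm_eq Em_eq by blast
qed

text \<open>Membership in \<open>Xs\<close> demands an actual radial derivative, hence
  \<open>int\<close> and \<open>ftc\<close> on top of admissibility. The derivative is
  \<open>g (ln r) * inverse r\<close> by the chain rule, and the factor in \<open>p\<close> undoes
  \<open>inverse r\<close>, so that \<open>R.p\<close> is the modulus of \<open>g\<close>;
  nonnegativity gives \<open>R.h = h\<close>.\<close>

lemma energy_profile_realize: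
  fixes h g :: "real \<Rightarrow> real"
  assumes prof: "energy_profile h g"
    and int: "\<And>a b. a \<le> b \<Longrightarrow> set_integrable lborel {a..b} g"
    and ftc: "\<And>a b. a \<le> b \<Longrightarrow> h b - h a = (LINT t:{a..b}|lborel. g t)"
  defines "u \<equiv> (\<lambda>x::pt2. complex_of_real (h (ln (norm x))))"
  shows "u \<in> Xs m" "Nrm u = (\<integral>t. (h t)\<^sup>2 \<partial>radial_measure)" "Em \<gamma> m u = profile_energy \<gamma> m h g"
proof -
  define f where "f r = complex_of_real (h (ln r))" for r
  define g' where "g' r = complex_of_real (g (ln r) * inverse r)" for r
  have [measurable]: "h \<in> borel_measurable borel" "g \<in> borel_measurable borel"
    using prof by (auto simp: energy_profile_def)
  have "radial_deriv f g'"
    unfolding radial_deriv_def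
  proof (intro conjI allI impI)
    show "g' \<in> borel_measurable borel" unfolding g'_def by measurable
    fix a b :: real assume ab: "0 < a" "a \<le> b"
    then have lab: "ln a \<le> ln b" by (simp add: ln_mono)
    have c: "continuous_on {a..b} inverse" using ab by (intro continuous_intros) auto
    have d: "(ln has_real_derivative inverse x) (at x)" if "x \<in> {a..b}" for x
      using that ab by (auto intro!: derivative_eq_intros simp: field_simps)
    note S = integral_substitution[where g = ln and g' = inverse and f = g and a = a and b = b, OF int[OF lab] d c _ ab(2)]
    have S1: "set_integrable lborel {a..b} (\<lambda>r. g (ln r) * inverse r)" using S(1) ab by simp
    have S2: "(LINT t:{ln a..ln b}|lborel. g t) = (LINT r:{a..b}|lborel. g (ln r) * inverse r)"
      using S(2) ab by (simp add: set_lebesgue_integral_def mult_ac)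
    have "(\<lambda>r. indicator {a..b} r *\<^sub>R g' r) = (\<lambda>r. complex_of_real (indicator {a..b} r *\<^sub>R (g (ln r) * inverse r)))"
      by (auto simp: g'_def fun_eq_iff scaleR_conv_of_real)
    then show "set_integrable lborel {a..b} g'" "f b - f a = (LINT t:{a..b}|lborel. g' t)"
      using S1 S2 ftc[OF lab] unfolding set_integrable_def set_lebesgue_integral_def
      by (simp_all only: integral_complex_of_real integrable_of_real f_def of_real_diff[symmetric])
  qed
  then have "radial_with u f g'" by (simp add: radial_with_def u_def f_def)
  moreover have "u \<in> borel_measurable lborel" unfolding u_def by measurable
  ultimately interpret R: radial_profile u f g' by unfold_locales
  have hh: "R.h = h"
    using prof by (auto simp: R.h_def f_def energy_profile_def)
  have pp: "R.p = (\<lambda>t. \<bar>g t\<bar>)"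
    by (rule ext) (simp add: R.p_def g'_def norm_mult norm_inverse)
  have prof': "energy_profile R.h R.p"
    using prof unfolding hh pp by (simp add: energy_profile_def)
  show "u \<in> Xs m" by (rule R.Xs_I[OF prof'])
  show "Nrm u = (\<integral>t. (h t)\<^sup>2 \<partial>radial_measure)" using R.Nrm_eq by (simp add: hh)
  show "Em \<gamma> m u = profile_energy \<gamma> m h g" using R.Em_eq[OF prof'] by (simp add: hh pp profile_energy_def)
qed

section \<open>Coercivity\<close>

lemma nn_integral_exp_atMost:
  fixes c T :: real
  assumes "c > 0"
  shows "(\<integral>\<^sup>+s. ennreal (exp (c * s)) * indicator {..T} s \<partial>lborel) = ennreal (exp (c * T) / c)"
proof -
  have "(\<integral>\<^sup>+s. ennreal (exp (c * s)) * indicator {..T} s \<partial>lborel)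
     = (\<integral>\<^sup>+s. ennreal (exp (- (c * s))) * indicator {- T..} s \<partial>lborel)"
    by (subst nn_integral_real_affine[where c = "- 1" and t = 0])
      (auto intro!: nn_integral_cong split: split_indicator)
  also have "\<dots> = ennreal (0 - (- exp (- (c * (- T))) / c))"
  proof (rule nn_integral_FTC_atLeast)
    show "((\<lambda>s. - exp (- (c * s)) / c) \<longlongrightarrow> 0) at_top"
    proof -
      have "filterlim (\<lambda>s. c * s) at_top at_top"
        using assms by (intro filterlim_tendsto_pos_mult_at_top[OF tendsto_const]) (auto simp: filterlim_ident)
      then have "((\<lambda>s. exp (- (c * s))) \<longlongrightarrow> 0) at_top"
        by (intro filterlim_compose[OF exp_at_bot]) (simp add: filterlim_uminus_at_bot)
      then have "((\<lambda>s. - exp (- (c * s)) / c) \<longlongrightarrow> - 0 / c) at_top"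
        using assms by (intro tendsto_intros) auto
      then show ?thesis by simp
    qed
  qed (use assms in \<open>auto intro!: derivative_eq_intros\<close>)
  finally show ?thesis by simp
qed

text \<open>Up to the origin \<open>{..T}\<close> stands for the disc of radius
  \<open>exp T\<close>, which has finite area.\<close>

lemma integrable_indicator_atMost: "integrable radial_measure (\<lambda>t. indicator {..T} t :: real)"
proof -
  have "emeasure radial_measure {..T} = (\<integral>\<^sup>+t. ennreal (2 * pi) * (ennreal (exp (2 * t)) * indicator {..T} t) \<partial>lborel)"
    unfolding radial_measure_def
    by (subst emeasure_density) (auto simp: ennreal_mult mult.assoc intro!: nn_integral_cong)
  also have "\<dots> = ennreal (2 * pi) * ennreal (exp (2 * T) / 2)"
    by (subst nn_integral_cmult) (auto simp: nn_integral_exp_atMost)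
  also have "\<dots> < \<infinity>" by (simp add: ennreal_mult_less_top)
  finally show ?thesis by (intro integrable_real_indicator) auto
qed

text \<open>Integrability of \<open>\<bar>ln r\<bar>\<close> over the unit disc: for
  \<open>t \<le> 0\<close> the bound \<open>\<bar>t\<bar> \<le> exp (- t)\<close> costs only half of
  the decay \<open>exp (2 * t)\<close>.\<close>

lemma integrable_abs_negative: "integrable radial_measure (\<lambda>t. \<bar>t\<bar> * indicator {..0} t :: real)"
proof (rule integrableI_bounded)
  have "(\<integral>\<^sup>+t. ennreal (norm (\<bar>t\<bar> * indicator {..0} t :: real)) \<partial>radial_measure)
     = (\<integral>\<^sup>+t. ennreal (2 * pi * exp (2 * t)) * ennreal (norm (\<bar>t\<bar> * indicator {..0} t :: real)) \<partial>lborel)"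
    unfolding radial_measure_def by (subst nn_integral_density) auto
  also have "\<dots> \<le> (\<integral>\<^sup>+t. ennreal (2 * pi) * (ennreal (exp (1 * t)) * indicator {..0} t) \<partial>lborel)"
  proof (intro nn_integral_mono)
    fix t :: real
    have exp_le: "exp (2 * t) * \<bar>t\<bar> \<le> exp t" if "t \<le> 0"
    proof -
      have "\<bar>t\<bar> \<le> exp (- t)" using that exp_ge_add_one_self[of "- t"] by linarith
      then have "exp (2 * t) * \<bar>t\<bar> \<le> exp (2 * t) * exp (- t)" by (intro mult_left_mono) auto
      also have "\<dots> = exp t" by (simp add: exp_add[symmetric])
      finally show ?thesis .
    qed
    have le: "2 * pi * exp (2 * t) * \<bar>t\<bar> \<le> 2 * pi * exp t" if "t \<le> 0"
      using mult_left_mono[OF exp_le[OF that], of "2 * pi"] by (simp only: mult.assoc) simp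
    show "ennreal (2 * pi * exp (2 * t)) * ennreal (norm (\<bar>t\<bar> * indicator {..0} t :: real))
       \<le> ennreal (2 * pi) * (ennreal (exp (1 * t)) * indicator {..0} t)"
    proof (cases "t \<le> 0")
      case True
      have "ennreal (2 * pi * exp (2 * t)) * ennreal (norm (\<bar>t\<bar> * indicator {..0} t :: real))
          = ennreal (2 * pi * exp (2 * t) * \<bar>t\<bar>)"
        using True by (subst ennreal_mult) auto
      also have "\<dots> \<le> ennreal (2 * pi * exp t)" by (intro ennreal_leI le True)
      also have "\<dots> = ennreal (2 * pi) * (ennreal (exp (1 * t)) * indicator {..0} t)"
        using True by (simp add: ennreal_mult)
      finally show ?thesis .
    qed simp
  qed
  also have "\<dots> = ennreal (2 * pi) * ennreal (exp (1 * 0) / 1)"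
    by (subst nn_integral_cmult, measurable, subst nn_integral_exp_atMost) auto
  also have "\<dots> < \<infinity>" by (simp add: ennreal_mult_less_top)
  finally show "(\<integral>\<^sup>+t. ennreal (norm (\<bar>t\<bar> * indicator {..0} t :: real)) \<partial>radial_measure) < \<infinity>" .
qed measurable

lemma energy_profile_holder:
  assumes "energy_profile h p"
  shows "(h b - h a)\<^sup>2 \<le> \<bar>b - a\<bar> * (\<integral>t. (p t)\<^sup>2 \<partial>lborel)"
proof -
  have *: "(h b - h a)\<^sup>2 \<le> (b - a) * (\<integral>t. (p t)\<^sup>2 \<partial>lborel)" if "a \<le> b" for a b
  proof -
    have [measurable]: "p \<in> borel_measurable borel" and int: "integrable lborel (\<lambda>t. (p t)\<^sup>2)"
      using assms by (auto simp: energy_profile_def)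
    have "ennreal ((h b - h a)\<^sup>2) = (ennreal \<bar>h b - h a\<bar>)\<^sup>2" by (simp add: ennreal_power)
    also have "\<dots> \<le> (\<integral>\<^sup>+t. ennreal \<bar>p t\<bar> * indicator {a..b} t \<partial>lborel)\<^sup>2"
      using assms that by (intro power_mono) (auto simp: energy_profile_def)
    also have "\<dots> \<le> ennreal (b - a) * (\<integral>\<^sup>+t. ennreal ((p t)\<^sup>2) * indicator {a..b} t \<partial>lborel)"
      by (intro Cauchy_Schwarz_interval that) measurable
    also have "\<dots> \<le> ennreal (b - a) * (\<integral>\<^sup>+t. ennreal ((p t)\<^sup>2) \<partial>lborel)"
      by (intro mult_left_mono nn_integral_mono) (auto split: split_indicator)
    also have "\<dots> = ennreal ((b - a) * (\<integral>t. (p t)\<^sup>2 \<partial>lborel))"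
      using that int by (subst nn_integral_eq_integral) (auto simp: ennreal_mult integral_nonneg_AE)
    finally show ?thesis
      using that by (subst (asm) ennreal_le_iff) (auto intro!: mult_nonneg_nonneg integral_nonneg_AE)
  qed
  show ?thesis using *[of a b] *[of b a] by (cases "a \<le> b") (auto simp: power2_commute)
qed

text \<open>The embedding of H^1 of the line into bounded functions: \<open>h t\<close> is compared
  with \<open>h s\<close> by the Hoelder estimate and the result is averaged over \<open>s\<close>
  in an interval of length 1.\<close>

lemma energy_profile_bounded:
  assumes prof: "energy_profile h p"
  shows "(h t)\<^sup>2 \<le> 2 * (\<integral>t. (h t)\<^sup>2 \<partial>lborel) + 2 * (\<integral>t. (p t)\<^sup>2 \<partial>lborel)"
proof -
  let ?P = "\<integral>t. (p t)\<^sup>2 \<partial>lborel"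
  have int: "integrable lborel (\<lambda>t. (h t)\<^sup>2)" using prof by (simp add: energy_profile_def)
  have P0: "?P \<ge> 0" by (simp add: integral_nonneg_AE)
  have pt: "(h t)\<^sup>2 \<le> 2 * (h s)\<^sup>2 + 2 * ?P" if "s \<in> {t..t + 1}" for s
  proof -
    have "(h s - h t)\<^sup>2 \<le> \<bar>s - t\<bar> * ?P" by (rule energy_profile_holder[OF prof])
    also have "\<dots> \<le> 1 * ?P" using that P0 by (intro mult_right_mono) auto
    finally have "(h s - h t)\<^sup>2 \<le> ?P" by simp
    moreover have "(h t)\<^sup>2 \<le> 2 * (h s)\<^sup>2 + 2 * (h s - h t)\<^sup>2"
      using zero_le_power2[of "2 * h s - h t"] by (simp add: power2_eq_square algebra_simps)
    ultimately show ?thesis by linarith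
  qed
  have si: "set_integrable lborel {t..t + 1} (\<lambda>s. (h s)\<^sup>2)"
    unfolding set_integrable_def by (rule integrable_mult_indicator[OF _ int]) simp
  have c: "set_integrable lborel {t..t + 1} (\<lambda>s. k)" for k :: real
    by (intro borel_integrable_atLeastAtMost' continuous_intros)
  have "(h t)\<^sup>2 = (LINT s:{t..t + 1}|lborel. (h t)\<^sup>2)"
    by (simp add: set_lebesgue_integral_def)
  also have "\<dots> \<le> (LINT s:{t..t + 1}|lborel. 2 * (h s)\<^sup>2 + 2 * ?P)"
    using pt si c by (intro set_integral_mono set_integral_add(1) set_integrable_mult_right) auto
  also have "\<dots> = 2 * (LINT s:{t..t + 1}|lborel. (h s)\<^sup>2) + (LINT s:{t..t + 1}|lborel. 2 * ?P)"
    using si c by (subst set_integral_add(2)) (auto intro: set_integrable_mult_right)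
  also have "(LINT s:{t..t + 1}|lborel. 2 * ?P) = 2 * ?P"
    by (simp add: set_lebesgue_integral_def)
  also have "(LINT s:{t..t + 1}|lborel. (h s)\<^sup>2) \<le> (\<integral>s. (h s)\<^sup>2 \<partial>lborel)"
    unfolding set_lebesgue_integral_def using si int
    by (intro integral_mono) (auto simp: set_integrable_def split: split_indicator)
  finally show ?thesis by simp
qed

lemma (in pair_sigma_finite) integral_mult_pair:
  fixes f :: "'a \<Rightarrow> real" and g :: "'b \<Rightarrow> real"
  assumes "integrable M1 f" "integrable M2 g"
  shows "(\<integral>z. (case z of (x, y) \<Rightarrow> f x * g y) \<partial>(M1 \<Otimes>\<^sub>M M2)) = (\<integral>x. f x \<partial>M1) * (\<integral>y. g y \<partial>M2)"
  using integral_fst'[OF integrable_mult_pair[OF assms]] by simp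

lemma integrable_interaction:
  assumes "energy_profile h p"
  shows "integrable (radial_measure \<Otimes>\<^sub>M radial_measure) (\<lambda>(s, t). max s t * (h s)\<^sup>2 * (h t)\<^sup>2)"
proof -
  note e = assms[unfolded energy_profile_def]
  have [measurable]: "h \<in> borel_measurable borel" using e by simp
  have "integrable (radial_measure \<Otimes>\<^sub>M radial_measure)
     (\<lambda>z. (case z of (s, t) \<Rightarrow> (\<bar>s\<bar> * (h s)\<^sup>2) * (h t)\<^sup>2) + (case z of (s, t) \<Rightarrow> (h s)\<^sup>2 * (\<bar>t\<bar> * (h t)\<^sup>2)))"
    using e by (intro Bochner_Integration.integrable_add radial.integrable_mult_pair) auto
  then show ?thesis
  proof (rule Bochner_Integration.integrable_bound)
    have "\<bar>max s t\<bar> * ((h s)\<^sup>2 * (h t)\<^sup>2) \<le> (\<bar>s\<bar> + \<bar>t\<bar>) * ((h s)\<^sup>2 * (h t)\<^sup>2)" for s t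
      by (intro mult_right_mono) auto
    then show "AE z in radial_measure \<Otimes>\<^sub>M radial_measure. norm (case z of (s, t) \<Rightarrow> max s t * (h s)\<^sup>2 * (h t)\<^sup>2)
       \<le> norm ((case z of (s, t) \<Rightarrow> (\<bar>s\<bar> * (h s)\<^sup>2) * (h t)\<^sup>2) + (case z of (s, t) \<Rightarrow> (h s)\<^sup>2 * (\<bar>t\<bar> * (h t)\<^sup>2)))"
      by (intro AE_I2) (auto simp: abs_mult distrib_right mult_ac)
  qed measurable
qed

lemma interaction_ge:
  assumes prof: "energy_profile h p"
  shows "interaction h \<ge> (\<integral>t. (h t)\<^sup>2 \<partial>radial_measure) * (\<integral>t. t * (h t)\<^sup>2 \<partial>radial_measure)"
proof -
  note e = prof[unfolded energy_profile_def]
  have it: "integrable radial_measure (\<lambda>t. t * (h t)\<^sup>2)" using e by (intro integrable_weight_sign) auto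
  have "(\<integral>t. (h t)\<^sup>2 \<partial>radial_measure) * (\<integral>t. t * (h t)\<^sup>2 \<partial>radial_measure)
     = (\<integral>z. (case z of (s, t) \<Rightarrow> (h s)\<^sup>2 * (t * (h t)\<^sup>2)) \<partial>(radial_measure \<Otimes>\<^sub>M radial_measure))"
    using e it by (subst radial.integral_mult_pair) auto
  also have "\<dots> \<le> interaction h"
    unfolding interaction_def
  proof (rule integral_mono)
    show "integrable (radial_measure \<Otimes>\<^sub>M radial_measure) (\<lambda>(s, t). (h s)\<^sup>2 * (t * (h t)\<^sup>2))"
      using e it by (intro radial.integrable_mult_pair) auto
    show "integrable (radial_measure \<Otimes>\<^sub>M radial_measure) (\<lambda>(s, t). max s t * (h s)\<^sup>2 * (h t)\<^sup>2)"
      by (rule integrable_interaction[OF prof])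
    have "(h s)\<^sup>2 * (t * (h t)\<^sup>2) \<le> max s t * (h s)\<^sup>2 * (h t)\<^sup>2" for s t
    proof -
      have "t * ((h s)\<^sup>2 * (h t)\<^sup>2) \<le> max s t * ((h s)\<^sup>2 * (h t)\<^sup>2)"
        by (intro mult_right_mono) auto
      then show ?thesis by (simp only: mult_ac)
    qed
    then show "(case z of (s, t) \<Rightarrow> (h s)\<^sup>2 * (t * (h t)\<^sup>2)) \<le> (case z of (s, t) \<Rightarrow> max s t * (h s)\<^sup>2 * (h t)\<^sup>2)" for z
      by (cases z) simp
  qed
  finally show ?thesis .
qed

text \<open>For negative \<open>t\<close> the difference of \<open>\<bar>t\<bar>\<close> and
  \<open>t\<close> is \<open>2 * \<bar>t\<bar>\<close>, so the constants are twice those of Young's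
  inequality for \<open>\<bar>t\<bar>\<close>; then \<open>y^2 \<le> exp (2 * y)\<close>.\<close>

lemma negative_part_le:
  fixes e t :: real
  assumes "e > 0"
  shows "\<bar>t\<bar> - 2 * e * exp (- (2 * t)) - 1 / (2 * e) \<le> t"
proof (cases "t \<ge> 0")
  case True
  moreover have "2 * e * exp (- (2 * t)) \<ge> 0" "1 / (2 * e) \<ge> 0" using assms by simp_all
  ultimately show ?thesis unfolding abs_of_nonneg[OF True] by linarith
next
  case False
  define y where "y = - t"
  have y: "y > 0" using False by (simp add: y_def)
  have "y\<^sup>2 \<le> (exp y)\<^sup>2" using y exp_ge_add_one_self[of y] by (intro power_mono) linarith+
  then have "2 * e * y\<^sup>2 \<le> 2 * e * exp (2 * y)" using assms by (simp add: exp_double)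
  moreover have "2 * y \<le> 2 * e * y\<^sup>2 + 1 / (2 * e)"
  proof -
    have "0 \<le> (2 * e * y - 1)\<^sup>2 / (2 * e)" using assms by simp
    also have "\<dots> = 2 * e * y\<^sup>2 + 1 / (2 * e) - 2 * y"
      using assms by (simp add: power2_eq_square field_simps)
    finally show ?thesis by simp
  qed
  ultimately show ?thesis using y by (simp add: y_def)
qed

lemma profile_energy_coercive:
  fixes \<gamma> lam :: real and m :: nat
  assumes "\<gamma> > 0" "m > 0" "lam > 0"
  obtains c C where "c > 0" and
    "\<And>h p. energy_profile h p \<Longrightarrow> (\<integral>t. (h t)\<^sup>2 \<partial>radial_measure) = lam \<Longrightarrow>
      c * ((\<integral>t. (p t)\<^sup>2 \<partial>lborel) + (\<integral>t. (h t)\<^sup>2 \<partial>lborel) + (\<integral>t. \<bar>t\<bar> * (h t)\<^sup>2 \<partial>radial_measure)) - C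
        \<le> profile_energy \<gamma> m h p"
proof -
  \<comment> \<open>\<open>k\<close> is the coefficient of the moment of \<open>t\<close> after one
    factor \<open>lam\<close> has split off in \<open>interaction_ge\<close>. The parameter
    \<open>e\<close> is tuned so that the loss \<open>k * (2 * e * (2 * pi * H))\<close> is half of
    the centrifugal energy.\<close>
  define k where "k = \<gamma> * lam / (4 * pi)"
  define e where "e = (real m)\<^sup>2 / (4 * k)"
  have k: "k > 0" using assms by (simp add: k_def)
  have e: "e > 0" using assms k by (simp add: e_def)
  have m1: "(real m)\<^sup>2 \<ge> 1" using \<open>m > 0\<close> by (simp add: one_le_power)
  \<comment> \<open>After the absorption at least \<open>pi\<close> remains in front of both lborel
    integrals and \<open>k\<close> in front of the weighted one.\<close>
  define c where "c = min pi k"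
  have "c * ((\<integral>t. (p t)\<^sup>2 \<partial>lborel) + (\<integral>t. (h t)\<^sup>2 \<partial>lborel) + (\<integral>t. \<bar>t\<bar> * (h t)\<^sup>2 \<partial>radial_measure)) - k * (lam / (2 * e))
        \<le> profile_energy \<gamma> m h p"
    if prof: "energy_profile h p" and mass: "(\<integral>t. (h t)\<^sup>2 \<partial>radial_measure) = lam" for h p
  proof -
    note E = prof[unfolded energy_profile_def]
    have [measurable]: "h \<in> borel_measurable borel" using E by simp
    define P where "P = (\<integral>t. (p t)\<^sup>2 \<partial>lborel)"
    define H where "H = (\<integral>t. (h t)\<^sup>2 \<partial>lborel)"
    define A where "A = (\<integral>t. \<bar>t\<bar> * (h t)\<^sup>2 \<partial>radial_measure)"
    have nn: "P \<ge> 0" "H \<ge> 0" "A \<ge> 0" by (auto simp: P_def H_def A_def integral_nonneg_AE)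
    have ie: "integrable radial_measure (\<lambda>t. exp (- (2 * t)) * (h t)\<^sup>2)" using E by (simp add: integrable_radial_iff)
    have it: "integrable radial_measure (\<lambda>t. t * (h t)\<^sup>2)" using E by (intro integrable_weight_sign) auto
    have "A - 2 * e * (2 * pi * H) - 1 / (2 * e) * lam
       = (\<integral>t. \<bar>t\<bar> * (h t)\<^sup>2 - 2 * e * (exp (- (2 * t)) * (h t)\<^sup>2) - 1 / (2 * e) * (h t)\<^sup>2 \<partial>radial_measure)"
      using E ie by (simp add: A_def H_def mass integrable_radial_iff(2)[symmetric])
    also have "\<dots> \<le> (\<integral>t. t * (h t)\<^sup>2 \<partial>radial_measure)"
    proof (rule integral_mono[OF _ it])
      show "integrable radial_measure (\<lambda>t. \<bar>t\<bar> * (h t)\<^sup>2 - 2 * e * (exp (- (2 * t)) * (h t)\<^sup>2) - 1 / (2 * e) * (h t)\<^sup>2)"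
        using E ie by (intro Bochner_Integration.integrable_diff integrable_mult_right) auto
      have "(\<bar>t\<bar> - 2 * e * exp (- (2 * t)) - 1 / (2 * e)) * (h t)\<^sup>2 \<le> t * (h t)\<^sup>2" for t
        by (intro mult_right_mono negative_part_le e) auto
      then show "\<bar>t\<bar> * (h t)\<^sup>2 - 2 * e * (exp (- (2 * t)) * (h t)\<^sup>2) - 1 / (2 * e) * (h t)\<^sup>2 \<le> t * (h t)\<^sup>2" for t
        by (simp only: left_diff_distrib mult.assoc)
    qed
    finally have J: "A - 2 * e * (2 * pi * H) - 1 / (2 * e) * lam \<le> (\<integral>t. t * (h t)\<^sup>2 \<partial>radial_measure)" .
    have "k * (A - 2 * e * (2 * pi * H) - 1 / (2 * e) * lam) \<le> k * (\<integral>t. t * (h t)\<^sup>2 \<partial>radial_measure)"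
      using J k by (intro mult_left_mono) auto
    also have "\<dots> = \<gamma> / (4 * pi) * (lam * (\<integral>t. t * (h t)\<^sup>2 \<partial>radial_measure))" by (simp add: k_def)
    also have "\<dots> \<le> \<gamma> / (4 * pi) * interaction h"
      using interaction_ge[OF prof] assms by (intro mult_left_mono) (auto simp: mass)
    finally have I: "k * (A - 2 * e * (2 * pi * H) - 1 / (2 * e) * lam) \<le> \<gamma> / (4 * pi) * interaction h" .
    have "k * (2 * e * (2 * pi * H)) = pi * (real m)\<^sup>2 * H"
      using k by (simp add: e_def)
    moreover have "k * (1 / (2 * e) * lam) = k * (lam / (2 * e))" by simp
    ultimately have "2 * pi * P + pi * (real m)\<^sup>2 * H + k * A - k * (lam / (2 * e)) \<le> profile_energy \<gamma> m h p"
      using I unfolding profile_energy_def P_def[symmetric] H_def[symmetric] right_diff_distrib by linarith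
    moreover have ck: "c \<le> pi" "c \<le> k" by (simp_all add: c_def)
    moreover have "c * P \<le> 2 * pi * P" "c * A \<le> k * A"
      using nn ck pi_gt_zero by (intro mult_right_mono; linarith)+
    moreover have "c * H \<le> pi * (real m)\<^sup>2 * H"
      using nn mult_left_mono[OF m1, of pi] by (intro mult_right_mono) (auto simp: c_def min.coboundedI1)
    ultimately show ?thesis unfolding P_def[symmetric] H_def[symmetric] A_def[symmetric] distrib_left by linarith
  qed
  moreover have "c > 0" using k by (simp add: c_def)
  ultimately show ?thesis using that by blast
qed

section \<open>Compactness and existence of a minimiser\<close>

lemma fatou_integral:
  fixes f :: "'a \<Rightarrow> real"
  assumes [measurable]: "f \<in> borel_measurable M" and u: "\<And>i. integrable M (u i)" "\<And>i x. 0 \<le> u i x"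
    and lim: "\<And>x. (\<lambda>i. u i x) \<longlonglongrightarrow> f x" and c: "(\<lambda>i. \<integral>x. u i x \<partial>M) \<longlonglongrightarrow> c"
  shows "integrable M f" "(\<integral>x. f x \<partial>M) \<le> c"
proof -
  have f0: "f x \<ge> 0" for x by (rule LIMSEQ_le_const[OF lim]) (use u in auto)
  have c0: "c \<ge> 0" by (rule LIMSEQ_le_const[OF c]) (use u in \<open>auto intro!: integral_nonneg_AE\<close>)
  have [measurable]: "u i \<in> borel_measurable M" for i using u by simp
  have "(\<integral>\<^sup>+x. ennreal (f x) \<partial>M) \<le> liminf (\<lambda>i. \<integral>\<^sup>+x. ennreal (u i x) \<partial>M)"
    by (rule nn_integral_fatou) (auto intro!: tendsto_ennrealI lim)
  also have "\<dots> = liminf (\<lambda>i. ennreal (\<integral>x. u i x \<partial>M))"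
    using u by (subst nn_integral_eq_integral) auto
  also have "\<dots> = ennreal c"
    by (intro lim_imp_Liminf tendsto_ennrealI c) simp
  finally have le: "(\<integral>\<^sup>+x. ennreal (f x) \<partial>M) \<le> ennreal c" .
  then show int: "integrable M f"
    using f0 by (intro integrableI_nonneg) (auto intro: order_le_less_trans)
  have "ennreal (\<integral>x. f x \<partial>M) \<le> ennreal c"
    using le nn_integral_eq_integral[OF int] f0 by simp
  then show "(\<integral>x. f x \<partial>M) \<le> c" using c0 by (simp add: ennreal_le_iff)
qed

lemma riesz_energy_profile:
  assumes cont: "continuous_on UNIV h" and h0: "\<And>t. h t \<ge> 0" and "C \<ge> 0"
    and bound: "\<And>k. (\<integral>\<^sup>+t. ennreal ((dyadic_quot h k t)\<^sup>2) \<partial>lborel) \<le> ennreal C"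
    and int: "integrable lborel (\<lambda>t. (h t)\<^sup>2)" "integrable radial_measure (\<lambda>t. (h t)\<^sup>2)"
      "integrable radial_measure (\<lambda>t. \<bar>t\<bar> * (h t)\<^sup>2)"
  obtains g where "energy_profile h g" "(\<integral>t. (g t)\<^sup>2 \<partial>lborel) \<le> C"
    "\<And>a b. a \<le> b \<Longrightarrow> set_integrable lborel {a..b} g"
    "\<And>a b. a \<le> b \<Longrightarrow> h b - h a = (LINT t:{a..b}|lborel. g t)"
proof -
  obtain g where g[measurable]: "g \<in> borel_measurable borel" and gC: "(\<integral>\<^sup>+t. ennreal ((g t)\<^sup>2) \<partial>lborel) \<le> ennreal C"
    and gi: "\<And>a b. a \<le> b \<Longrightarrow> set_integrable lborel {a..b} g"
    and gf: "\<And>a b. a \<le> b \<Longrightarrow> h b - h a = (LINT t:{a..b}|lborel. g t)"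
    using riesz_derivative[OF cont bound] by blast
  have ig: "integrable lborel (\<lambda>t. (g t)\<^sup>2)"
    using gC by (intro integrableI_nonneg) (auto intro: order_le_less_trans)
  have "ennreal (\<integral>t. (g t)\<^sup>2 \<partial>lborel) \<le> ennreal C"
    using gC by (subst (asm) nn_integral_eq_integral[OF ig]) auto
  then have "(\<integral>t. (g t)\<^sup>2 \<partial>lborel) \<le> C" using \<open>C \<ge> 0\<close> by (simp add: ennreal_le_iff)
  moreover have "ennreal \<bar>h b - h a\<bar> \<le> (\<integral>\<^sup>+t. ennreal \<bar>g t\<bar> * indicator {a..b} t \<partial>lborel)" if "a \<le> b" for a b
  proof -
    have "ennreal \<bar>h b - h a\<bar> \<le> (\<integral>\<^sup>+t. ennreal (norm (indicator {a..b} t *\<^sub>R g t)) \<partial>lborel)"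
      unfolding gf[OF that] set_lebesgue_integral_def real_norm_def[symmetric]
      by (rule integral_norm_bound_ennreal) (use gi[OF that] in \<open>simp add: set_integrable_def\<close>)
    also have "\<dots> = (\<integral>\<^sup>+t. ennreal \<bar>g t\<bar> * indicator {a..b} t \<partial>lborel)"
      by (intro nn_integral_cong) (auto split: split_indicator)
    finally show ?thesis .
  qed
  ultimately show ?thesis
    using that[of g] int h0 ig gi gf borel_measurable_continuous_onI[OF cont]
    by (auto simp: energy_profile_def)
qed

text \<open>Guarantees that the constraint set is nonempty, so that the infimum is a real number and
  a minimising sequence exists.\<close>

lemma exists_energy_profile:
  assumes "lam > 0"
  obtains h g where "energy_profile h g" "(\<integral>t. (h t)\<^sup>2 \<partial>radial_measure) = lam"
    "\<And>a b. a \<le> b \<Longrightarrow> set_integrable lborel {a..b} g"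
    "\<And>a b. a \<le> b \<Longrightarrow> h b - h a = (LINT t:{a..b}|lborel. g t)"
proof -
  \<comment> \<open>A tent in the logarithmic variable, rescaled below to the prescribed mass; it
    vanishes near the origin and near infinity, so all weights are harmless.\<close>
  define T where "T t = max 0 (1 - \<bar>t\<bar>)" for t :: real
  have [measurable]: "T \<in> borel_measurable borel" unfolding T_def by measurable
  have T: "0 \<le> T t" "(T t)\<^sup>2 \<le> indicator {-1..1::real} t" "\<bar>t\<bar> * (T t)\<^sup>2 \<le> indicator {-1..1::real} t" for t
  proof -
    show "0 \<le> T t" by (simp add: T_def)
    show 1: "(T t)\<^sup>2 \<le> indicator {-1..1::real} t"
      by (auto simp: T_def power_le_one split: split_indicator)
    show "\<bar>t\<bar> * (T t)\<^sup>2 \<le> indicator {-1..1::real} t"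
    proof (cases "t \<in> {-1..1::real}")
      case True
      then have "\<bar>t\<bar> * (T t)\<^sup>2 \<le> 1 * 1" using 1 by (intro mult_mono) (auto simp: abs_le_iff)
      then show ?thesis using True by simp
    next
      case False
      then have "T t = 0" by (auto simp: T_def)
      then show ?thesis using False by simp
    qed
  qed
  have i1: "integrable radial_measure (\<lambda>t. indicator {-1..1::real} t :: real)"
    by (rule Bochner_Integration.integrable_bound[OF integrable_indicator_atMost[of 1]])
      (auto split: split_indicator)
  have i2: "integrable lborel (\<lambda>t. indicator {-1..1::real} t :: real)"
    by (intro integrable_real_indicator) auto
  have iT: "integrable radial_measure (\<lambda>t. (T t)\<^sup>2)" "integrable radial_measure (\<lambda>t. \<bar>t\<bar> * (T t)\<^sup>2)"
    by (rule Bochner_Integration.integrable_bound[OF i1]; use T in \<open>auto simp: abs_mult\<close>)+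
  have iT': "integrable lborel (\<lambda>t. (T t)\<^sup>2)"
    by (rule Bochner_Integration.integrable_bound[OF i2]; use T in auto)
  define N where "N = (\<integral>t. (T t)\<^sup>2 \<partial>radial_measure)"
  have "N > 0"
  proof -
    let ?I = "{- (1/2)<..<1/2} :: real set"
    have em: "emeasure radial_measure ?I = ennreal (pi * exp (2 * (1/2)) - pi * exp (2 * - (1/2)))"
      by (rule emeasure_radial_measure_interval) simp
    then have "measure radial_measure ?I = pi * (exp 1 - exp (- 1))"
      by (simp add: measure_def right_diff_distrib)
    then have pos: "measure radial_measure ?I > 0" by simp
    have "1/4 * measure radial_measure ?I = (\<integral>t. (1/4::real) * indicator ?I t \<partial>radial_measure)"
      by simp
    also have "\<dots> \<le> N"
      unfolding N_def
    proof (rule integral_mono[OF _ iT(1)])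
      show "integrable radial_measure (\<lambda>t. (1/4::real) * indicator ?I t)"
        using em by (intro integrable_mult_right integrable_real_indicator) auto
      show "1/4 * indicator ?I t \<le> (T t)\<^sup>2" for t
      proof (cases "t \<in> ?I")
        case True
        then have "1/2 \<le> T t" by (auto simp: T_def abs_if)
        then have "(1/2)\<^sup>2 \<le> (T t)\<^sup>2" by (intro power_mono) auto
        then show ?thesis using True by (simp add: power_divide)
      qed simp
    qed
    finally show ?thesis using pos by simp
  qed
  define \<alpha> where "\<alpha> = sqrt (lam / N)"
  have \<alpha>2: "\<alpha>\<^sup>2 = lam / N" and \<alpha>0: "\<alpha> > 0" using \<open>N > 0\<close> assms by (auto simp: \<alpha>_def)
  define h where "h t = \<alpha> * T t" for t
  have h2: "(h t)\<^sup>2 = \<alpha>\<^sup>2 * (T t)\<^sup>2" for t by (simp add: h_def power_mult_distrib)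
  have cont: "continuous_on UNIV h" unfolding h_def T_def by (intro continuous_intros)
  have [measurable]: "h \<in> borel_measurable borel" by (rule borel_measurable_continuous_onI[OF cont])
  \<comment> \<open>The tent has Lipschitz constant 1 and varies only on \<open>{-1..1}\<close>, so
    a scaled indicator bounds its variation; its squared norm is
    \<open>\<alpha>^2 * 2\<close>.\<close>
  have var: "ennreal \<bar>h b - h a\<bar> \<le> (\<integral>\<^sup>+t. ennreal \<bar>\<alpha> * indicator {-1..1::real} t\<bar> * indicator {a..b} t \<partial>lborel)" if "a \<le> b" for a b
  proof -
    have "\<bar>T b - T a\<bar> \<le> max 0 (min b 1 - max a (-1))"
      using that unfolding T_def max_def min_def abs_if by auto
    then have "ennreal \<bar>T b - T a\<bar> \<le> emeasure lborel {max a (-1)..min b 1}"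
      by (auto simp: emeasure_lborel_Icc_eq max_def split: if_splits intro!: ennreal_leI)
    moreover have "\<bar>h b - h a\<bar> = \<alpha> * \<bar>T b - T a\<bar>"
      using \<alpha>0 by (simp add: h_def right_diff_distrib[symmetric] abs_mult)
    ultimately have "ennreal \<bar>h b - h a\<bar> \<le> ennreal \<alpha> * emeasure lborel {max a (-1)..min b 1}"
      using \<alpha>0 by (simp add: ennreal_mult mult_left_mono)
    also have "\<dots> = (\<integral>\<^sup>+t. ennreal \<alpha> * indicator {max a (-1)..min b 1} t \<partial>lborel)"
      by (simp add: nn_integral_cmult_indicator)
    also have "\<dots> = (\<integral>\<^sup>+t. ennreal \<bar>\<alpha> * indicator {-1..1::real} t\<bar> * indicator {a..b} t \<partial>lborel)"
      using \<alpha>0 by (intro nn_integral_cong) (auto split: split_indicator)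
    finally show ?thesis .
  qed
  have bound: "(\<integral>\<^sup>+t. ennreal ((dyadic_quot h k t)\<^sup>2) \<partial>lborel) \<le> ennreal (\<alpha>\<^sup>2 * 2)" for k
  proof -
    have "(\<integral>\<^sup>+t. ennreal ((dyadic_quot h k t)\<^sup>2) \<partial>lborel) \<le> (\<integral>\<^sup>+t. ennreal ((\<alpha> * indicator {-1..1::real} t)\<^sup>2) \<partial>lborel)"
      by (rule dyadic_quot_energy_le) (auto intro: var)
    also have "\<dots> = (\<integral>\<^sup>+t. ennreal (\<alpha>\<^sup>2) * indicator {-1..1::real} t \<partial>lborel)"
      by (intro nn_integral_cong) (auto split: split_indicator)
    also have "\<dots> = ennreal (\<alpha>\<^sup>2 * 2)" by (simp add: nn_integral_cmult_indicator ennreal_mult)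
    finally show ?thesis .
  qed
  have mass: "(\<integral>t. (h t)\<^sup>2 \<partial>radial_measure) = lam"
    using \<open>N > 0\<close> by (simp add: h2 \<alpha>2 N_def[symmetric])
  have ih: "integrable lborel (\<lambda>t. (h t)\<^sup>2)" "integrable radial_measure (\<lambda>t. (h t)\<^sup>2)"
    "integrable radial_measure (\<lambda>t. \<bar>t\<bar> * (h t)\<^sup>2)"
    using iT iT' by (simp_all add: h2 mult.left_commute[of _ "\<alpha>\<^sup>2"])
  have h0: "h t \<ge> 0" for t using \<alpha>0 T by (simp add: h_def)
  show ?thesis
    by (rule riesz_energy_profile[OF cont h0 _ bound ih]) (use mass that in auto)
qed

text \<open>Along one subsequence the profiles converge pointwise and the separate parts of the
  energy converge as numbers. Each part is lower semicontinuous for its own reason, while the mass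
  is preserved exactly.\<close>

proposition energy_profile_compactness:
  fixes H P :: "nat \<Rightarrow> real \<Rightarrow> real"
  assumes prof: "\<And>n. energy_profile (H n) (P n)"
    and mass: "\<And>n. (\<integral>t. (H n t)\<^sup>2 \<partial>radial_measure) = lam"
    and bP: "\<And>n. (\<integral>t. (P n t)\<^sup>2 \<partial>lborel) \<le> K" and bH: "\<And>n. (\<integral>t. (H n t)\<^sup>2 \<partial>lborel) \<le> K"
    and bT: "\<And>n. (\<integral>t. \<bar>t\<bar> * (H n t)\<^sup>2 \<partial>radial_measure) \<le> K"
    and "\<gamma> > 0" and conv: "(\<lambda>n. profile_energy \<gamma> m (H n) (P n)) \<longlonglongrightarrow> L"
  obtains h g where "energy_profile h g" "(\<integral>t. (h t)\<^sup>2 \<partial>radial_measure) = lam"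
    "\<And>a b. a \<le> b \<Longrightarrow> set_integrable lborel {a..b} g"
    "\<And>a b. a \<le> b \<Longrightarrow> h b - h a = (LINT t:{a..b}|lborel. g t)"
    "profile_energy \<gamma> m h g \<le> L"
proof -
  note E = prof[unfolded energy_profile_def]
  have [measurable]: "H n \<in> borel_measurable borel" "P n \<in> borel_measurable borel" for n using E[of n] by auto
  have H0: "H n t \<ge> 0" for n t using E[of n] by auto
  have "0 \<le> (\<integral>t. (P 0 t)\<^sup>2 \<partial>lborel)" by (simp add: integral_nonneg_AE)
  then have K0: "K \<ge> 0" using bP[of 0] by linarith
  have H4: "(H n t)\<^sup>2 \<le> 4 * K" for n t
    using energy_profile_bounded[OF prof, of n t] bP[of n] bH[of n] by linarith
  \<comment> \<open>Values at rational points and the three integrals are packed into one bounded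
    family over a countable index set, so a single diagonal extraction handles all of them.\<close>
  define F where "F n x = (case x of Inl t \<Rightarrow> H n t | Inr i \<Rightarrow>
      if i = 0 then \<integral>t. (P n t)\<^sup>2 \<partial>lborel else if i = 1 then \<integral>t. (H n t)\<^sup>2 \<partial>lborel
      else \<integral>t. \<bar>t\<bar> * (H n t)\<^sup>2 \<partial>radial_measure)" for n and x :: "real + nat"
  define S where "S = (Inl ` \<rat> \<union> Inr ` UNIV :: (real + nat) set)"
  have "countable S" by (auto simp: S_def countable_rat)
  moreover have "norm (F n x) \<le> max (sqrt (4 * K)) K" if "x \<in> S" for n x
  proof (cases x)
    case (Inl t)
    have "\<bar>H n t\<bar> \<le> sqrt (4 * K)" using H4[of n t] by (intro real_le_rsqrt) simp
    then show ?thesis using Inl by (simp add: F_def)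
  next
    case (Inr i)
    have "\<bar>\<integral>t. (P n t)\<^sup>2 \<partial>lborel\<bar> \<le> K" "\<bar>\<integral>t. (H n t)\<^sup>2 \<partial>lborel\<bar> \<le> K"
      "\<bar>\<integral>t. \<bar>t\<bar> * (H n t)\<^sup>2 \<partial>radial_measure\<bar> \<le> K"
      using bP[of n] bH[of n] bT[of n] by (simp_all add: integral_nonneg_AE)
    then show ?thesis using Inr by (simp add: F_def max.coboundedI2)
  qed
  ultimately obtain k where k: "strict_mono k" and kS: "\<And>x. x \<in> S \<Longrightarrow> \<exists>l. (\<lambda>n. F (k n) x) \<longlonglongrightarrow> l"
    using function_convergent_subsequence[of S F] by blast
  obtain a where a: "(\<lambda>n. \<integral>t. (P (k n) t)\<^sup>2 \<partial>lborel) \<longlonglongrightarrow> a" using kS[of "Inr 0"] by (auto simp: S_def F_def)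
  obtain b where b: "(\<lambda>n. \<integral>t. (H (k n) t)\<^sup>2 \<partial>lborel) \<longlonglongrightarrow> b" using kS[of "Inr 1"] by (auto simp: S_def F_def)
  obtain d where d: "(\<lambda>n. \<integral>t. \<bar>t\<bar> * (H (k n) t)\<^sup>2 \<partial>radial_measure) \<longlonglongrightarrow> d" using kS[of "Inr 2"] by (auto simp: S_def F_def)
  have hol: "(H n t - H n s)\<^sup>2 \<le> \<bar>t - s\<bar> * K" for n s t
    using order_trans[OF energy_profile_holder[OF prof] mult_left_mono[OF bP abs_ge_zero]] .
  have cv: "convergent (\<lambda>n. H (k n) t)" for t
  proof (rule Cauchy_convergent, rule metric_CauchyI)
    fix e :: real assume e: "e > 0"
    \<comment> \<open>Chosen so that the Hoelder estimate makes values at distance below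
      \<open>r\<close> differ by less than \<open>e / 3\<close>; \<open>K + 1\<close> avoids
      division by zero.\<close>
    define r where "r = (e / 3)\<^sup>2 / (K + 1)"
    have "r > 0" using e K0 by (simp add: r_def)
    then obtain q where q: "q \<in> \<rat>" "t < q" "q < t + r" using Rats_dense_in_real[of t "t + r"] by auto
    have near: "\<bar>H n t - H n q\<bar> < e / 3" for n
    proof -
      have "(H n t - H n q)\<^sup>2 \<le> \<bar>t - q\<bar> * K" by (rule hol)
      also have "\<dots> \<le> \<bar>t - q\<bar> * (K + 1)" by (intro mult_left_mono) auto
      also have "\<dots> < r * (K + 1)" using q K0 by (intro mult_strict_right_mono) auto
      also have "\<dots> = (e / 3)\<^sup>2" using K0 by (simp add: r_def)
      finally have "\<bar>H n t - H n q\<bar>\<^sup>2 < (e / 3)\<^sup>2" by simp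
      then show ?thesis using e by (intro power2_less_imp_less[of _ "e / 3"]) auto
    qed
    have "Cauchy (\<lambda>n. H (k n) q)"
      using kS[of "Inl q"] q by (intro convergent_Cauchy) (auto simp: S_def F_def convergent_def)
    then obtain M where M: "\<And>i j. i \<ge> M \<Longrightarrow> j \<ge> M \<Longrightarrow> dist (H (k i) q) (H (k j) q) < e / 3"
      using e by (metis Cauchy_def divide_pos_pos zero_less_numeral)
    have "dist (H (k i) t) (H (k j) t) < e" if "i \<ge> M" "j \<ge> M" for i j
      using near[of "k i"] near[of "k j"] M[OF that] unfolding dist_real_def by linarith
    then show "\<exists>M. \<forall>i\<ge>M. \<forall>j\<ge>M. dist (H (k i) t) (H (k j) t) < e" by blast
  qed
  define h where "h t = lim (\<lambda>n. H (k n) t)" for t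
  have hl: "(\<lambda>n. H (k n) t) \<longlonglongrightarrow> h t" for t using cv by (simp add: h_def convergent_LIMSEQ_iff)
  have h0: "h t \<ge> 0" for t by (rule LIMSEQ_le_const[OF hl]) (use H0 in auto)
  have hhol: "(h t - h s)\<^sup>2 \<le> \<bar>t - s\<bar> * K" for s t
    by (rule LIMSEQ_le_const2[OF tendsto_power[OF tendsto_diff[OF hl hl]]]) (use hol in auto)
  have cont: "continuous_on UNIV h"
    unfolding continuous_on_def
  proof
    fix s :: real
    have "((\<lambda>t. h t - h s) \<longlongrightarrow> 0) (at s)"
    proof (rule Lim_null_comparison)
      show "\<forall>\<^sub>F t in at s. norm (h t - h s) \<le> sqrt (\<bar>t - s\<bar> * K)"
        using hhol by (intro always_eventually allI real_le_rsqrt) simp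
      have "((\<lambda>t. sqrt (\<bar>t - s\<bar> * K)) \<longlongrightarrow> sqrt (\<bar>s - s\<bar> * K)) (at s)"
        by (intro tendsto_intros)
      then show "((\<lambda>t. sqrt (\<bar>t - s\<bar> * K)) \<longlongrightarrow> 0) (at s)" by simp
    qed
    then show "(h \<longlongrightarrow> h s) (at s within UNIV)" by (simp add: LIM_zero_cancel)
  qed
  have [measurable]: "h \<in> borel_measurable borel" by (rule borel_measurable_continuous_onI[OF cont])
  have a0: "a \<ge> 0" by (rule LIMSEQ_le_const[OF a]) (auto simp: integral_nonneg_AE)
  \<comment> \<open>At a fixed level the quotients converge pointwise, so the limit \<open>a\<close>
    of the kinetic integrals bounds every level although \<open>P\<close> itself need not
    converge.\<close>
  have dq: "(\<integral>\<^sup>+t. ennreal ((dyadic_quot h j t)\<^sup>2) \<partial>lborel) \<le> ennreal a" for j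
  proof -
    have "(\<integral>\<^sup>+t. ennreal ((dyadic_quot h j t)\<^sup>2) \<partial>lborel)
       \<le> liminf (\<lambda>n. \<integral>\<^sup>+t. ennreal ((dyadic_quot (H (k n)) j t)\<^sup>2) \<partial>lborel)"
      by (rule nn_integral_fatou) (auto simp: dyadic_quot_def intro!: tendsto_intros hl)
    also have "\<dots> \<le> liminf (\<lambda>n. \<integral>\<^sup>+t. ennreal ((P (k n) t)\<^sup>2) \<partial>lborel)"
      using E by (intro Liminf_mono always_eventually allI dyadic_quot_energy_le) auto
    also have "\<dots> = liminf (\<lambda>n. ennreal (\<integral>t. (P (k n) t)\<^sup>2 \<partial>lborel))"
      using E by (subst nn_integral_eq_integral) auto
    also have "\<dots> = ennreal a" by (intro lim_imp_Liminf tendsto_ennrealI a) simp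
    finally show ?thesis .
  qed
  have fH: "integrable lborel (\<lambda>t. (h t)\<^sup>2)" "(\<integral>t. (h t)\<^sup>2 \<partial>lborel) \<le> b"
    by (rule fatou_integral[OF _ _ _ _ b]; use E in \<open>auto intro!: tendsto_intros hl\<close>)+
  have fT: "integrable radial_measure (\<lambda>t. \<bar>t\<bar> * (h t)\<^sup>2)"
    by (rule fatou_integral[OF _ _ _ _ d]; use E in \<open>auto intro!: tendsto_intros hl\<close>)
  have mc: "(\<lambda>n. \<integral>t. (H (k n) t)\<^sup>2 \<partial>radial_measure) \<longlonglongrightarrow> lam" by (simp add: mass)
  have fN: "integrable radial_measure (\<lambda>t. (h t)\<^sup>2)" "(\<integral>t. (h t)\<^sup>2 \<partial>radial_measure) \<le> lam"
    by (rule fatou_integral[OF _ _ _ _ mc]; use E in \<open>auto intro!: tendsto_intros hl\<close>)+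
  obtain g where g: "energy_profile h g" "(\<integral>t. (g t)\<^sup>2 \<partial>lborel) \<le> a"
    "\<And>a b. a \<le> b \<Longrightarrow> set_integrable lborel {a..b} g"
    "\<And>a b. a \<le> b \<Longrightarrow> h b - h a = (LINT t:{a..b}|lborel. g t)"
    using riesz_energy_profile[OF cont h0 a0 dq fH(1) fN(1) fT] by blast
  \<comment> \<open>Chebyshev's inequality with weight \<open>\<bar>t\<bar>\<close>: at most
    \<open>K / T\<close> of the mass lies beyond \<open>T\<close>, uniformly in
    \<open>n\<close>.\<close>
  have tight: "lam - K / T \<le> (\<integral>t. (h t)\<^sup>2 \<partial>radial_measure)" if "T > 0" for T
  proof -
    have iI: "integrable radial_measure (\<lambda>t. indicator {..T} t * (H n t)\<^sup>2)" for n
      using E[of n] integrable_mult_indicator[of "{..T}" radial_measure "\<lambda>t. (H n t)\<^sup>2"] by simp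
    have low: "lam - K / T \<le> (\<integral>t. indicator {..T} t * (H n t)\<^sup>2 \<partial>radial_measure)" for n
    proof -
      have "lam = (\<integral>t. (H n t)\<^sup>2 \<partial>radial_measure)" by (simp add: mass)
      also have "\<dots> \<le> (\<integral>t. indicator {..T} t * (H n t)\<^sup>2 + 1 / T * (\<bar>t\<bar> * (H n t)\<^sup>2) \<partial>radial_measure)"
      proof (rule integral_mono)
        show "integrable radial_measure (\<lambda>t. (H n t)\<^sup>2)" using E[of n] by simp
        show "integrable radial_measure (\<lambda>t. indicator {..T} t * (H n t)\<^sup>2 + 1 / T * (\<bar>t\<bar> * (H n t)\<^sup>2))"
          using E[of n] iI by (intro Bochner_Integration.integrable_add integrable_mult_right) auto
        show "(H n t)\<^sup>2 \<le> indicator {..T} t * (H n t)\<^sup>2 + 1 / T * (\<bar>t\<bar> * (H n t)\<^sup>2)" for t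
        proof (cases "t \<le> T")
          case True
          then show ?thesis using that by simp
        next
          case False
          then have "1 * (H n t)\<^sup>2 \<le> \<bar>t\<bar> / T * (H n t)\<^sup>2"
            using that by (intro mult_right_mono) auto
          then show ?thesis using False by simp
        qed
      qed
      also have "\<dots> = (\<integral>t. indicator {..T} t * (H n t)\<^sup>2 \<partial>radial_measure) + 1 / T * (\<integral>t. \<bar>t\<bar> * (H n t)\<^sup>2 \<partial>radial_measure)"
        using E[of n] iI by (subst Bochner_Integration.integral_add) auto
      also have "1 / T * (\<integral>t. \<bar>t\<bar> * (H n t)\<^sup>2 \<partial>radial_measure) \<le> 1 / T * K"
        using that bT[of n] by (intro mult_left_mono) auto
      finally show ?thesis by simp
    qed
    have "(\<lambda>n. \<integral>t. indicator {..T} t * (H (k n) t)\<^sup>2 \<partial>radial_measure) \<longlonglongrightarrow> (\<integral>t. indicator {..T} t * (h t)\<^sup>2 \<partial>radial_measure)"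
    \<comment> \<open>The uniform bound \<open>4 * K\<close> on a set of finite measure excludes
      concentration at the origin.\<close>
    proof (rule integral_dominated_convergence[where w = "\<lambda>t. indicator {..T} t * (4 * K)"])
      show "integrable radial_measure (\<lambda>t. indicator {..T} t * (4 * K))"
        by (intro integrable_mult_left integrable_indicator_atMost)
      show "AE t in radial_measure. (\<lambda>n. indicator {..T} t * (H (k n) t)\<^sup>2) \<longlonglongrightarrow> indicator {..T} t * (h t)\<^sup>2"
        by (intro AE_I2 tendsto_intros hl)
      show "AE t in radial_measure. norm (indicator {..T} t * (H (k n) t)\<^sup>2) \<le> indicator {..T} t * (4 * K)" for n
        using H4 by (intro AE_I2) (auto split: split_indicator)
    qed auto
    then have "lam - K / T \<le> (\<integral>t. indicator {..T} t * (h t)\<^sup>2 \<partial>radial_measure)"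
      by (rule LIMSEQ_le_const) (use low in auto)
    also have "\<dots> \<le> (\<integral>t. (h t)\<^sup>2 \<partial>radial_measure)"
      using fN(1) integrable_mult_indicator[of "{..T}" radial_measure "\<lambda>t. (h t)\<^sup>2"]
      by (intro integral_mono) (auto split: split_indicator)
    finally show ?thesis .
  qed
  have "lam \<le> (\<integral>t. (h t)\<^sup>2 \<partial>radial_measure)"
  proof (rule LIMSEQ_le_const2)
    have "(\<lambda>n. lam - K * inverse (real (Suc n))) \<longlonglongrightarrow> lam - K * 0"
      by (intro tendsto_intros LIMSEQ_inverse_real_of_nat)
    then show "(\<lambda>n. lam - K / real (Suc n)) \<longlonglongrightarrow> lam" by (simp add: divide_inverse)
    show "\<exists>N. \<forall>n\<ge>N. lam - K / real (Suc n) \<le> (\<integral>t. (h t)\<^sup>2 \<partial>radial_measure)" using tight by auto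
  qed
  with fN(2) have massh: "(\<integral>t. (h t)\<^sup>2 \<partial>radial_measure) = lam" by simp
  let ?R = "radial_measure \<Otimes>\<^sub>M radial_measure"
  \<comment> \<open>The kernel is negative only for \<open>s\<close> and \<open>t\<close> both
    negative, where it is at least \<open>- \<bar>s\<bar>\<close> and each squared profile is at
    most \<open>4 * K\<close>. Adding \<open>\<Phi>\<close> makes the integrand nonnegative for all
    profiles at once, as Fatou's lemma requires.\<close>
  define \<Phi> where "\<Phi> = (\<lambda>(s, t). ((4 * K)\<^sup>2 * (\<bar>s\<bar> * indicator {..0} s)) * indicator {..0::real} t :: real)"
  have i\<Phi>: "integrable ?R \<Phi>"
    unfolding \<Phi>_def
    by (intro radial.integrable_mult_pair integrable_mult_right integrable_abs_negative integrable_indicator_atMost)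
  define W where "W f z = (case z of (s, t) \<Rightarrow> max s t * (f s)\<^sup>2 * (f t)\<^sup>2) + \<Phi> z" for f :: "real \<Rightarrow> real" and z
  have W0: "W f z \<ge> 0" if "\<And>t. (f t)\<^sup>2 \<le> 4 * K" for f z
  proof -
    obtain s t where z: "z = (s, t)" by (cases z)
    show ?thesis
    proof (cases "s \<le> 0 \<and> t \<le> 0")
      case True
      have "(- max s t) * ((f s)\<^sup>2 * (f t)\<^sup>2) \<le> \<bar>s\<bar> * ((4 * K) * (4 * K))"
        using True K0 that by (intro mult_mono) auto
      then show ?thesis using True by (simp add: z W_def \<Phi>_def power2_eq_square[of K] mult_ac)
    next
      case False
      then have "max s t \<ge> 0" by auto
      then show ?thesis by (simp add: z W_def \<Phi>_def)
    qed
  qed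
  \<comment> \<open>The value to which the interaction must converge, since the energy and its two
    quadratic parts do.\<close>
  define v where "v = (L - 2 * pi * a - 2 * pi * (real m)\<^sup>2 * b) / (\<gamma> / (4 * pi))"
  have iconv: "(\<lambda>n. interaction (H (k n))) \<longlonglongrightarrow> v"
  proof -
    have "(\<lambda>n. (profile_energy \<gamma> m (H (k n)) (P (k n)) - 2 * pi * (\<integral>t. (P (k n) t)\<^sup>2 \<partial>lborel)
        - 2 * pi * (real m)\<^sup>2 * (\<integral>t. (H (k n) t)\<^sup>2 \<partial>lborel)) / (\<gamma> / (4 * pi))) \<longlonglongrightarrow> v"
      unfolding v_def using \<open>\<gamma> > 0\<close>
      by (intro tendsto_divide tendsto_diff tendsto_mult tendsto_const a b LIMSEQ_subseq_LIMSEQ[OF conv k, unfolded o_def]) auto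
    then show ?thesis using \<open>\<gamma> > 0\<close> by (simp add: profile_energy_def)
  qed
  have Wint: "integrable ?R (W f) \<and> (\<integral>z. W f z \<partial>?R) = interaction f + (\<integral>z. \<Phi> z \<partial>?R)" if "energy_profile f q" for f q
    unfolding W_def interaction_def using integrable_interaction[OF that] i\<Phi> by simp
  have Wc: "(\<lambda>n. \<integral>z. W (H (k n)) z \<partial>?R) \<longlonglongrightarrow> v + (\<integral>z. \<Phi> z \<partial>?R)"
    using Wint[OF prof] by (simp add: tendsto_add[OF iconv])
  have Wl: "(\<lambda>n. W (H (k n)) z) \<longlonglongrightarrow> W h z" for z
    unfolding W_def by (cases z) (auto intro!: tendsto_intros hl)
  have "(\<integral>z. W h z \<partial>?R) \<le> v + (\<integral>z. \<Phi> z \<partial>?R)"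
    by (rule fatou_integral(2)[OF _ _ _ Wl Wc]) (use Wint[OF prof] Wint[OF g(1)] W0[OF H4] in auto)
  then have "interaction h \<le> v" using Wint[OF g(1)] by simp
  then have "\<gamma> / (4 * pi) * interaction h \<le> \<gamma> / (4 * pi) * v" using \<open>\<gamma> > 0\<close> by (intro mult_left_mono) auto
  also have "\<dots> = L - 2 * pi * a - 2 * pi * (real m)\<^sup>2 * b" using \<open>\<gamma> > 0\<close> by (simp add: v_def)
  finally have "\<gamma> / (4 * pi) * interaction h \<le> L - 2 * pi * a - 2 * pi * (real m)\<^sup>2 * b" .
  moreover have "2 * pi * (\<integral>t. (g t)\<^sup>2 \<partial>lborel) \<le> 2 * pi * a" using g(2) by simp
  moreover have "2 * pi * (real m)\<^sup>2 * (\<integral>t. (h t)\<^sup>2 \<partial>lborel) \<le> 2 * pi * (real m)\<^sup>2 * b"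
    by (intro mult_left_mono fH(2)) auto
  ultimately have "profile_energy \<gamma> m h g \<le> L"
    unfolding profile_energy_def by linarith
  then show ?thesis using that[OF g(1) massh] g(3,4) by blast
qed

theorem theorem5p1:
  fixes \<gamma> :: real and m :: nat and lam :: real
  assumes "\<gamma> > 0" and "m > 0" and "lam > 0"
  shows "\<exists>u. u \<in> Xs m \<and> (\<forall>x. Im (u x) = 0 \<and> Re (u x) \<ge> 0) \<and>
             Nrm u = lam \<and> ereal (Em \<gamma> m u) = em \<gamma> m lam"
proof -
  define S where "S = {u \<in> Xs m. Nrm u = lam}"
  obtain c C where c: "c > 0" and coercive: "\<And>h p. energy_profile h p \<Longrightarrow> (\<integral>t. (h t)\<^sup>2 \<partial>radial_measure) = lam \<Longrightarrow>
      c * ((\<integral>t. (p t)\<^sup>2 \<partial>lborel) + (\<integral>t. (h t)\<^sup>2 \<partial>lborel) + (\<integral>t. \<bar>t\<bar> * (h t)\<^sup>2 \<partial>radial_measure)) - C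
        \<le> profile_energy \<gamma> m h p"
    using profile_energy_coercive[OF assms] by blast
  have profile: "\<exists>h p. energy_profile h p \<and> (\<integral>t. (h t)\<^sup>2 \<partial>radial_measure) = lam \<and> Em \<gamma> m u = profile_energy \<gamma> m h p"
    if "u \<in> S" for u
  proof -
    have u: "u \<in> Xs m" "Nrm u = lam" using that by (auto simp: S_def)
    show ?thesis by (rule Xs_energy_profile[OF u(1) \<open>m > 0\<close>]) (use u(2) in auto)
  qed
  have lower: "- C \<le> Em \<gamma> m u" if u: "u \<in> S" for u
  proof -
    obtain h p where hp: "energy_profile h p" "(\<integral>t. (h t)\<^sup>2 \<partial>radial_measure) = lam" "Em \<gamma> m u = profile_energy \<gamma> m h p"
      using profile[OF u] by blast
    have "0 \<le> c * ((\<integral>t. (p t)\<^sup>2 \<partial>lborel) + (\<integral>t. (h t)\<^sup>2 \<partial>lborel) + (\<integral>t. \<bar>t\<bar> * (h t)\<^sup>2 \<partial>radial_measure))"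
      using c by (intro mult_nonneg_nonneg add_nonneg_nonneg integral_nonneg_AE) auto
    then show ?thesis using coercive[OF hp(1,2)] hp(3) by linarith
  qed
  obtain u0 where u0: "u0 \<in> S"
  proof -
    obtain h g where hg: "energy_profile h g" "(\<integral>t. (h t)\<^sup>2 \<partial>radial_measure) = lam"
      "\<And>a b. a \<le> b \<Longrightarrow> set_integrable lborel {a..b} g"
      "\<And>a b. a \<le> b \<Longrightarrow> h b - h a = (LINT t:{a..b}|lborel. g t)"
      using exists_energy_profile[OF \<open>lam > 0\<close>] by blast
    show ?thesis
      using energy_profile_realize(1)[OF hg(1,3,4), of m] energy_profile_realize(2)[OF hg(1,3,4)] hg(2) by (intro that) (auto simp: S_def)
  qed
  \<comment> \<open>A real infimum, meaningful because \<open>S\<close> is nonempty and the energies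
    are bounded below; it is matched with the extended-real \<open>em\<close> at the end.\<close>
  define e where "e = (INF u\<in>S. Em \<gamma> m u)"
  have bdd: "bdd_below (Em \<gamma> m ` S)" using lower by (auto simp: bdd_below_def)
  have e_le: "e \<le> Em \<gamma> m u" if "u \<in> S" for u
    unfolding e_def by (rule cINF_lower[OF bdd that])
  have "\<exists>u\<in>S. Em \<gamma> m u < e + 1 / real (Suc n)" for n
    using cINF_less_iff[OF _ bdd, of "e + 1 / real (Suc n)"] u0 unfolding e_def by auto
  then obtain U where U: "\<And>n. U n \<in> S" "\<And>n. Em \<gamma> m (U n) < e + 1 / real (Suc n)" by metis
  obtain H P where HP: "\<And>n. energy_profile (H n) (P n)" "\<And>n. (\<integral>t. (H n t)\<^sup>2 \<partial>radial_measure) = lam"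
    "\<And>n. Em \<gamma> m (U n) = profile_energy \<gamma> m (H n) (P n)"
    using profile[OF U(1)] by metis
  have conv: "(\<lambda>n. profile_energy \<gamma> m (H n) (P n)) \<longlonglongrightarrow> e"
  proof (rule tendsto_sandwich[OF _ _ tendsto_const])
    have "(\<lambda>n. e + inverse (real (Suc n))) \<longlonglongrightarrow> e + 0"
      by (intro tendsto_intros LIMSEQ_inverse_real_of_nat)
    then show "(\<lambda>n. e + 1 / real (Suc n)) \<longlonglongrightarrow> e" by (simp add: divide_inverse)
    show "\<forall>\<^sub>F n in sequentially. e \<le> profile_energy \<gamma> m (H n) (P n)"
      using e_le[OF U(1)] by (simp add: HP(3))
    show "\<forall>\<^sub>F n in sequentially. profile_energy \<gamma> m (H n) (P n) \<le> e + 1 / real (Suc n)"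
      using U(2) by (intro always_eventually allI less_imp_le) (simp add: HP(3))
  qed
  \<comment> \<open>The energies of the sequence stay below \<open>e + 1\<close>, so coercivity
    bounds the sum of the three nonnegative integrals by this number.\<close>
  define K where "K = (e + 1 + C) / c"
  have bounds: "(\<integral>t. (P n t)\<^sup>2 \<partial>lborel) \<le> K" "(\<integral>t. (H n t)\<^sup>2 \<partial>lborel) \<le> K"
    "(\<integral>t. \<bar>t\<bar> * (H n t)\<^sup>2 \<partial>radial_measure) \<le> K" for n
  proof -
    have "Em \<gamma> m (U n) \<le> e + 1" using U(2)[of n] by (rule order_trans[OF less_imp_le]) simp
    then have "c * ((\<integral>t. (P n t)\<^sup>2 \<partial>lborel) + (\<integral>t. (H n t)\<^sup>2 \<partial>lborel) + (\<integral>t. \<bar>t\<bar> * (H n t)\<^sup>2 \<partial>radial_measure)) \<le> e + 1 + C"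
      using coercive[OF HP(1,2)[of n]] HP(3)[of n] by linarith
    then have "(\<integral>t. (P n t)\<^sup>2 \<partial>lborel) + (\<integral>t. (H n t)\<^sup>2 \<partial>lborel) + (\<integral>t. \<bar>t\<bar> * (H n t)\<^sup>2 \<partial>radial_measure) \<le> K"
      using c by (simp add: K_def pos_le_divide_eq mult.commute)
    moreover have "(\<integral>t. (P n t)\<^sup>2 \<partial>lborel) \<ge> 0" "(\<integral>t. (H n t)\<^sup>2 \<partial>lborel) \<ge> 0"
      "(\<integral>t. \<bar>t\<bar> * (H n t)\<^sup>2 \<partial>radial_measure) \<ge> 0"
      by (intro integral_nonneg_AE; simp)+
    ultimately show "(\<integral>t. (P n t)\<^sup>2 \<partial>lborel) \<le> K" "(\<integral>t. (H n t)\<^sup>2 \<partial>lborel) \<le> K"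
      "(\<integral>t. \<bar>t\<bar> * (H n t)\<^sup>2 \<partial>radial_measure) \<le> K" by linarith+
  qed
  obtain h g where hg: "energy_profile h g" "(\<integral>t. (h t)\<^sup>2 \<partial>radial_measure) = lam"
    "\<And>a b. a \<le> b \<Longrightarrow> set_integrable lborel {a..b} g"
    "\<And>a b. a \<le> b \<Longrightarrow> h b - h a = (LINT t:{a..b}|lborel. g t)"
    "profile_energy \<gamma> m h g \<le> e"
    using energy_profile_compactness[OF HP(1,2) bounds \<open>\<gamma> > 0\<close> conv] by blast
  \<comment> \<open>At the origin \<open>ln 0 = 0\<close> gives the value \<open>h 0\<close>, so
    nonnegativity holds at every point and not just almost everywhere.\<close>
  define u where "u = (\<lambda>x::pt2. complex_of_real (h (ln (norm x))))"
  note R = energy_profile_realize[OF hg(1,3,4), folded u_def]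
  have uS: "u \<in> S" using R(1,2) hg(2) by (simp add: S_def)
  have min: "Em \<gamma> m u = e" using e_le[OF uS] R(3) hg(5) by (simp add: antisym)
  have "em \<gamma> m lam = ereal (Em \<gamma> m u)"
    unfolding em_def S_def[symmetric]
  proof (rule antisym)
    show "(INF u\<in>S. ereal (Em \<gamma> m u)) \<le> ereal (Em \<gamma> m u)" using uS by (rule INF_lower)
    show "ereal (Em \<gamma> m u) \<le> (INF u\<in>S. ereal (Em \<gamma> m u))"
      using e_le min by (intro INF_greatest) simp
  qed
  moreover have "h t \<ge> 0" for t using hg(1) by (simp add: energy_profile_def)
  ultimately show ?thesis
    using uS by (intro exI[of _ u]) (auto simp: S_def u_def)
qed

end
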